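(* Let $n\ge 2$ and let $m_1<\cdots<m_n$ be an arithmetic sequence of positive integers, i.e. $m_i=m_1+(i-1)d$ for all $i\in\{1,\ldots,n\}$ with $d\in\mathbb{Z}^+$, and suppose $\gcd\{m_1,d\}=1$. Then $K[\mathcal{C}]$ is Gorenstein if and only if $m_1\equiv 2\pmod{n-1}$.
   Context: $K$ is an infinite field and $R=K[x_1,\ldots,x_{n+1}]$. For positive integers $m_1<\cdots<m_n$, the associated projective monomial curve $\mathcal{C}\subset\mathbb{P}^n_K$ is parametrically defined by $x_i=u^{m_i}v^{m_n-m_i}$ for $1\le i\le n$ and $x_{n+1}=v^{m_n}$. Its vanishing ideal $I(\mathcal{C})\subset R$ is the kernel of the $K$-algebra homomorphism $R\to K[u,v]$, $x_i\mapsto u^{m_i}v^{m_n-m_i}$ ($1\le i\le n$), $x_{n+1}\mapsto v^{m_n}$, and $K[\mathcal{C}]=R/I(\mathcal{C})$. $K[\mathcal{C}]$ is Gorenstein if it is Cohen-Macaulay and the last nonzero free module in its minimal graded free resolution over $R$ has rank $1$. *)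

theory Defs
  imports "HOL-Algebra.Algebra" "HOL-Library.Poly_Mapping" "HOL-Library.Extended_Nat"
    "HOL-Number_Theory.Cong"
begin

section \<open>Polynomial rings over a field\<close>

text \<open>Exponent vectors are finitely supported functions \<open>nat \<Rightarrow>\<^sub>0 nat\<close>; a polynomial maps
  finitely many of them to nonzero coefficients. The number of variables is controlled by the
  set of admissible variable indices, so that it may depend on a natural number.\<close>

type_synonym 'k mpoly = "(nat \<Rightarrow>\<^sub>0 nat) \<Rightarrow>\<^sub>0 'k"

definition poly_ring :: "nat set \<Rightarrow> ('k::field) mpoly ring" where
  "poly_ring V = \<lparr>carrier = {f. \<forall>t\<in>Poly_Mapping.keys f. Poly_Mapping.keys t \<subseteq> V},
     monoid.mult = (*), one = 1, ring.zero = 0, add = (+)\<rparr>"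

definition Const :: "'k::field \<Rightarrow> 'k mpoly" where
  "Const c = Poly_Mapping.single 0 c"

definition Var :: "nat \<Rightarrow> ('k::field) mpoly" where
  "Var i = Poly_Mapping.single (Poly_Mapping.single i 1) 1"

text \<open>The \<open>K\<close>-algebra homomorphism that sends the variable \<open>i\<close> to \<open>\<phi> i\<close>.\<close>

definition poly_subst :: "(nat \<Rightarrow> 'k mpoly) \<Rightarrow> ('k::field) mpoly \<Rightarrow> 'k mpoly" where
  "poly_subst \<phi> f = (\<Sum>t\<in>Poly_Mapping.keys f. Const (Poly_Mapping.lookup f t) *
     (\<Prod>i\<in>Poly_Mapping.keys t. \<phi> i ^ Poly_Mapping.lookup t i))"

definition monom_degree :: "(nat \<Rightarrow>\<^sub>0 nat) \<Rightarrow> nat" where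
  "monom_degree t = (\<Sum>i\<in>Poly_Mapping.keys t. Poly_Mapping.lookup t i)"

text \<open>Graded pieces for the standard grading, indexed by the integers (and zero in negative
  degrees).\<close>

definition homog_part :: "nat set \<Rightarrow> int \<Rightarrow> ('k::field) mpoly set" where
  "homog_part V e =
     {f \<in> carrier (poly_ring V). \<forall>t\<in>Poly_Mapping.keys f. int (monom_degree t) = e}"

definition irrelevant_ideal :: "nat set \<Rightarrow> ('k::field) mpoly set" where
  "irrelevant_ideal V = genideal (poly_ring V) (Var ` V)"

section \<open>Krull dimension, depth and Cohen--Macaulayness\<close>

definition krull_dim :: "('a, 'b) ring_scheme \<Rightarrow> enat" where
  "krull_dim A = Sup {enat k | k. \<exists>P. (\<forall>i\<le>k. primeideal (P i) A) \<and> (\<forall>i<k. P i \<subset> P (Suc i))}"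

definition regular_sequence :: "('a, 'b) ring_scheme \<Rightarrow> 'a list \<Rightarrow> bool" where
  "regular_sequence A xs \<longleftrightarrow>
     set xs \<subseteq> carrier A \<and>
     genideal A (set xs) \<noteq> carrier A \<and>
     (\<forall>i<length xs. \<forall>a\<in>carrier A.
        xs ! i \<otimes>\<^bsub>A\<^esub> a \<in> genideal A (set (take i xs)) \<longrightarrow> a \<in> genideal A (set (take i xs)))"

definition depth :: "('a, 'b) ring_scheme \<Rightarrow> 'a set \<Rightarrow> enat" where
  "depth A I = Sup {enat (length xs) | xs. regular_sequence A xs \<and> set xs \<subseteq> I}"

text \<open>Cohen--Macaulayness of the graded \<open>K\<close>-algebra \<open>R/J\<close>, \<open>J\<close> a homogeneous ideal of
  \<open>R = poly_ring V\<close>: the depth with respect to the irrelevant maximal ideal of \<open>R/J\<close> equals the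
  Krull dimension.\<close>

definition graded_cohen_macaulay :: "nat set \<Rightarrow> ('k::field) mpoly set \<Rightarrow> bool" where
  "graded_cohen_macaulay V J \<longleftrightarrow>
     depth (poly_ring V Quot J) ((\<lambda>f. J +>\<^bsub>poly_ring V\<^esub> f) ` irrelevant_ideal V)
       = krull_dim (poly_ring V Quot J)"

section \<open>Minimal graded free resolutions\<close>

text \<open>The list \<open>as\<close> of integers encodes the graded free module \<open>\<Oplus>\<^sub>j R(-as!j)\<close>, whose rank is the
  length of \<open>as\<close>. Its elements are the vectors of polynomials that are extended by zero beyond
  the rank. The multiplicative fields of the record play no role for modules.\<close>

definition free_mod :: "nat set \<Rightarrow> int list \<Rightarrow> (('k::field) mpoly, nat \<Rightarrow> 'k mpoly) module" where
  "free_mod V as = \<lparr>carrier = {v. (\<forall>j<length as. v j \<in> carrier (poly_ring V)) \<and>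
                               (\<forall>j\<ge>length as. v j = 0)},
     monoid.mult = undefined, one = undefined, ring.zero = (\<lambda>j. 0), add = (\<lambda>v w j. v j + w j),
     smult = (\<lambda>r v j. r * v j)\<rparr>"

definition free_part :: "nat set \<Rightarrow> int list \<Rightarrow> int \<Rightarrow> (nat \<Rightarrow> ('k::field) mpoly) set" where
  "free_part V as e = {v \<in> carrier (free_mod V as).
     \<forall>j<length as. v j \<in> homog_part V (e - as ! j)}"

text \<open>The quotient \<open>R/J\<close> as an \<open>R\<close>-module, and its induced grading.\<close>

definition quot_mod :: "nat set \<Rightarrow> ('k::field) mpoly set \<Rightarrow> ('k mpoly, 'k mpoly set) module" where
  "quot_mod V J = (let A = poly_ring V Quot J in
     \<lparr>carrier = carrier A, monoid.mult = monoid.mult A, one = one A, ring.zero = ring.zero A, add = add A,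
      smult = (\<lambda>r a. (J +>\<^bsub>poly_ring V\<^esub> r) \<otimes>\<^bsub>A\<^esub> a)\<rparr>)"

definition quot_part :: "nat set \<Rightarrow> ('k::field) mpoly set \<Rightarrow> int \<Rightarrow> 'k mpoly set set" where
  "quot_part V J e = (\<lambda>f. J +>\<^bsub>poly_ring V\<^esub> f) ` homog_part V e"

definition module_homs ::
  "('r, 'x) ring_scheme \<Rightarrow> ('r, 'a, 'y) module_scheme \<Rightarrow> ('r, 'b, 'z) module_scheme \<Rightarrow> ('a \<Rightarrow> 'b) set"
where
  "module_homs R M N = {f \<in> carrier M \<rightarrow> carrier N.
     (\<forall>x\<in>carrier M. \<forall>y\<in>carrier M. f (x \<oplus>\<^bsub>M\<^esub> y) = f x \<oplus>\<^bsub>N\<^esub> f y) \<and>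
     (\<forall>r\<in>carrier R. \<forall>x\<in>carrier M. f (r \<odot>\<^bsub>M\<^esub> x) = r \<odot>\<^bsub>N\<^esub> f x)}"

text \<open>A graded free resolution
  \<open>\<dots> \<rightarrow> F 2 \<rightarrow> F 1 \<rightarrow> F 0 \<rightarrow> R/J \<rightarrow> 0\<close> with maps \<open>d k : F (k+1) \<rightarrow> F k\<close> and
  \<open>\<epsilon> : F 0 \<rightarrow> R/J\<close> of degree 0.\<close>

definition graded_free_resolution ::
  "nat set \<Rightarrow> ('k::field) mpoly set \<Rightarrow> (nat \<Rightarrow> int list) \<Rightarrow>
   (nat \<Rightarrow> (nat \<Rightarrow> 'k mpoly) \<Rightarrow> (nat \<Rightarrow> 'k mpoly)) \<Rightarrow> ((nat \<Rightarrow> 'k mpoly) \<Rightarrow> 'k mpoly set) \<Rightarrow> bool"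
where
  "graded_free_resolution V J F d \<epsilon> \<longleftrightarrow>
     \<epsilon> \<in> module_homs (poly_ring V) (free_mod V (F 0)) (quot_mod V J) \<and>
     (\<forall>e. \<epsilon> ` free_part V (F 0) e \<subseteq> quot_part V J e) \<and>
     (\<forall>k. d k \<in> module_homs (poly_ring V) (free_mod V (F (Suc k))) (free_mod V (F k))) \<and>
     (\<forall>k e. d k ` free_part V (F (Suc k)) e \<subseteq> free_part V (F k) e) \<and>
     \<epsilon> ` carrier (free_mod V (F 0)) = carrier (quot_mod V J) \<and>
     d 0 ` carrier (free_mod V (F (Suc 0))) = a_kernel (free_mod V (F 0)) (quot_mod V J) \<epsilon> \<and>
     (\<forall>k. d (Suc k) ` carrier (free_mod V (F (Suc (Suc k)))) =
          a_kernel (free_mod V (F (Suc k))) (free_mod V (F k)) (d k))"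

text \<open>Minimality: the image of \<open>F (k+1)\<close> lies in \<open>\<mm> F k\<close>, where \<open>\<mm>\<close> is the irrelevant ideal of
  \<open>R\<close>; membership in \<open>\<mm> F k\<close> is tested on coordinates.\<close>

definition minimal_graded_free_resolution ::
  "nat set \<Rightarrow> ('k::field) mpoly set \<Rightarrow> (nat \<Rightarrow> int list) \<Rightarrow>
   (nat \<Rightarrow> (nat \<Rightarrow> 'k mpoly) \<Rightarrow> (nat \<Rightarrow> 'k mpoly)) \<Rightarrow> ((nat \<Rightarrow> 'k mpoly) \<Rightarrow> 'k mpoly set) \<Rightarrow> bool"
where
  "minimal_graded_free_resolution V J F d \<epsilon> \<longleftrightarrow>
     graded_free_resolution V J F d \<epsilon> \<and>
     (\<forall>k. \<forall>v\<in>carrier (free_mod V (F (Suc k))).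
        \<forall>j<length (F k). d k v j \<in> irrelevant_ideal V)"

text \<open>Minimal graded free resolutions are unique up to isomorphism, so asking for one whose last
  nonzero module \<open>F p\<close> has rank 1 is a condition on \<open>R/J\<close>.\<close>

definition graded_gorenstein :: "nat set \<Rightarrow> ('k::field) mpoly set \<Rightarrow> bool" where
  "graded_gorenstein V J \<longleftrightarrow>
     graded_cohen_macaulay V J \<and>
     (\<exists>F d \<epsilon> p. minimal_graded_free_resolution V J F d \<epsilon> \<and>
        length (F p) = 1 \<and> (\<forall>k>p. length (F k) = 0))"

section \<open>Projective monomial curves\<close>

text \<open>In \<open>K[u,v] = poly_ring {1,2}\<close> we take \<open>u = Var 1\<close> and \<open>v = Var 2\<close>.\<close>

definition curve_param :: "nat \<Rightarrow> (nat \<Rightarrow> nat) \<Rightarrow> nat \<Rightarrow> ('k::field) mpoly" where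
  "curve_param n m i =
     (if i = n + 1 then Var 2 ^ m n else Var 1 ^ m i * Var 2 ^ (m n - m i))"

definition curve_ideal :: "nat \<Rightarrow> (nat \<Rightarrow> nat) \<Rightarrow> ('k::field) mpoly set" where
  "curve_ideal n m =
     a_kernel (poly_ring {1..n+1}) (poly_ring {1,2}) (poly_subst (curve_param n m))"

end

theory Submission
  imports Defs "HOL-Library.Function_Algebras"
begin

text \<open>
  Write \<open>A\<close> for the coordinate ring, \<open>r = n - 1\<close> and \<open>M = m\<^sub>n\<close>. Dimension shifting along a minimal
  resolution \<open>F\<close> identifies \<open>F\<^sub>p / \<mm> F\<^sub>p\<close> with the Koszul homology \<open>H\<^sub>p(x\<^sub>1, \<dots>, x\<^sub>n\<^sub>+\<^sub>1; A)\<close>, and conversely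
  finiteness of the Koszul homology provides the finite generation needed to build a minimal
  resolution step by step, by the graded Nakayama lemma. Since \<open>x\<^sub>n\<^sub>+\<^sub>1, x\<^sub>n\<close> is a regular sequence on \<open>A\<close>, this
  is the Koszul homology of \<open>B = A / (x\<^sub>n, x\<^sub>n\<^sub>+\<^sub>1)\<close> with respect to \<open>x\<^sub>1, \<dots>, x\<^sub>n\<^sub>-\<^sub>1\<close>; it vanishes above
  degree \<open>r\<close> and is the socle of \<open>B\<close> in degree \<open>r\<close>. The monomial basis of \<open>B\<close> is an Apery set with \<open>M\<close>
  elements, and its socle is one-dimensional exactly if \<open>M - 2\<close>, equivalently \<open>m\<^sub>1 - 2\<close>, is divisible by \<open>r\<close>.
  For the Cohen--Macaulay property, depth and dimension are both at most 2 because three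
  elements of \<open>K[u, v]\<close> are algebraically dependent.
\<close>

section \<open>Comparing subquotients\<close>

text \<open>Minimal resolutions are not compared with one another: the rank of \<open>F p\<close> is
  read off an invariant of \<open>A\<close>, and only ranks 0 and 1 have to be recognized. The last
  module must sit at \<open>p = r\<close> because the homology there is the socle of an Artinian
  monomial quotient, which is never zero, while everything above vanishes. The homology is finite in
  every degree because the Apery set is finite.

  The congruence is a count. In the Apery set a monomial is a pair \<open>(j, t)\<close> with
  \<open>t < r\<close>, where \<open>j\<close> is its degree. A socle element satisfies
  \<open>M - 1 <= r j < M + t\<close>, so \<open>j\<close> is the least number with
  \<open>r j >= M - 1\<close>, and \<open>t\<close> runs over \<open>r j - M < t < r\<close>. These
  are \<open>M + r - 1 - r j\<close> values; there is exactly one iff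
  \<open>r j = M + r - 2\<close>, that is, iff \<open>M\<close> is 2 modulo \<open>r\<close>.
  Finally \<open>M = m 1 + r d\<close>.\<close>

text \<open>A quotient \<open>Z / B\<close> of subspaces is kept as the pair \<open>Z, B\<close>, without requiring \<open>B \<subseteq> Z\<close>, and
  isomorphisms are given by linear relations. The connecting homomorphisms below are then
  simply zigzags, and no quotient types are needed. The sign in \<open>y + s c z\<close> is absorbed by \<open>c\<close>.\<close>

definition quot_line :: "('k \<Rightarrow> 'a::ab_group_add \<Rightarrow> 'a) \<Rightarrow> 'a set \<Rightarrow> 'a set \<Rightarrow> bool" where
  "quot_line s Z B \<longleftrightarrow> (\<exists>z\<in>Z. z \<notin> B \<and> (\<forall>y\<in>Z. \<exists>c. y + s c z \<in> B))"

definition quot_fin :: "('k \<Rightarrow> 'a::ab_group_add \<Rightarrow> 'a) \<Rightarrow> 'a set \<Rightarrow> 'a set \<Rightarrow> bool" where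
  "quot_fin s Z B \<longleftrightarrow> (\<exists>(k::nat) g. (\<forall>i<k. g i \<in> Z) \<and> (\<forall>z\<in>Z. \<exists>c. z + (\<Sum>i<k. s (c i) (g i)) \<in> B))"

definition quot_iso :: "('k \<Rightarrow> 'a::ab_group_add \<Rightarrow> 'a) \<Rightarrow> 'a set \<Rightarrow> 'a set \<Rightarrow>
    ('k \<Rightarrow> 'b::ab_group_add \<Rightarrow> 'b) \<Rightarrow> 'b set \<Rightarrow> 'b set \<Rightarrow> bool" where
  "quot_iso s1 Z1 B1 s2 Z2 B2 \<longleftrightarrow> (\<exists>\<rho>.
     (\<forall>x y. \<rho> x y \<longrightarrow> x \<in> Z1 \<and> y \<in> Z2) \<and>
     (\<forall>x y x' y'. \<rho> x y \<longrightarrow> \<rho> x' y' \<longrightarrow> \<rho> (x + x') (y + y')) \<and>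
     (\<forall>c x y. \<rho> x y \<longrightarrow> \<rho> (s1 c x) (s2 c y)) \<and>
     (\<forall>x\<in>Z1. \<exists>y. \<rho> x y) \<and> (\<forall>y\<in>Z2. \<exists>x. \<rho> x y) \<and>
     (\<forall>x y. \<rho> x y \<longrightarrow> (x \<in> B1 \<longleftrightarrow> y \<in> B2)))"

lemma quot_isoI:
  assumes "\<And>x y. \<rho> x y \<Longrightarrow> x \<in> Z1" "\<And>x y. \<rho> x y \<Longrightarrow> y \<in> Z2"
    and "\<And>x y x' y'. \<rho> x y \<Longrightarrow> \<rho> x' y' \<Longrightarrow> \<rho> (x + x') (y + y')"
    and "\<And>c x y. \<rho> x y \<Longrightarrow> \<rho> (s1 c x) (s2 c y)"
    and "\<And>x. x \<in> Z1 \<Longrightarrow> \<exists>y. \<rho> x y" "\<And>y. y \<in> Z2 \<Longrightarrow> \<exists>x. \<rho> x y"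
    and "\<And>x y. \<rho> x y \<Longrightarrow> x \<in> B1 \<Longrightarrow> y \<in> B2" "\<And>x y. \<rho> x y \<Longrightarrow> y \<in> B2 \<Longrightarrow> x \<in> B1"
  shows "quot_iso s1 Z1 B1 s2 Z2 B2"
  unfolding quot_iso_def using assms by (intro exI[of _ \<rho>]) meson

lemma quot_iso_sym:
  assumes "quot_iso s1 Z1 B1 s2 Z2 B2"
  shows "quot_iso s2 Z2 B2 s1 Z1 B1"
proof -
  from assms obtain \<rho> where "(\<forall>x y. \<rho> x y \<longrightarrow> x \<in> Z1 \<and> y \<in> Z2) \<and>
     (\<forall>x y x' y'. \<rho> x y \<longrightarrow> \<rho> x' y' \<longrightarrow> \<rho> (x + x') (y + y')) \<and>
     (\<forall>c x y. \<rho> x y \<longrightarrow> \<rho> (s1 c x) (s2 c y)) \<and>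
     (\<forall>x\<in>Z1. \<exists>y. \<rho> x y) \<and> (\<forall>y\<in>Z2. \<exists>x. \<rho> x y) \<and>
     (\<forall>x y. \<rho> x y \<longrightarrow> (x \<in> B1 \<longleftrightarrow> y \<in> B2))"
    unfolding quot_iso_def by blast
  then show ?thesis unfolding quot_iso_def by (intro exI[of _ "\<lambda>x y. \<rho> y x"]) blast
qed

lemma quot_iso_trans:
  assumes "quot_iso s1 Z1 B1 s2 Z2 B2" "quot_iso s2 Z2 B2 s3 Z3 B3"
  shows "quot_iso s1 Z1 B1 s3 Z3 B3"
proof -
  from assms(1) obtain \<rho> where 1: "\<forall>x y. \<rho> x y \<longrightarrow> x \<in> Z1 \<and> y \<in> Z2"
     "\<forall>x y x' y'. \<rho> x y \<longrightarrow> \<rho> x' y' \<longrightarrow> \<rho> (x + x') (y + y')"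
     "\<forall>c x y. \<rho> x y \<longrightarrow> \<rho> (s1 c x) (s2 c y)"
     "\<forall>x\<in>Z1. \<exists>y. \<rho> x y" "\<forall>y\<in>Z2. \<exists>x. \<rho> x y"
     "\<forall>x y. \<rho> x y \<longrightarrow> (x \<in> B1 \<longleftrightarrow> y \<in> B2)"
    unfolding quot_iso_def by blast
  from assms(2) obtain \<rho>' where 2: "\<forall>x y. \<rho>' x y \<longrightarrow> x \<in> Z2 \<and> y \<in> Z3"
     "\<forall>x y x' y'. \<rho>' x y \<longrightarrow> \<rho>' x' y' \<longrightarrow> \<rho>' (x + x') (y + y')"
     "\<forall>c x y. \<rho>' x y \<longrightarrow> \<rho>' (s2 c x) (s3 c y)"
     "\<forall>x\<in>Z2. \<exists>y. \<rho>' x y" "\<forall>y\<in>Z3. \<exists>x. \<rho>' x y"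
     "\<forall>x y. \<rho>' x y \<longrightarrow> (x \<in> B2 \<longleftrightarrow> y \<in> B3)"
    unfolding quot_iso_def by blast
  show ?thesis
    by (rule quot_isoI[of "\<lambda>x z. \<exists>y. \<rho> x y \<and> \<rho>' y z"]) (use 1 2 in metis)+
qed

lemma quot_iso_zero:
  assumes "quot_iso s1 Z1 B1 s2 Z2 B2"
  shows "Z1 \<subseteq> B1 \<longleftrightarrow> Z2 \<subseteq> B2"
  using assms unfolding quot_iso_def by (metis subset_iff)

lemma quot_iso_line1:
  assumes "quot_iso s1 Z1 B1 s2 Z2 B2" "quot_line s1 Z1 B1"
  shows "quot_line s2 Z2 B2"
proof -
  from assms(1) obtain \<rho> where r: "\<forall>x y. \<rho> x y \<longrightarrow> x \<in> Z1 \<and> y \<in> Z2"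
     "\<forall>x y x' y'. \<rho> x y \<longrightarrow> \<rho> x' y' \<longrightarrow> \<rho> (x + x') (y + y')"
     "\<forall>c x y. \<rho> x y \<longrightarrow> \<rho> (s1 c x) (s2 c y)"
     "\<forall>x\<in>Z1. \<exists>y. \<rho> x y" "\<forall>y\<in>Z2. \<exists>x. \<rho> x y"
     "\<forall>x y. \<rho> x y \<longrightarrow> (x \<in> B1 \<longleftrightarrow> y \<in> B2)"
    unfolding quot_iso_def by blast
  from assms(2) obtain z where z: "z \<in> Z1" "z \<notin> B1" "\<And>y. y \<in> Z1 \<Longrightarrow> \<exists>c. y + s1 c z \<in> B1"
    unfolding quot_line_def by blast
  obtain w where w: "\<rho> z w" using bspec[OF r(4) z(1)] by (elim exE)
  have "\<exists>c. y + s2 c w \<in> B2" if yZ: "y \<in> Z2" for y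
  proof -
    obtain x where x: "\<rho> x y" using bspec[OF r(5) yZ] by (elim exE)
    then have "x \<in> Z1" using r(1) by simp
    from z(3)[OF this] obtain c where c: "x + s1 c z \<in> B1" by (elim exE)
    have "\<rho> (x + s1 c z) (y + s2 c w)" using r(2)[rule_format, OF x r(3)[rule_format, OF w]] .
    then have "y + s2 c w \<in> B2" using r(6) c by simp
    then show ?thesis by (rule exI)
  qed
  moreover have "w \<in> Z2" "w \<notin> B2" using w z r(1,6) by simp_all
  ultimately show ?thesis unfolding quot_line_def by (intro bexI[of _ w]) simp_all
qed

lemma quot_iso_line:
  assumes "quot_iso s1 Z1 B1 s2 Z2 B2"
  shows "quot_line s1 Z1 B1 \<longleftrightarrow> quot_line s2 Z2 B2"
  using quot_iso_line1[OF assms] quot_iso_line1[OF quot_iso_sym[OF assms]] by blast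

lemma quot_iso_fin:
  assumes iso: "quot_iso s1 Z1 B1 s2 Z2 B2" and fin: "quot_fin s1 Z1 B1"
  shows "quot_fin s2 Z2 B2"
proof -
  from iso obtain \<rho> where r: "\<forall>x y. \<rho> x y \<longrightarrow> x \<in> Z1 \<and> y \<in> Z2"
     "\<forall>x y x' y'. \<rho> x y \<longrightarrow> \<rho> x' y' \<longrightarrow> \<rho> (x + x') (y + y')"
     "\<forall>c x y. \<rho> x y \<longrightarrow> \<rho> (s1 c x) (s2 c y)"
     "\<forall>x\<in>Z1. \<exists>y. \<rho> x y" "\<forall>y\<in>Z2. \<exists>x. \<rho> x y"
     "\<forall>x y. \<rho> x y \<longrightarrow> (x \<in> B1 \<longleftrightarrow> y \<in> B2)"
    unfolding quot_iso_def by blast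
  from fin obtain k :: nat and g where g: "\<forall>i<k. g i \<in> Z1"
    "\<And>z. z \<in> Z1 \<Longrightarrow> \<exists>c. z + (\<Sum>i<k. s1 (c i) (g i)) \<in> B1"
    unfolding quot_fin_def by blast
  define h where "h i = (SOME y. \<rho> (g i) y)" for i
  have h: "\<rho> (g i) (h i)" if "i < k" for i
    using g(1) r(4) that unfolding h_def by (metis someI_ex)
  have "\<exists>c. z + (\<Sum>i<k. s2 (c i) (h i)) \<in> B2" if z: "z \<in> Z2" for z
  proof -
    obtain w where w: "\<rho> w z" using r(5) z by blast
    then obtain c where c: "w + (\<Sum>i<k. s1 (c i) (g i)) \<in> B1" using g(2) r(1) by blast
    have "j \<le> k \<Longrightarrow> \<rho> (w + (\<Sum>i<j. s1 (c i) (g i))) (z + (\<Sum>i<j. s2 (c i) (h i)))" for j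
    proof (induction j)
      case 0 then show ?case using w by simp
    next
      case (Suc j)
      then have "\<rho> (s1 (c j) (g j)) (s2 (c j) (h j))" using h r(3) by auto
      with Suc r(2) have "\<rho> (w + (\<Sum>i<j. s1 (c i) (g i)) + s1 (c j) (g j))
        (z + (\<Sum>i<j. s2 (c i) (h i)) + s2 (c j) (h j))" by auto
      then show ?case by (simp add: add.assoc)
    qed
    then show ?thesis using c r(6) by blast
  qed
  then show ?thesis unfolding quot_fin_def using h r(1) by blast
qed

text \<open>Gives finite dimension of \<open>Z / B\<close> with no basis at hand: it is enough that
  finitely many linear functionals detect membership in \<open>B\<close>. Induction removes one
  functional at a time; either it vanishes on \<open>Z\<close>, or one \<open>z0\<close> off its
  kernel is added to the generators found for the kernel.\<close>

lemma quot_fin_coords: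
  fixes \<kappa> :: "'i \<Rightarrow> 'a::ab_group_add \<Rightarrow> 'k::field" and s :: "'k \<Rightarrow> 'a \<Rightarrow> 'a"
  assumes "finite I"
    and add: "\<And>x y. x \<in> Z \<Longrightarrow> y \<in> Z \<Longrightarrow> x + y \<in> Z" and sc: "\<And>c x. x \<in> Z \<Longrightarrow> s c x \<in> Z"
    and \<kappa>_add: "\<And>i x y. \<kappa> i (x + y) = \<kappa> i x + \<kappa> i y" and \<kappa>_s: "\<And>i c x. \<kappa> i (s c x) = c * \<kappa> i x"
    and "\<And>z. z \<in> Z \<Longrightarrow> \<forall>i\<in>I. \<kappa> i z = 0 \<Longrightarrow> z \<in> B"
  shows "quot_fin s Z B"
  using assms(1,2,3,6)
proof (induction I arbitrary: Z rule: finite_induct)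
  case empty
  then show ?case unfolding quot_fin_def by (intro exI[of _ 0]) auto
next
  case (insert i0 I)
  let ?Z = "{z \<in> Z. \<kappa> i0 z = 0}"
  have "quot_fin s ?Z B"
    by (rule insert.IH) (use insert.prems \<kappa>_add \<kappa>_s in auto)
  then obtain k :: nat and g where g: "\<forall>i<k. g i \<in> ?Z"
    "\<And>z. z \<in> ?Z \<Longrightarrow> \<exists>c. z + (\<Sum>i<k. s (c i) (g i)) \<in> B"
    unfolding quot_fin_def by blast
  show ?case
  proof (cases "\<exists>z\<in>Z. \<kappa> i0 z \<noteq> 0")
    case False
    then have "?Z = Z" by auto
    with \<open>quot_fin s ?Z B\<close> show ?thesis by simp
  next
    case True
    then obtain z0 where z0: "z0 \<in> Z" "\<kappa> i0 z0 \<noteq> 0" by blast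
    let ?g = "g(k := z0)"
    have "\<exists>c. z + (\<Sum>i<Suc k. s (c i) (?g i)) \<in> B" if z: "z \<in> Z" for z
    proof -
      define e where "e = - \<kappa> i0 z / \<kappa> i0 z0"
      have "z + s e z0 \<in> ?Z" using insert.prems z z0 \<kappa>_add \<kappa>_s by (auto simp: e_def)
      then obtain c where "z + s e z0 + (\<Sum>i<k. s (c i) (g i)) \<in> B" using g(2) by blast
      then have "z + (\<Sum>i<Suc k. s ((c(k := e)) i) (?g i)) \<in> B"
        by (simp add: ac_simps)
      then show ?thesis by blast
    qed
    moreover have "\<forall>i<Suc k. ?g i \<in> Z" using g(1) z0 by (auto simp: less_Suc_eq)
    ultimately show ?thesis unfolding quot_fin_def by blast
  qed
qed

section \<open>Koszul homology\<close>

text \<open>The Koszul complex of a list \<open>l\<close> of operators: a list of truth values as long as \<open>l\<close> is the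
  basis vector of the exterior algebra in which the entries marked \<open>True\<close> occur. A module is again
  a pair \<open>M, N\<close> that stands for \<open>M / N\<close>.\<close>

definition kchains :: "nat \<Rightarrow> int \<Rightarrow> 'a::zero set \<Rightarrow> (bool list \<Rightarrow> 'a) set" where
  "kchains k q M = {f. \<forall>S. if length S = k \<and> int (count_list S True) = q then f S \<in> M else f S = 0}"

fun kpair :: "(bool list \<Rightarrow> 'a::zero) \<Rightarrow> (bool list \<Rightarrow> 'a) \<Rightarrow> bool list \<Rightarrow> 'a" where
  "kpair f g [] = 0"
| "kpair f g (False # S) = f S"
| "kpair f g (True # S) = g S"

text \<open>The complex of \<open>a # l\<close> is the mapping cone of multiplication by
  \<open>a\<close> on the complex of \<open>l\<close>: a chain is a pair \<open>(f0, f1)\<close>,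
  split by the first entry of the index list, with differential
  \<open>(d f0 + a f1, - d f1)\<close>. The sign makes the two mixed terms cancel in
  \<open>kd_kd\<close>.\<close>

fun kd :: "(nat \<Rightarrow> 'a \<Rightarrow> 'a) \<Rightarrow> nat list \<Rightarrow> (bool list \<Rightarrow> 'a::ab_group_add) \<Rightarrow> bool list \<Rightarrow> 'a" where
  "kd act [] f = 0"
| "kd act (a # l) f = kpair (kd act l (\<lambda>S. f (False # S)) + (\<lambda>S. act a (f (True # S)))) (- kd act l (\<lambda>S. f (True # S)))"

abbreviation (input) fscale :: "('k \<Rightarrow> 'a \<Rightarrow> 'a) \<Rightarrow> 'k \<Rightarrow> ('i \<Rightarrow> 'a) \<Rightarrow> 'i \<Rightarrow> 'a" where
  "fscale s c f \<equiv> (\<lambda>S. s c (f S))"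

definition kcyc :: "(nat \<Rightarrow> 'a \<Rightarrow> 'a) \<Rightarrow> nat list \<Rightarrow> int \<Rightarrow> 'a::ab_group_add set \<Rightarrow> 'a set \<Rightarrow> (bool list \<Rightarrow> 'a) set" where
  "kcyc act l q M N = {f \<in> kchains (length l) q M. kd act l f \<in> kchains (length l) (q - 1) N}"

definition kbnd :: "(nat \<Rightarrow> 'a \<Rightarrow> 'a) \<Rightarrow> nat list \<Rightarrow> int \<Rightarrow> 'a::ab_group_add set \<Rightarrow> 'a set \<Rightarrow> (bool list \<Rightarrow> 'a) set" where
  "kbnd act l q M N = {f \<in> kchains (length l) q M.
     \<exists>g\<in>kchains (length l) (q + 1) M. f - kd act l g \<in> kchains (length l) q N}"

lemma kpair_add: "kpair f g + kpair f' g' = kpair (f + f') (g + g')"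
  for f :: "bool list \<Rightarrow> 'a::ab_group_add"
proof
  fix S show "(kpair f g + kpair f' g') S = kpair (f + f') (g + g') S"
    by (cases "(f,g,S)" rule: kpair.cases) auto
qed

lemma kpair_diff: "kpair f g - kpair f' g' = kpair (f - f') (g - g')"
  for f :: "bool list \<Rightarrow> 'a::ab_group_add"
proof
  fix S show "(kpair f g - kpair f' g') S = kpair (f - f') (g - g') S"
    by (cases "(f,g,S)" rule: kpair.cases) auto
qed

lemma kpair_uminus: "- kpair f g = kpair (- f) (- g)"
  for f :: "bool list \<Rightarrow> 'a::ab_group_add"
proof
  fix S show "(- kpair f g) S = kpair (- f) (- g) S"
    by (cases "(f,g,S)" rule: kpair.cases) auto
qed

lemma kpair_zero: "kpair 0 0 = (0 :: bool list \<Rightarrow> 'a::ab_group_add)"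
proof
  fix S show "kpair 0 0 S = (0 :: bool list \<Rightarrow> 'a) S"
    by (cases "(0 :: bool list \<Rightarrow> 'a, 0 :: bool list \<Rightarrow> 'a, S)" rule: kpair.cases) auto
qed

lemma kpair_map: "(\<And>S. h 0 = 0) \<Longrightarrow> (\<lambda>S. h (kpair f g S)) = kpair (\<lambda>S. h (f S)) (\<lambda>S. h (g S))"
proof
  fix S assume "\<And>S. h 0 = 0"
  then show "h (kpair f g S) = kpair (\<lambda>S. h (f S)) (\<lambda>S. h (g S)) S"
    by (cases "(f,g,S)" rule: kpair.cases) auto
qed

lemma kchains_on: "f \<in> kchains k q M \<Longrightarrow> length S = k \<Longrightarrow> int (count_list S True) = q \<Longrightarrow> f S \<in> M"
  by (simp add: kchains_def)

lemma kchains_off: "f \<in> kchains k q M \<Longrightarrow> \<not> (length S = k \<and> int (count_list S True) = q) \<Longrightarrow> f S = 0"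
  unfolding kchains_def mem_Collect_eq by (metis (full_types))

lemma kchainsI:
  assumes "\<And>S. length S = k \<Longrightarrow> int (count_list S True) = q \<Longrightarrow> f S \<in> M"
    and "\<And>S. \<not> (length S = k \<and> int (count_list S True) = q) \<Longrightarrow> f S = 0"
  shows "f \<in> kchains k q M"
  using assms unfolding kchains_def by (simp only: mem_Collect_eq split: if_split) blast

lemma kchains_zero: "0 \<in> M \<Longrightarrow> 0 \<in> kchains k q M"
  by (auto simp: kchains_def)

lemma kchains_mem: "f \<in> kchains k q M \<Longrightarrow> 0 \<in> M \<Longrightarrow> f S \<in> M"
  unfolding kchains_def mem_Collect_eq by (metis (full_types))

lemma kchains_mono: "M \<subseteq> M' \<Longrightarrow> kchains k q M \<subseteq> kchains k q M'"
  unfolding kchains_def by (force split: if_splits)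

lemma kchains_kpair:
  assumes "(0::'a::zero) \<in> M"
  shows "kpair f g \<in> kchains (Suc k) q M \<longleftrightarrow> f \<in> kchains k q M \<and> g \<in> kchains k (q - 1) (M :: 'a set)"
    (is "?L \<longleftrightarrow> ?R")
proof
  assume L: ?L
  have "if length S = k \<and> int (count_list S True) = q then f S \<in> M else f S = 0" for S
    using L[unfolded kchains_def mem_Collect_eq, rule_format, of "False # S"] by auto
  moreover have "if length S = k \<and> int (count_list S True) = q - 1 then g S \<in> M else g S = 0" for S
    using L[unfolded kchains_def mem_Collect_eq, rule_format, of "True # S"] by (auto split: if_splits)
  ultimately show ?R unfolding kchains_def by blast
next
  assume R: ?R
  have "if length S = Suc k \<and> int (count_list S True) = q then kpair f g S \<in> M else kpair f g S = 0" for S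
  proof (cases "(f,g,S)" rule: kpair.cases)
    case (2 f' g' T)
    then show ?thesis using R[THEN conjunct1, unfolded kchains_def mem_Collect_eq, rule_format, of T] by auto
  next
    case (3 f' g' T)
    have "int (count_list T True) = q - 1 \<longleftrightarrow> int (count_list (True # T) True) = q" by auto
    then show ?thesis using 3 R[THEN conjunct2, unfolded kchains_def mem_Collect_eq, rule_format, of T]
      by auto
  qed auto
  then show ?L unfolding kchains_def by blast
qed

lemma kchains_split:
  assumes "f \<in> kchains (Suc k) q M"
  shows "f = kpair (\<lambda>S. f (False # S)) (\<lambda>S. f (True # S))"
proof
  fix S
  have "f [] = 0" using assms unfolding kchains_def by auto
  then show "f S = kpair (\<lambda>S. f (False # S)) (\<lambda>S. f (True # S)) S"
    by (cases "(f,f,S)" rule: kpair.cases) auto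
qed

lemma kchains_cases:
  assumes "f \<in> kchains (Suc k) q M" "(0::'a::zero) \<in> M"
  obtains f0 f1 where "f = kpair f0 f1" "f0 \<in> kchains k q M" "f1 \<in> kchains k (q - 1) (M::'a set)"
  using kchains_split[OF assms(1)] assms kchains_kpair by metis

text \<open>Lifts chains one coefficient at a time. \<open>P 0 0\<close> allows the value 0 at lists
  of the wrong length or degree, so that the result is again a chain.\<close>

lemma kchains_choose:
  assumes "f \<in> kchains k q M'" "\<And>x. x \<in> M' \<Longrightarrow> \<exists>y\<in>M. P x y" "P 0 0"
  obtains g where "g \<in> kchains k q M" "\<And>S. P (f S) (g S)"
proof -
  have "\<forall>S. \<exists>y. (if length S = k \<and> int (count_list S True) = q then y \<in> M else y = 0) \<and> P (f S) y"
  proof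
    fix S
    note f = assms(1)[unfolded kchains_def mem_Collect_eq, rule_format, of S]
    show "\<exists>y. (if length S = k \<and> int (count_list S True) = q then y \<in> M else y = 0) \<and> P (f S) y"
    proof (cases "length S = k \<and> int (count_list S True) = q")
      case True
      then have "f S \<in> M'" using f by simp
      then show ?thesis using assms(2) True by auto
    next
      case False
      then have "f S = 0" using f by (simp only: if_False)
      then show ?thesis using assms(3) False by auto
    qed
  qed
  then obtain g where "\<forall>S. (if length S = k \<and> int (count_list S True) = q then g S \<in> M else g S = 0) \<and> P (f S) (g S)"
    by metis
  then show ?thesis using that unfolding kchains_def by auto
qed

lemma kd_kpair: "kd act (a # l) (kpair f g) = kpair (kd act l f + (\<lambda>S. act a (g S))) (- kd act l g)"
  by simp


text \<open>What the Koszul complex uses of a module over a polynomial ring: additive operators that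
  commute with each other and with the additive scalars. \<open>V\<close> enters through
  \<open>submod\<close>, as the set of operators under which a submodule is closed. The locale
  covers both vectors of polynomials and the target ring of the parametrization.\<close>

locale ops =
  fixes s :: "'k \<Rightarrow> 'a::ab_group_add \<Rightarrow> 'a" and act :: "nat \<Rightarrow> 'a \<Rightarrow> 'a" and V :: "nat set"
  assumes act_add: "act i (x + y) = act i x + act i y"
    and act_comm: "act i (act j x) = act j (act i x)"
    and act_s: "act i (s c x) = s c (act i x)"
    and s_add: "s c (x + y) = s c x + s c y"
begin

lemma act_zero [simp]: "act i 0 = 0"
  using act_add[of i 0 0] by simp

lemma s_zero [simp]: "s c 0 = 0"
  using s_add[of c 0 0] by simp

lemma act_uminus: "act i (- x) = - act i x"
  using act_add[of i x "- x"] by (simp add: eq_neg_iff_add_eq_0 add.commute)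

lemma s_uminus: "s c (- x) = - s c x"
  using s_add[of c x "- x"] by (simp add: eq_neg_iff_add_eq_0 add.commute)

definition submod :: "'a set \<Rightarrow> bool" where
  "submod M \<longleftrightarrow> 0 \<in> M \<and> (\<forall>x\<in>M. \<forall>y\<in>M. x + y \<in> M) \<and> (\<forall>x\<in>M. - x \<in> M) \<and>
     (\<forall>c. \<forall>x\<in>M. s c x \<in> M) \<and> (\<forall>i\<in>V. \<forall>x\<in>M. act i x \<in> M)"

lemma submodI:
  assumes "0 \<in> M" "\<And>x y. x \<in> M \<Longrightarrow> y \<in> M \<Longrightarrow> x + y \<in> M" "\<And>x. x \<in> M \<Longrightarrow> - x \<in> M"
    "\<And>c x. x \<in> M \<Longrightarrow> s c x \<in> M" "\<And>i x. i \<in> V \<Longrightarrow> x \<in> M \<Longrightarrow> act i x \<in> M"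
  shows "submod M"
  unfolding submod_def using assms by simp

lemma submodD:
  assumes "submod M"
  shows "0 \<in> M" "x \<in> M \<Longrightarrow> y \<in> M \<Longrightarrow> x + y \<in> M" "x \<in> M \<Longrightarrow> - x \<in> M"
    "x \<in> M \<Longrightarrow> s c x \<in> M" "i \<in> V \<Longrightarrow> x \<in> M \<Longrightarrow> act i x \<in> M" "x \<in> M \<Longrightarrow> y \<in> M \<Longrightarrow> x - y \<in> M"
  using assms unfolding submod_def by (blast, blast, blast, blast, blast) (metis assms submod_def uminus_add_conv_diff add.commute)

lemma submod_zero: "submod {0}"
  by (simp add: submod_def)

lemma kchains_add: "submod M \<Longrightarrow> f \<in> kchains k q M \<Longrightarrow> g \<in> kchains k q M \<Longrightarrow> f + g \<in> kchains k q M"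
  unfolding kchains_def using submodD(2) by (auto split: if_splits)

lemma kchains_uminus: "submod M \<Longrightarrow> f \<in> kchains k q M \<Longrightarrow> - f \<in> kchains k q M"
  unfolding kchains_def using submodD(3) by (auto split: if_splits)

lemma kchains_diff: "submod M \<Longrightarrow> f \<in> kchains k q M \<Longrightarrow> g \<in> kchains k q M \<Longrightarrow> f - g \<in> kchains k q M"
  unfolding kchains_def using submodD(6) by (auto split: if_splits)

lemma kchains_scale: "submod M \<Longrightarrow> f \<in> kchains k q M \<Longrightarrow> fscale s c f \<in> kchains k q M"
  unfolding kchains_def using submodD(4) by (auto split: if_splits)

lemma kchains_X: "submod M \<Longrightarrow> i \<in> V \<Longrightarrow> f \<in> kchains k q M \<Longrightarrow> (\<lambda>S. act i (f S)) \<in> kchains k q M"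
  unfolding kchains_def using submodD(5) by (auto split: if_splits)

lemma kchains_set_add:
  assumes "f \<in> kchains k q {y + act a x | y x. y \<in> N \<and> x \<in> M}" "0 \<in> N"
  obtains y x where "y \<in> kchains k q N" "x \<in> kchains k q M" "f = y + (\<lambda>S. act a (x S))"
proof -
  obtain x where x: "x \<in> kchains k q M" "\<And>S. f S - act a (x S) \<in> N"
  proof (rule kchains_choose[OF assms(1), of M "\<lambda>z x. z - act a x \<in> N"])
    fix z assume "z \<in> {y + act a x | y x. y \<in> N \<and> x \<in> M}"
    then show "\<exists>x\<in>M. z - act a x \<in> N" by (auto intro!: bexI)
  qed (use assms(2) in simp_all)
  have "(\<lambda>S. f S - act a (x S)) \<in> kchains k q N"
    using x(2) kchains_off[OF assms(1)] kchains_off[OF x(1)] by (intro kchainsI) simp_all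
  moreover have "f = (\<lambda>S. f S - act a (x S)) + (\<lambda>S. act a (x S))" by auto
  ultimately show ?thesis using that x by blast
qed

lemma kd_add: "kd act l (f + g) = kd act l f + kd act l g"
proof (induction l arbitrary: f g)
  case (Cons a l)
  have e: "(\<lambda>S. (f + g) (b # S)) = (\<lambda>S. f (b # S)) + (\<lambda>S. g (b # S))" for b by auto
  show ?case unfolding kd.simps e Cons kpair_add by (rule arg_cong2[where f=kpair]) (auto simp: act_add)
qed auto

lemma kd_uminus: "kd act l (- f) = - kd act l f"
proof (induction l arbitrary: f)
  case (Cons a l)
  have e: "(\<lambda>S. (- f) (b # S)) = - (\<lambda>S. f (b # S))" for b by auto
  show ?case unfolding kd.simps e Cons kpair_uminus by (rule arg_cong2[where f=kpair]) (auto simp: act_uminus)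
qed auto

lemma kd_diff: "kd act l (f - g) = kd act l f - kd act l g"
  using kd_add[of l f "- g"] by (simp add: kd_uminus)

lemma kd_zero [simp]: "kd act l 0 = 0"
  using kd_add[of l 0 0] by simp

lemma kd_X: "kd act l (\<lambda>S. act i (f S)) = (\<lambda>S. act i (kd act l f S))"
proof (induction l arbitrary: f)
  case Nil then show ?case by (simp add: zero_fun_def)
next
  case (Cons a l)
  show ?case unfolding kd.simps kpair_map[of "act i", OF act_zero] Cons
    by (rule arg_cong2[where f=kpair]) (auto simp: act_uminus act_add act_comm[of i a])
qed

lemma kd_scale: "kd act l (fscale s c f) = fscale s c (kd act l f)"
proof (induction l arbitrary: f)
  case Nil then show ?case by (simp add: zero_fun_def)
next
  case (Cons a l)
  show ?case unfolding kd.simps kpair_map[of "s c", OF s_zero] Cons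
    by (rule arg_cong2[where f=kpair]) (auto simp: s_uminus s_add act_s)
qed

lemma kd_kd: "kd act l (kd act l f) = 0"
proof (induction l arbitrary: f)
  case (Cons a l)
  show ?case unfolding kd.simps(2)[of act a l f] kd_kpair kd_add Cons kd_uminus kd_X
    by (subst kpair_zero[symmetric], rule arg_cong2[where f=kpair]) (auto simp: act_uminus)
qed auto

lemma kd_chains:
  assumes "submod M" "set l \<subseteq> V" "f \<in> kchains (length l) q M"
  shows "kd act l f \<in> kchains (length l) (q - 1) M"
  using assms(2,3)
proof (induction l arbitrary: f q)
  case Nil
  then show ?case using kchains_zero[unfolded zero_fun_def] submodD(1)[OF assms(1)] by simp
next
  case (Cons a l)
  note z = submodD(1)[OF assms(1)]
  obtain f0 f1 where f: "f = kpair f0 f1" "f0 \<in> kchains (length l) q M" "f1 \<in> kchains (length l) (q - 1) M"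
    using kchains_cases[of f "length l" q M] Cons.prems z by auto
  have "kd act l f0 + (\<lambda>S. act a (f1 S)) \<in> kchains (length l) (q - 1) M"
    using Cons f by (intro kchains_add kchains_X assms(1)) auto
  moreover have "- kd act l f1 \<in> kchains (length l) (q - 1 - 1) M"
    using Cons.IH[of f1 "q - 1"] Cons.prems f by (intro kchains_uminus assms(1)) auto
  ultimately show ?case unfolding f(1) kd_kpair using kchains_kpair[OF z] by auto
qed

lemma submod_reg:
  assumes "submod M" "submod N" "a \<in> V"
  shows "submod {y + act a x | y x. y \<in> N \<and> x \<in> M}" (is "submod ?N")
proof -
  have "0 = 0 + act a 0" by simp
  then have "0 \<in> ?N" using submodD(1)[OF assms(1)] submodD(1)[OF assms(2)] by blast
  moreover have "u + v \<in> ?N" if uv: "u \<in> ?N" "v \<in> ?N" for u v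
  proof -
    obtain y x y' x' where "u = y + act a x" "v = y' + act a x'" "y \<in> N" "x \<in> M" "y' \<in> N" "x' \<in> M"
      using uv by auto
    moreover from this have "u + v = (y + y') + act a (x + x')" by (simp add: act_add)
    ultimately show ?thesis using submodD(2)[OF assms(1)] submodD(2)[OF assms(2)] by blast
  qed
  moreover have "- u \<in> ?N" if uv: "u \<in> ?N" for u
  proof -
    obtain y x where "u = y + act a x" "y \<in> N" "x \<in> M"
      using uv by auto
    moreover from this have "- u = - y + act a (- x)" by (simp add: act_uminus)
    ultimately show ?thesis using submodD(3)[OF assms(1)] submodD(3)[OF assms(2)] by blast
  qed
  moreover have "s c u \<in> ?N" if uv: "u \<in> ?N" for u c
  proof -
    obtain y x where "u = y + act a x" "y \<in> N" "x \<in> M"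
      using uv by auto
    moreover from this have "s c u = s c y + act a (s c x)" by (simp add: act_s s_add)
    ultimately show ?thesis using submodD(4)[OF assms(1)] submodD(4)[OF assms(2)] by blast
  qed
  moreover have "act i u \<in> ?N" if uv: "i \<in> V" "u \<in> ?N" for i u
  proof -
    obtain y x where "u = y + act a x" "y \<in> N" "x \<in> M"
      using uv by auto
    moreover from this have "act i u = act i y + act a (act i x)" by (simp add: act_add act_comm)
    ultimately show ?thesis using submodD(5)[OF assms(1) uv(1)] submodD(5)[OF assms(2) uv(1)] by blast
  qed
  ultimately show ?thesis by (rule submodI)
qed

lemma kcyc_add: "submod M \<Longrightarrow> submod N \<Longrightarrow> f \<in> kcyc act l q M N \<Longrightarrow> g \<in> kcyc act l q M N \<Longrightarrow> f + g \<in> kcyc act l q M N"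
  unfolding kcyc_def by (auto simp: kd_add kchains_add)

lemma kcyc_scale: "submod M \<Longrightarrow> submod N \<Longrightarrow> f \<in> kcyc act l q M N \<Longrightarrow> fscale s c f \<in> kcyc act l q M N"
  unfolding kcyc_def by (auto simp: kd_scale kchains_scale)

text \<open>In the cone, a cycle \<open>(f0, f1)\<close> satisfies \<open>d f0 = - a f1\<close>
  modulo \<open>N\<close>, so \<open>f0\<close> is a cycle modulo \<open>N + a M\<close>. Since
  \<open>a\<close> is a nonzerodivisor on \<open>M / N\<close>, \<open>f1\<close> is recovered from
  \<open>f0\<close> modulo \<open>N\<close>. Dropping \<open>f1\<close> is therefore the isomorphism
  that removes \<open>a\<close> from the list.\<close>

theorem koszul_regular:
  assumes M: "submod M" and N: "submod N" and NM: "N \<subseteq> M" and a: "a \<in> V" and l: "set l \<subseteq> V"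
    and reg: "\<And>x. x \<in> M \<Longrightarrow> act a x \<in> N \<Longrightarrow> x \<in> N"
  defines "N' \<equiv> {y + act a x | y x. y \<in> N \<and> x \<in> M}"
  shows "quot_iso (fscale s) (kcyc act (a # l) q M N) (kbnd act (a # l) q M N)
    (fscale s) (kcyc act l q M N') (kbnd act l q M N')"
proof -
  let ?n = "length l"
  let ?act = "\<lambda>f S. act a (f S)"
  note M0 = submodD(1)[OF M] and N0 = submodD(1)[OF N]
  have N': "submod N'" unfolding N'_def by (rule submod_reg[OF M N a])
  have NN': "N \<subseteq> N'"
  proof
    fix y assume "y \<in> N"
    moreover have "y = y + act a 0" by simp
    ultimately show "y \<in> N'" unfolding N'_def using M0 by blast
  qed
  have XN': "?act f \<in> kchains ?n q N'" if f: "f \<in> kchains ?n q M" for f q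
  proof (rule kchainsI)
    fix S assume "length S = ?n" "int (count_list S True) = q"
    then have "f S \<in> M" using kchains_on f by blast
    moreover have "act a (f S) = 0 + act a (f S)" by simp
    ultimately show "act a (f S) \<in> N'" unfolding N'_def using N0 by blast
  qed (use kchains_off[OF f] in simp)
  have N'I: "y + ?act x \<in> kchains ?n q N'" if "y \<in> kchains ?n q N" "x \<in> kchains ?n q M" for y x q
    using kchains_add[OF N'] XN' that kchains_mono[OF NN'] by blast
  have N'E: "\<exists>y x. y \<in> kchains ?n q N \<and> x \<in> kchains ?n q M \<and> f = y + ?act x" if "f \<in> kchains ?n q N'" for f q
    using kchains_set_add[of f ?n q a N M] that N0 unfolding N'_def by metis
  have regc: "f \<in> kchains ?n q N" if f: "f \<in> kchains ?n q M" "?act f \<in> kchains ?n q N" for f q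
    by (rule kchainsI) (use reg kchains_on[OF f(1)] kchains_on[OF f(2)] kchains_off[OF f(1)] in simp_all)
  have cyc: "kpair f0 f1 \<in> kcyc act (a # l) q M N \<longleftrightarrow> f0 \<in> kchains ?n q M \<and> f1 \<in> kchains ?n (q - 1) M \<and>
      kd act l f0 + ?act f1 \<in> kchains ?n (q - 1) N \<and> kd act l f1 \<in> kchains ?n (q - 2) N" for f0 f1
    using kchains_uminus[OF N, of "kd act l f1" ?n "q-2"] kchains_uminus[OF N, of "- kd act l f1" ?n "q-2"]
    by (simp add: kcyc_def kd_kpair kchains_kpair[OF M0] kchains_kpair[OF N0] del: kd.simps)
      (auto simp del: kd.simps)
  have bnd: "kpair f0 f1 \<in> kbnd act (a # l) q M N \<longleftrightarrow> f0 \<in> kchains ?n q M \<and> f1 \<in> kchains ?n (q - 1) M \<and>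
      (\<exists>g0 g1. g0 \<in> kchains ?n (q + 1) M \<and> g1 \<in> kchains ?n q M \<and>
       f0 - (kd act l g0 + ?act g1) \<in> kchains ?n q N \<and> f1 + kd act l g1 \<in> kchains ?n (q - 1) N)" for f0 f1
  proof -
    have "(\<exists>g\<in>kchains (Suc ?n) (q+1) M. kpair f0 f1 - kd act (a#l) g \<in> kchains (Suc ?n) q N) \<longleftrightarrow>
      (\<exists>g0 g1. g0 \<in> kchains ?n (q + 1) M \<and> g1 \<in> kchains ?n q M \<and>
        kpair f0 f1 - kd act (a#l) (kpair g0 g1) \<in> kchains (Suc ?n) q N)" (is "?A \<longleftrightarrow> ?B")
    proof
      assume ?A
      then obtain g where g: "g \<in> kchains (Suc ?n) (q+1) M" "kpair f0 f1 - kd act (a#l) g \<in> kchains (Suc ?n) q N" by blast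
      from g(1) obtain g0 g1 where "g = kpair g0 g1" "g0 \<in> kchains ?n (q+1) M" "g1 \<in> kchains ?n (q + 1 - 1) M"
        using kchains_cases M0 by metis
      with g(2) show ?B by auto
    next
      assume ?B
      then show ?A using kchains_kpair[OF M0] by (metis add_diff_cancel_right')
    qed
    then show ?thesis unfolding kbnd_def
      by (simp add: kd_kpair kchains_kpair[OF M0] kchains_kpair[OF N0] kpair_diff del: kd.simps)
  qed
  show ?thesis
  proof (rule quot_isoI[of "\<lambda>f h. f \<in> kcyc act (a # l) q M N \<and> h = (\<lambda>S. f (False # S))"], goal_cases)
    case (1 x y) then show ?case by blast
  next
    case (2 f h)
    then obtain f0 f1 where f: "f = kpair f0 f1"
      using kchains_split[of f ?n q M] unfolding kcyc_def by auto
    have "kd act l f0 + ?act f1 - ?act f1 \<in> kchains ?n (q-1) N'"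
      using 2 f cyc kchains_mono[OF NN'] XN' kchains_diff[OF N'] by blast
    then show ?case using 2 f cyc unfolding kcyc_def[of act l] by auto
  next
    case (3 x y x' y') then show ?case using kcyc_add[OF M N] by auto
  next
    case (4 c x y) then show ?case using kcyc_scale[OF M N] by auto
  next
    case (5 x) then show ?case by blast
  next
    case (6 f0)
    then have f0: "f0 \<in> kchains ?n q M" "kd act l f0 \<in> kchains ?n (q-1) N'" unfolding kcyc_def by auto
    then obtain y x where yx: "y \<in> kchains ?n (q-1) N" "x \<in> kchains ?n (q-1) M" "kd act l f0 = y + ?act x"
      using N'E by blast
    have mx: "- x \<in> kchains ?n (q-1) M" using yx kchains_uminus[OF M] by blast
    \<comment> \<open>The missing component of the lift is \<open>- x\<close>. Applying
      \<open>d\<close> to \<open>d f0 = y + a x\<close> gives \<open>a d (- x) = d y\<close>, which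
      lies in \<open>N\<close>, so regularity puts \<open>d (- x)\<close> in
      \<open>N\<close>.\<close>
    have "?act (kd act l (- x)) = kd act l y"
    proof -
      have "0 = kd act l (kd act l f0)" by (simp add: kd_kd)
      also have "\<dots> = kd act l y + ?act (kd act l x)" unfolding yx kd_add kd_X by simp
      finally show ?thesis by (auto simp: kd_uminus act_uminus fun_eq_iff neg_eq_iff_add_eq_0 add.commute)
    qed
    then have "?act (kd act l (- x)) \<in> kchains ?n (q - 1 - 1) N" using kd_chains[OF N l yx(1)] by simp
    then have "kd act l (- x) \<in> kchains ?n (q - 1 - 1) N" using regc kd_chains[OF M l mx] by blast
    moreover have "kd act l f0 + ?act (- x) = y" unfolding yx by (auto simp: act_uminus)
    ultimately have "kpair f0 (- x) \<in> kcyc act (a # l) q M N" unfolding cyc using f0(1) mx yx(1) by simp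
    then show ?case by (intro exI[of _ "kpair f0 (- x)"]) auto
  next
    case (7 f h)
    then obtain f0 f1 where f: "f = kpair f0 f1"
      using kchains_split[of f ?n q M] unfolding kcyc_def by auto
    from 7 obtain g0 g1 where g: "f0 \<in> kchains ?n q M" "g0 \<in> kchains ?n (q + 1) M" "g1 \<in> kchains ?n q M"
       "f0 - (kd act l g0 + ?act g1) \<in> kchains ?n q N" unfolding f bnd by blast
    have "f0 - kd act l g0 = (f0 - (kd act l g0 + ?act g1)) + ?act g1" by simp
    then have "f0 - kd act l g0 \<in> kchains ?n q N'" using N'I[OF g(4,3)] by metis
    then show ?case unfolding kbnd_def using g f 7 by auto
  next
    case (8 f h)
    then obtain f0 f1 where f: "f = kpair f0 f1"
      using kchains_split[of f ?n q M] unfolding kcyc_def by auto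
    with 8 have fc: "kpair f0 f1 \<in> kcyc act (a # l) q M N" by simp
    have h: "h = f0" using 8 f by auto
    from 8 h obtain g0 where g0: "g0 \<in> kchains ?n (q + 1) M" "f0 - kd act l g0 \<in> kchains ?n q N'"
      unfolding kbnd_def by auto
    then obtain y x where yx: "y \<in> kchains ?n q N" "x \<in> kchains ?n q M" "f0 - kd act l g0 = y + ?act x"
      using N'E by blast
    note fc = fc[unfolded cyc]
    \<comment> \<open>The pair \<open>(f0, f1)\<close> is to be the boundary of
      \<open>(g0, x)\<close> modulo \<open>N\<close>. The second component \<open>f1 + d x\<close>
      is tested after multiplication by \<open>a\<close>, where the cycle condition applies.\<close>
    have e: "?act (f1 + kd act l x) = (kd act l f0 + ?act f1) - kd act l y"
    proof -
      have f0: "f0 = kd act l g0 + y + ?act x" using yx(3) by (simp add: algebra_simps)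
      show ?thesis by (auto simp: f0 kd_add kd_kd act_add kd_X)
    qed
    have "f1 + kd act l x \<in> kchains ?n (q - 1) N"
    proof (rule regc)
      show "f1 + kd act l x \<in> kchains ?n (q - 1) M" using fc kd_chains[OF M l yx(2)] kchains_add[OF M] by blast
      show "?act (f1 + kd act l x) \<in> kchains ?n (q - 1) N" unfolding e
        using fc kd_chains[OF N l yx(1)] kchains_diff[OF N] by blast
    qed
    moreover have "f0 - (kd act l g0 + ?act x) = y" using yx(3) by (simp add: algebra_simps)
    ultimately show ?case unfolding f bnd using fc g0(1) yx(1,2)
      by (intro conjI exI[of _ g0] exI[of _ x]) simp_all
  qed
qed

end

section \<open>Koszul homology in the extreme degrees, and acyclicity for regular sequences\<close>

lemma kchains_null: "f \<in> kchains k q {0} \<longleftrightarrow> f = 0"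
proof
  assume "f \<in> kchains k q {0}"
  then show "f = 0" using kchains_on[of f k q "{0}"] kchains_off[of f k q "{0}"] by (intro ext) (auto simp: zero_fun_def)
qed (simp add: kchains_zero)

lemma kcyc_null: "f \<in> kcyc act l q M {0} \<longleftrightarrow> f \<in> kchains (length l) q M \<and> kd act l f = 0"
  by (simp add: kcyc_def kchains_null)

lemma kbnd_null: "f \<in> kbnd act l q M {0} \<longleftrightarrow> f \<in> kchains (length l) q M \<and> (\<exists>g\<in>kchains (length l) (q + 1) M. f = kd act l g)"
  by (simp add: kbnd_def kchains_null)

lemma kchains_out:
  assumes "f \<in> kchains k q M" "q < 0 \<or> int k < q"
  shows "f = 0"
proof
  fix S
  have "\<not> (length S = k \<and> int (count_list S True) = q)"
    using assms(2) count_le_length[of S True] by auto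
  then show "f S = 0 S" using kchains_off[OF assms(1)] by simp
qed

text \<open>The product \<open>I M\<close>, with \<open>I\<close> the ideal generated by the
  operators in the list.\<close>

fun imul :: "(nat \<Rightarrow> 'a \<Rightarrow> 'a) \<Rightarrow> nat list \<Rightarrow> 'a::ab_group_add set \<Rightarrow> 'a set" where
  "imul act [] M = {0}"
| "imul act (a # l) M = {y + act a x | y x. y \<in> imul act l M \<and> x \<in> M}"

text \<open>A weakly regular sequence on \<open>M / N\<close>: the successive quotients may become
  zero.\<close>

fun regular_on :: "(nat \<Rightarrow> 'a \<Rightarrow> 'a) \<Rightarrow> nat list \<Rightarrow> 'a::ab_group_add set \<Rightarrow> 'a set \<Rightarrow> bool" where
  "regular_on act [] M N \<longleftrightarrow> True"
| "regular_on act (a # l) M N \<longleftrightarrow> (\<forall>x\<in>M. act a x \<in> N \<longrightarrow> x \<in> N) \<and>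
     regular_on act l M {y + act a x | y x. y \<in> N \<and> x \<in> M}"

lemma count_list_top: "count_list S True = length S \<longleftrightarrow> S = replicate (length S) True"
proof (induction S)
  case (Cons b S)
  then show ?case using count_le_length[of S True] by (cases b) auto
qed auto

lemma count_list_bot: "count_list S True = 0 \<longleftrightarrow> S = replicate (length S) False"
  by (induction S) auto

definition ktop :: "nat \<Rightarrow> 'a::zero \<Rightarrow> bool list \<Rightarrow> 'a" where
  "ktop k x = (\<lambda>S. if S = replicate k True then x else 0)"

definition kbot :: "nat \<Rightarrow> 'a::zero \<Rightarrow> bool list \<Rightarrow> 'a" where
  "kbot k x = (\<lambda>S. if S = replicate k False then x else 0)"

lemma ktop_Suc: "ktop (Suc k) x = kpair (0 :: bool list \<Rightarrow> 'a::zero) (ktop k x)"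
proof
  fix S show "ktop (Suc k) x S = kpair 0 (ktop k x) S"
    by (cases "(0 :: bool list \<Rightarrow> 'a, 0 :: bool list \<Rightarrow> 'a, S)" rule: kpair.cases) (auto simp: ktop_def)
qed

lemma kbot_Suc: "kbot (Suc k) x = kpair (kbot k x) (0 :: bool list \<Rightarrow> 'a::zero)"
proof
  fix S show "kbot (Suc k) x S = kpair (kbot k x) 0 S"
    by (cases "(0 :: bool list \<Rightarrow> 'a, 0 :: bool list \<Rightarrow> 'a, S)" rule: kpair.cases) (auto simp: kbot_def)
qed

lemma ktop_chain: "x \<in> M \<Longrightarrow> ktop k x \<in> kchains k (int k) M"
proof (rule kchainsI)
  fix S assume "x \<in> M" "length S = k" "int (count_list S True) = int k"
  then show "ktop k x S \<in> M" using count_list_top[of S] by (simp add: ktop_def)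
qed (use count_list_top[of "replicate k True"] in \<open>auto simp: ktop_def\<close>)

lemma kbot_chain: "x \<in> M \<Longrightarrow> kbot k x \<in> kchains k 0 M"
proof (rule kchainsI)
  fix S assume "x \<in> M" "length S = k" "int (count_list S True) = 0"
  then show "kbot k x S \<in> M" using count_list_bot[of S] by (simp add: kbot_def)
qed (use count_list_bot[of "replicate k False"] in \<open>auto simp: kbot_def\<close>)

lemma chain_ktop:
  assumes "f \<in> kchains k (int k) M"
  shows "f = ktop k (f (replicate k True))" "f (replicate k True) \<in> M"
proof -
  show "f = ktop k (f (replicate k True))"
  proof
    fix S show "f S = ktop k (f (replicate k True)) S"
      using kchains_off[OF assms, of S] count_list_top[of S] by (cases "length S = k") (auto simp: ktop_def)
  qed
  show "f (replicate k True) \<in> M"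
    using count_list_top[of "replicate k True"] by (intro kchains_on[OF assms]) auto
qed

lemma chain_kbot:
  assumes "f \<in> kchains k 0 M"
  shows "f = kbot k (f (replicate k False))" "f (replicate k False) \<in> M"
proof -
  show "f = kbot k (f (replicate k False))"
  proof
    fix S show "f S = kbot k (f (replicate k False)) S"
      using kchains_off[OF assms, of S] count_list_bot[of S] by (cases "length S = k") (auto simp: kbot_def)
  qed
  show "f (replicate k False) \<in> M"
    using count_list_bot[of "replicate k False"] by (intro kchains_on[OF assms]) auto
qed

lemma kbot_eq_iff: "kbot k x = kbot k y \<longleftrightarrow> x = y"
  unfolding kbot_def fun_eq_iff by auto

lemma kbot_add: "kbot k x + kbot k y = kbot k (x + y)" for x :: "'a::ab_group_add"
  by (auto simp: kbot_def)

lemma ktop_add: "ktop k x + ktop k y = ktop k (x + y)" for x :: "'a::ab_group_add"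
  by (auto simp: ktop_def)

context ops begin

lemma kd_mem:
  assumes "submod F" "set l \<subseteq> V" "\<And>S. f S \<in> F"
  shows "kd act l f S \<in> F"
  using assms(2,3)
proof (induction l arbitrary: f S)
  case Nil then show ?case using submodD(1)[OF assms(1)] by simp
next
  case (Cons a l)
  note F = submodD[OF assms(1)]
  have "kd act l (\<lambda>S. f (b # S)) T \<in> F" for b T using Cons by simp
  then show ?case
    by (cases "(f,f,S)" rule: kpair.cases) (use Cons.prems F in auto)
qed

text \<open>Degree \<open>length l\<close> has a single basis vector, and the coefficients of the
  differential of \<open>x\<close> times it are 0 or, up to sign, \<open>act i x\<close>. There are
  no chains above that degree, so only \<open>N\<close> is divided out. Top homology is thus the
  annihilator of the operators in \<open>M / N\<close>.\<close>

lemma koszul_top: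
  assumes M: "submod M" and N: "submod N" and NM: "N \<subseteq> M" and l: "set l \<subseteq> V"
  shows "quot_iso s {x \<in> M. \<forall>i\<in>set l. act i x \<in> N} N
    (fscale s) (kcyc act l (int (length l)) M N) (kbnd act l (int (length l)) M N)"
proof -
  note N0 = submodD(1)[OF N] and M0 = submodD(1)[OF M]
  have top: "(\<forall>S. kd act l (ktop (length l) x) S \<in> N) \<longleftrightarrow> (\<forall>i\<in>set l. act i x \<in> N)" for x and l
  proof (induction l)
    case Nil then show ?case using N0 by simp
  next
    case (Cons a l)
    have e: "kd act (a # l) (ktop (length (a # l)) x) =
      kpair (\<lambda>S. act a (ktop (length l) x S)) (- kd act l (ktop (length l) x))"
      by (simp add: ktop_Suc flip: zero_fun_def)
    have mN: "- u \<in> N \<longleftrightarrow> u \<in> N" for u using submodD(3)[OF N, of u] submodD(3)[OF N, of "- u"] by auto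
    have "(\<forall>S. kpair f g S \<in> N) \<longleftrightarrow> (\<forall>S. f S \<in> N) \<and> (\<forall>S. g S \<in> N)" for f g
    proof safe
      fix S assume a: "\<forall>S. kpair f g S \<in> N"
      show "f S \<in> N" using a[rule_format, of "False # S"] by simp
      show "g S \<in> N" using a[rule_format, of "True # S"] by simp
    next
      fix S assume "\<forall>S. f S \<in> N" "\<forall>S. g S \<in> N"
      then show "kpair f g S \<in> N" using N0 by (cases "(f,g,S)" rule: kpair.cases) auto
    qed
    moreover have "(\<forall>S. act a (ktop (length l) x S) \<in> N) \<longleftrightarrow> act a x \<in> N"
      using N0 by (auto simp: ktop_def)
    ultimately show ?case unfolding e using Cons by (simp add: mN)
  qed
  have top2: "ktop (length l) x \<in> kcyc act l (int (length l)) M N" if "x \<in> M" "\<forall>i\<in>set l. act i x \<in> N" for x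
  proof -
    have "kd act l (ktop (length l) x) \<in> kchains (length l) (int (length l) - 1) M"
      using kd_chains[OF M l ktop_chain[OF that(1)]] .
    then have "kd act l (ktop (length l) x) \<in> kchains (length l) (int (length l) - 1) N"
      using top that(2) kchains_off by (intro kchainsI) blast+
    then show ?thesis using ktop_chain[OF that(1)] unfolding kcyc_def by blast
  qed
  have bnd: "ktop (length l) x \<in> kbnd act l (int (length l)) M N \<longleftrightarrow> x \<in> N" if "x \<in> M" for x
  proof
    assume "ktop (length l) x \<in> kbnd act l (int (length l)) M N"
    then obtain g where g: "g \<in> kchains (length l) (int (length l) + 1) M"
      "ktop (length l) x - kd act l g \<in> kchains (length l) (int (length l)) N" unfolding kbnd_def by blast
    from g(1) have "g = 0" by (rule kchains_out) simp
    with g(2) have "ktop (length l) x \<in> kchains (length l) (int (length l)) N" by simp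
    then show "x \<in> N" using chain_ktop(2) by (force simp: ktop_def)
  next
    assume "x \<in> N"
    then have "ktop (length l) x - kd act l 0 \<in> kchains (length l) (int (length l)) N" using ktop_chain by simp
    then show "ktop (length l) x \<in> kbnd act l (int (length l)) M N"
      unfolding kbnd_def using kchains_zero[OF M0] ktop_chain[OF that] by blast
  qed
  show ?thesis
  proof (rule quot_isoI[of "\<lambda>x f. x \<in> M \<and> (\<forall>i\<in>set l. act i x \<in> N) \<and> f = ktop (length l) x"], goal_cases)
    case (3 x y x' y')
    then show ?case using submodD(2)[OF M] submodD(2)[OF N] by (auto simp: act_add ktop_add)
  next
    case (4 c x y)
    then show ?case using submodD(4)[OF M] submodD(4)[OF N] by (auto simp: act_s ktop_def)
  next
    case (6 y)
    then have y: "y \<in> kchains (length l) (int (length l)) M" "kd act l y \<in> kchains (length l) (int (length l) - 1) N"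
      unfolding kcyc_def by auto
    note c = chain_ktop[OF y(1)]
    let ?x = "y (replicate (length l) True)"
    have "\<forall>S. kd act l (ktop (length l) ?x) S \<in> N"
      using kchains_mem[OF y(2) N0] c(1) by simp
    then show ?case using c top by blast
  next
    case (7 x y) then show ?case using bnd by blast
  next
    case (8 x y) then show ?case using bnd by blast
  qed (use top2 in auto)
qed

text \<open>A 1-chain for \<open>a # l\<close> is a pair of a 1-chain \<open>g0\<close> for
  \<open>l\<close> and a 0-chain, which is a single element \<open>y\<close>; its boundary is
  \<open>d g0 + a y\<close>. This is the recursion of \<open>imul\<close>.\<close>

lemma imul_boundary:
  assumes M: "submod M" and l: "set l \<subseteq> V"
  shows "(\<exists>g\<in>kchains (length l) 1 M. kbot (length l) x = kd act l g) \<longleftrightarrow> x \<in> imul act l M"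
  using l
proof (induction l arbitrary: x)
  case Nil
  have "kbot 0 x = 0 \<longleftrightarrow> x = 0" using kbot_eq_iff[of 0 x 0] by (simp add: kbot_def zero_fun_def)
  then show ?case using kchains_zero[OF submodD(1)[OF M]] by auto
next
  case (Cons a l)
  note M0 = submodD(1)[OF M]
  let ?n = "length l"
  have e: "kd act (a # l) (kpair g0 (kbot ?n y)) = kpair (kd act l g0 + kbot ?n (act a y)) 0" if "y \<in> M" for g0 y
  proof -
    have "kd act l (kbot ?n y) \<in> kchains ?n (0 - 1) M"
      using Cons.prems by (intro kd_chains[OF M _ kbot_chain[OF that]]) auto
    then have "kd act l (kbot ?n y) = 0" by (rule kchains_out) simp
    moreover have "(\<lambda>S. act a (kbot ?n y S)) = kbot ?n (act a y)" by (auto simp: kbot_def)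
    ultimately show ?thesis by (simp add: kd_kpair del: kd.simps)
  qed
  have pe: "kpair f 0 = kpair g 0 \<longleftrightarrow> f = g" for f g :: "bool list \<Rightarrow> 'a"
    by (metis ext kpair.simps(2))
  show ?case
  proof
    assume "\<exists>g\<in>kchains (length (a # l)) 1 M. kbot (length (a # l)) x = kd act (a # l) g"
    then obtain g where g: "g \<in> kchains (Suc ?n) 1 M" "kbot (Suc ?n) x = kd act (a # l) g" by auto
    then obtain g0 g1 where gg: "g = kpair g0 g1" "g0 \<in> kchains ?n 1 M" "g1 \<in> kchains ?n (1 - 1) M"
      using kchains_cases M0 by metis
    then obtain y where y: "g1 = kbot ?n y" "y \<in> M" using chain_kbot[of g1 ?n M] by auto
    have "kbot ?n x = kd act l g0 + kbot ?n (act a y)"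
      using g(2) unfolding gg y e[OF y(2)] kbot_Suc pe .
    then have "kbot ?n (x - act a y) = kd act l g0"
      using kbot_add[of ?n "x - act a y" "act a y"] by (simp add: algebra_simps)
    then have "x - act a y \<in> imul act l M" using Cons gg by auto
    then show "x \<in> imul act (a # l) M" using y by force
  next
    assume "x \<in> imul act (a # l) M"
    then obtain z y where zy: "x = z + act a y" "z \<in> imul act l M" "y \<in> M" by auto
    then obtain g0 where g0: "g0 \<in> kchains ?n 1 M" "kbot ?n z = kd act l g0" using Cons by auto
    have "kbot (Suc ?n) x = kd act (a # l) (kpair g0 (kbot ?n y))"
      unfolding e[OF zy(3)] kbot_Suc pe zy(1) using g0(2) kbot_add by metis
    moreover have "kpair g0 (kbot ?n y) \<in> kchains (Suc ?n) 1 M"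
      using g0 kbot_chain[OF zy(3)] kchains_kpair[OF M0] by simp
    ultimately show "\<exists>g\<in>kchains (length (a # l)) 1 M. kbot (length (a # l)) x = kd act (a # l) g"
      unfolding list.size(4) add_Suc_right add_0_right by (intro bexI)
  qed
qed

text \<open>There are no chains in degree -1, so every 0-chain is a cycle, and
  \<open>imul_boundary\<close> describes the boundaries.\<close>

lemma koszul_bot:
  assumes M: "submod M" and l: "set l \<subseteq> V"
  shows "quot_iso s M (imul act l M) (fscale s) (kcyc act l 0 M {0}) (kbnd act l 0 M {0})"
proof (rule quot_isoI[of "\<lambda>x f. x \<in> M \<and> f = kbot (length l) x"], goal_cases)
  case (2 x y)
  then have "y \<in> kchains (length l) 0 M" using kbot_chain by blast
  moreover from kd_chains[OF M l this] have "kd act l y = 0" by (rule kchains_out) simp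
  ultimately show ?case unfolding kcyc_null by blast
next
  case (3 x y x' y')
  then show ?case using submodD(2)[OF M] by (auto simp: kbot_add)
next
  case (4 c x y)
  then show ?case using submodD(4)[OF M] by (auto simp: kbot_def)
next
  case (6 y)
  then show ?case using chain_kbot unfolding kcyc_null by blast
next
  case (7 x y)
  then show ?case using imul_boundary[OF M l, of x] kbot_chain unfolding kbnd_null by auto
next
  case (8 x y)
  then show ?case using imul_boundary[OF M l, of x] unfolding kbnd_null by auto
qed auto

text \<open>\<open>koszul_regular\<close> removes the operators one by one at fixed
  \<open>q\<close>; for the empty list there are no chains in positive degree.\<close>

lemma koszul_acyclic:
  assumes M: "submod M" and l: "set l \<subseteq> V" and q: "q > 0"
    and N: "submod N" "N \<subseteq> M" "regular_on act l M N"
  shows "kcyc act l q M N \<subseteq> kbnd act l q M N"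
  using l N
proof (induction l arbitrary: N)
  case Nil
  have "f = 0" if "f \<in> kchains 0 q M" for f using kchains_out[OF that] q by simp
  then show ?case using kchains_zero submodD(1)[OF M] submodD(1)[OF Nil(2)]
    unfolding kcyc_def kbnd_def by fastforce
next
  case (Cons a l)
  let ?N = "{y + act a x | y x. y \<in> N \<and> x \<in> M}"
  have a: "a \<in> V" "set l \<subseteq> V" using Cons.prems by auto
  have "?N \<subseteq> M" using Cons.prems a submodD(2,5)[OF M] by blast
  then have "kcyc act l q M ?N \<subseteq> kbnd act l q M ?N"
    using Cons.IH[OF a(2) submod_reg[OF M Cons.prems(2) a(1)]] Cons.prems by simp
  moreover have "quot_iso (fscale s) (kcyc act (a # l) q M N) (kbnd act (a # l) q M N)
    (fscale s) (kcyc act l q M ?N) (kbnd act l q M ?N)"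
    using Cons.prems a by (intro koszul_regular[OF M]) auto
  ultimately show ?case using quot_iso_zero by blast
qed

end

section \<open>Dimension shifting along a surjection\<close>

lemma kd_hom:
  assumes "ops s act" "ops.submod s act V F" "set l \<subseteq> V" "\<And>S. f S \<in> F" "\<pi> 0 = 0"
    and \<pi>: "\<And>x y. x \<in> F \<Longrightarrow> y \<in> F \<Longrightarrow> \<pi> (x + y) = \<pi> x + \<pi> y"
      "\<And>i x. i \<in> V \<Longrightarrow> x \<in> F \<Longrightarrow> \<pi> (act i x) = act' i (\<pi> x)"
  shows "(\<lambda>S. \<pi> (kd act l f S)) = kd act' l (\<lambda>S. \<pi> (f S))"
  using assms(3,4)
proof (induction l arbitrary: f)
  case Nil then show ?case using \<open>\<pi> 0 = 0\<close> by (simp add: zero_fun_def)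
next
  case (Cons a l)
  interpret ops s act V by fact
  note F = submodD[OF assms(2)]
  have neg: "\<pi> (- x) = - \<pi> x" if "x \<in> F" for x
    using \<pi>(1)[of x "- x"] F(3) that \<open>\<pi> 0 = 0\<close> by (simp add: eq_neg_iff_add_eq_0 add.commute)
  have k: "kd act l (\<lambda>S. f (b # S)) T \<in> F" for b T
    using kd_mem[OF assms(2)] Cons.prems by simp
  have IH: "\<pi> (kd act l (\<lambda>S. f (b # S)) T) = kd act' l (\<lambda>S. \<pi> (f (b # S))) T" for b T
    using Cons.IH[of "\<lambda>S. f (b # S)"] Cons.prems by (simp add: fun_eq_iff)
  show ?case unfolding kd.simps kpair_map[of \<pi>, OF \<open>\<pi> 0 = 0\<close>]
    by (rule arg_cong2[where f=kpair]) (use Cons.prems F k in \<open>auto simp: \<pi> neg IH\<close>)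
qed

text \<open>The connecting isomorphism for \<open>0 -> Z -> F -> M -> 0\<close>. \<open>acF\<close>
  says that the homology of \<open>F\<close> vanishes in degree \<open>q + 1\<close>,
  \<open>cycZ\<close> that the map from the homology of \<open>Z\<close> to that of \<open>F\<close>
  in degree \<open>q\<close> is zero. The second condition has this weak form because for
  \<open>q = 0\<close> the homology of \<open>F\<close> itself is \<open>F / m F\<close>, with
  \<open>m\<close> the irrelevant ideal.\<close>

theorem koszul_shift:
  fixes s :: "'k \<Rightarrow> 'a::ab_group_add \<Rightarrow> 'a" and s' :: "'k \<Rightarrow> 'b::ab_group_add \<Rightarrow> 'b"
  assumes ops: "ops s act" "ops s' act'"
    and F: "ops.submod s act V F" and Z: "ops.submod s act V Z" and M: "ops.submod s' act' V M"
    and l: "set l \<subseteq> V"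
    and \<pi>_add: "\<And>x y. x \<in> F \<Longrightarrow> y \<in> F \<Longrightarrow> \<pi> (x + y) = \<pi> x + \<pi> y"
    and \<pi>_s: "\<And>c x. x \<in> F \<Longrightarrow> \<pi> (s c x) = s' c (\<pi> x)"
    and \<pi>_act: "\<And>i x. i \<in> V \<Longrightarrow> x \<in> F \<Longrightarrow> \<pi> (act i x) = act' i (\<pi> x)"
    and img: "\<pi> ` F = M" and ker: "Z = {x \<in> F. \<pi> x = 0}"
    and acF: "kcyc act l (q + 1) F {0} \<subseteq> kbnd act l (q + 1) F {0}"
    and cycZ: "kcyc act l q Z {0} \<subseteq> kbnd act l q F {0}"
  shows "quot_iso (fscale s') (kcyc act' l (q + 1) M {0}) (kbnd act' l (q + 1) M {0})
    (fscale s) (kcyc act l q Z {0}) (kbnd act l q Z {0})"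
proof -
  interpret A: ops s act V by fact
  interpret B: ops s' act' V by fact
  let ?n = "length l"
  note F0 = A.submodD(1)[OF F] and Z0 = A.submodD(1)[OF Z] and M0 = B.submodD(1)[OF M]
  have \<pi>0: "\<pi> 0 = 0" using \<pi>_add[OF F0 F0] by simp
  have ZF: "Z \<subseteq> F" using ker by blast
  have \<pi>F: "\<pi> x \<in> M" if "x \<in> F" for x using img that by blast
  have \<pi>c: "(\<lambda>S. \<pi> (f S)) \<in> kchains ?n p M" if f: "f \<in> kchains ?n p F" for f p
    by (rule kchainsI) (use kchains_on[OF f] kchains_off[OF f] \<pi>F \<pi>0 in auto)
  have kh: "(\<lambda>S. \<pi> (kd act l f S)) = kd act' l (\<lambda>S. \<pi> (f S))" if "f \<in> kchains ?n p F" for f p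
    by (rule kd_hom[OF ops(1) F l]) (use kchains_mem[OF that F0] \<pi>0 \<pi>_add \<pi>_act in auto)
  have lift: "\<exists>f. f \<in> kchains ?n p F \<and> m = (\<lambda>S. \<pi> (f S))" if m: "m \<in> kchains ?n p M" for m p
  proof -
    obtain f where "f \<in> kchains ?n p F" "\<And>S. m S = \<pi> (f S)"
      using kchains_choose[OF m, of F "\<lambda>z x. z = \<pi> x"] img \<pi>0 by (metis imageE)
    then show ?thesis by auto
  qed
  have kz: "f \<in> kchains ?n p Z" if f: "f \<in> kchains ?n p F" "(\<lambda>S. \<pi> (f S)) = 0" for f p
    by (rule kchainsI) (use kchains_on[OF f(1)] kchains_off[OF f(1)] f(2) ker in \<open>auto simp: fun_eq_iff\<close>)
  have \<pi>Z: "(\<lambda>S. \<pi> (f S)) = 0" if f: "f \<in> kchains ?n p Z" for f p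
    using kchains_mem[OF f Z0] ker by auto
  have \<pi>_diff: "\<pi> (x - y) = \<pi> x - \<pi> y" if "x \<in> F" "y \<in> F" for x y
    using \<pi>_add[of "x - y" y] A.submodD(6)[OF F] that by simp
  show ?thesis
  \<comment> \<open>The zigzag: lift \<open>m\<close> to a chain \<open>f\<close> of
    \<open>F\<close> and take its differential. No lift is chosen; independence of the lift is
    contained in the last clause of \<open>quot_iso\<close>, which is cases 7 and 8.\<close>
  proof (rule quot_isoI[of "\<lambda>m z. \<exists>f\<in>kchains ?n (q + 1) F. m = (\<lambda>S. \<pi> (f S)) \<and> z = kd act l f \<and> z \<in> kchains ?n q Z"], goal_cases)
    case (1 m z)
    then obtain f where f: "f \<in> kchains ?n (q + 1) F" "m = (\<lambda>S. \<pi> (f S))" "z = kd act l f" "z \<in> kchains ?n q Z" by blast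
    then have "kd act' l m = 0" using kh[OF f(1)] \<pi>Z[OF f(4)] by simp
    then show ?case unfolding kcyc_null using f \<pi>c by blast
  next
    case (2 m z)
    then show ?case unfolding kcyc_null using A.kd_kd by auto
  next
    case (3 m z m' z')
    then obtain f f' where f: "f \<in> kchains ?n (q + 1) F" "m = (\<lambda>S. \<pi> (f S))" "z = kd act l f" "z \<in> kchains ?n q Z"
      "f' \<in> kchains ?n (q + 1) F" "m' = (\<lambda>S. \<pi> (f' S))" "z' = kd act l f'" "z' \<in> kchains ?n q Z" by blast
    have "m + m' = (\<lambda>S. \<pi> ((f + f') S))" using f kchains_mem[OF f(1) F0] kchains_mem[OF f(5) F0] by (auto simp: \<pi>_add)
    moreover have "z + z' = kd act l (f + f')" using f by (simp add: A.kd_add)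
    moreover have "f + f' \<in> kchains ?n (q + 1) F" "z + z' \<in> kchains ?n q Z" using f A.kchains_add F Z by auto
    ultimately show ?case by blast
  next
    case (4 c m z)
    then obtain f where f: "f \<in> kchains ?n (q + 1) F" "m = (\<lambda>S. \<pi> (f S))" "z = kd act l f" "z \<in> kchains ?n q Z" by blast
    have "(\<lambda>S. s' c (m S)) = (\<lambda>S. \<pi> (s c (f S)))" using f kchains_mem[OF f(1) F0] by (simp add: \<pi>_s)
    moreover have "(\<lambda>S. s c (z S)) = kd act l (\<lambda>S. s c (f S))" using f by (simp add: A.kd_scale)
    moreover have "(\<lambda>S. s c (f S)) \<in> kchains ?n (q + 1) F" "(\<lambda>S. s c (z S)) \<in> kchains ?n q Z"
      using f A.kchains_scale F Z by auto
    ultimately show ?case by (intro bexI[of _ "\<lambda>S. s c (f S)"]) auto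
  next
    case (5 m)
    then have m: "m \<in> kchains ?n (q + 1) M" "kd act' l m = 0" unfolding kcyc_null by auto
    then obtain f where f: "f \<in> kchains ?n (q + 1) F" "m = (\<lambda>S. \<pi> (f S))" using lift by blast
    have "kd act l f \<in> kchains ?n q F" using A.kd_chains[OF F l f(1)] by simp
    then have "kd act l f \<in> kchains ?n q Z" using kz kh[OF f(1)] m(2) f(2) by simp
    then show ?case using f by blast
  next
    case (6 z)
    then have "z \<in> kbnd act l q F {0}" using cycZ by blast
    then obtain f where "f \<in> kchains ?n (q + 1) F" "z = kd act l f" unfolding kbnd_null by blast
    then show ?case using 6 unfolding kcyc_null by blast
  next
    case (7 m z)
    then obtain f where f: "f \<in> kchains ?n (q + 1) F" "m = (\<lambda>S. \<pi> (f S))" "z = kd act l f" "z \<in> kchains ?n q Z" by blast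
    from 7 obtain m' where m': "m' \<in> kchains ?n (q + 1 + 1) M" "m = kd act' l m'" unfolding kbnd_null by blast
    then obtain f' where f': "f' \<in> kchains ?n (q + 1 + 1) F" "m' = (\<lambda>S. \<pi> (f' S))" using lift by blast
    have kf': "kd act l f' \<in> kchains ?n (q + 1) F" using A.kd_chains[OF F l f'(1)] by (simp only: add_diff_cancel_right')
    have d: "f - kd act l f' \<in> kchains ?n (q + 1) F" using A.kchains_diff[OF F f(1) kf'] .
    have "(\<lambda>S. \<pi> ((f - kd act l f') S)) = 0"
    proof -
      have "m = (\<lambda>S. \<pi> (kd act l f' S))" using kh[OF f'(1)] m'(2) f'(2) by simp
      then show ?thesis using kchains_mem[OF f(1) F0] kchains_mem[OF kf' F0] f(2) by (auto simp: \<pi>_diff fun_eq_iff)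
    qed
    \<comment> \<open>Correcting the lift by \<open>d f'\<close> turns it into a chain of
      \<open>Z\<close> with the same differential.\<close>
    then have "f - kd act l f' \<in> kchains ?n (q + 1) Z" using kz d by blast
    moreover have "z = kd act l (f - kd act l f')" using f(3) by (simp add: A.kd_diff A.kd_kd)
    ultimately show ?case using f(4) unfolding kbnd_null by blast
  next
    case (8 m z)
    then obtain f where f: "f \<in> kchains ?n (q + 1) F" "m = (\<lambda>S. \<pi> (f S))" "z = kd act l f" "z \<in> kchains ?n q Z" by blast
    from 8 obtain z' where z': "z' \<in> kchains ?n (q + 1) Z" "z = kd act l z'" unfolding kbnd_null by blast
    have z'F: "z' \<in> kchains ?n (q + 1) F" using z'(1) kchains_mono[OF ZF] by blast
    \<comment> \<open>If \<open>z\<close> bounds in \<open>Z\<close>, the lift can be corrected to a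
      cycle of \<open>F\<close>. Acyclicity makes this cycle a boundary, and \<open>z'\<close>
      disappears under the projection.\<close>
    have "f - z' \<in> kcyc act l (q + 1) F {0}" unfolding kcyc_null
      using A.kchains_diff[OF F f(1) z'F] f(3) z'(2) by (simp add: A.kd_diff)
    then have "f - z' \<in> kbnd act l (q + 1) F {0}" using acF by blast
    then obtain h where h: "h \<in> kchains ?n (q + 1 + 1) F" "f - z' = kd act l h" unfolding kbnd_null by blast
    have "m = (\<lambda>S. \<pi> (kd act l h S))"
    proof -
      have "\<pi> (kd act l h S) = \<pi> (f S) - \<pi> (z' S)" for S
        using kchains_mem[OF f(1) F0] kchains_mem[OF z'F F0] \<pi>_diff by (simp flip: h(2))
      then show ?thesis using \<pi>Z[OF z'(1)] f(2) by (auto simp: fun_eq_iff)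
    qed
    then have "m = kd act' l (\<lambda>S. \<pi> (h S))" using kh[OF h(1)] by simp
    then show ?case unfolding kbnd_null using \<pi>c[OF h(1)] \<pi>c[OF f(1)] f(2) by auto
  qed
qed

section \<open>Polynomials\<close>

abbreviation lookup where "lookup \<equiv> Poly_Mapping.lookup"
abbreviation keys where "keys \<equiv> Poly_Mapping.keys"
abbreviation single where "single \<equiv> Poly_Mapping.single"

abbreviation polys :: "nat set \<Rightarrow> ('k::field) mpoly set" where
  "polys V \<equiv> carrier (poly_ring V)"

lemma poly_ring_simps [simp]:
  "monoid.mult (poly_ring V) = (*)" "one (poly_ring V) = 1" "ring.zero (poly_ring V) = 0"
  "add (poly_ring V) = (+)"
  by (simp_all add: poly_ring_def)

lemma in_polys: "f \<in> polys V \<longleftrightarrow> (\<forall>t\<in>keys f. keys t \<subseteq> V)"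
  by (simp add: poly_ring_def)

lemma keys_plus_nat: "keys (s + t) = keys s \<union> keys t" for s t :: "nat \<Rightarrow>\<^sub>0 nat"
  by (auto simp: in_keys_iff lookup_add)

lemma plus_eq_0_nat: "s + t = 0 \<longleftrightarrow> s = 0 \<and> t = 0" for s t :: "nat \<Rightarrow>\<^sub>0 nat"
  by (metis Un_empty keys_plus_nat keys_eq_empty)

lemma single_Suc_neq_0 [simp]: "single i (Suc k) \<noteq> (0 :: nat \<Rightarrow>\<^sub>0 nat)" "0 \<noteq> (single i (Suc k) :: nat \<Rightarrow>\<^sub>0 nat)"
  by (metis lookup_single_eq lookup_zero nat.distinct(1))+

lemma polys_closed [simp]:
  "0 \<in> polys V" "1 \<in> polys V" "f \<in> polys V \<Longrightarrow> g \<in> polys V \<Longrightarrow> f + g \<in> polys V"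
  "f \<in> polys V \<Longrightarrow> - f \<in> polys V" "f \<in> polys V \<Longrightarrow> g \<in> polys V \<Longrightarrow> f * g \<in> polys V"
  "f \<in> polys V \<Longrightarrow> g \<in> polys V \<Longrightarrow> f - g \<in> polys V"
  "Const c \<in> polys V" "i \<in> V \<Longrightarrow> Var i \<in> polys V"
proof -
  show "f \<in> polys V \<Longrightarrow> g \<in> polys V \<Longrightarrow> f + g \<in> polys V"
    using keys_add[of f g] unfolding in_polys by blast
  show "f \<in> polys V \<Longrightarrow> g \<in> polys V \<Longrightarrow> f - g \<in> polys V"
    using keys_diff[of f g] unfolding in_polys by blast
  show "f * g \<in> polys V" if fg: "f \<in> polys V" "g \<in> polys V"
    unfolding in_polys
  proof
    fix t assume "t \<in> keys (f * g)"
    then obtain a b where "t = a + b" "a \<in> keys f" "b \<in> keys g" using keys_mult[of f g] by auto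
    then show "keys t \<subseteq> V" using fg by (auto simp: keys_plus_nat in_polys)
  qed
qed (auto simp: in_polys Const_def Var_def)

lemma polys_sum [simp]: "(\<And>x. x \<in> A \<Longrightarrow> f x \<in> polys V) \<Longrightarrow> sum f A \<in> polys V"
  by (induction A rule: infinite_finite_induct) auto

lemma polys_power [simp]: "f \<in> polys V \<Longrightarrow> f ^ k \<in> polys V"
  by (induction k) auto

lemma cring_poly_ring: "cring (poly_ring V)"
proof (rule cringI)
  show "abelian_group (poly_ring V)"
  proof (rule abelian_groupI)
    fix f assume "f \<in> polys V"
    then show "\<exists>g\<in>polys V. g \<oplus>\<^bsub>poly_ring V\<^esub> f = \<zero>\<^bsub>poly_ring V\<^esub>"
      by (intro bexI[of _ "- f"]) simp_all
  qed (simp_all add: ac_simps)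
  show "comm_monoid (poly_ring V)"
    by (rule comm_monoidI) (auto simp: algebra_simps)
qed (auto simp: algebra_simps)

lemma poly_ring_a_inv: "f \<in> polys V \<Longrightarrow> \<ominus>\<^bsub>poly_ring V\<^esub> f = - f"
proof -
  interpret cring "poly_ring V" by (rule cring_poly_ring)
  assume "f \<in> polys V"
  then show ?thesis using minus_equality[of "- f" f] by auto
qed

lemma poly_ring_minus: "f \<in> polys V \<Longrightarrow> g \<in> polys V \<Longrightarrow> f \<ominus>\<^bsub>poly_ring V\<^esub> g = f - g"
  by (simp add: a_minus_def poly_ring_a_inv)

subsection \<open>Monomials\<close>

lemma lookup_single_times [simp]: "lookup (single t c * f) (t + u) = c * lookup f u"
  for f :: "('k::field) mpoly"
proof -
  have "lookup (single t c * f) (t + u) = (\<Sum>l. lookup (single t c) l * (\<Sum>q. lookup f q when t + u = l + q))"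
    by (rule lookup_mult)
  also have "\<dots> = (\<Sum>l. (c * (\<Sum>q. lookup f q when t + u = t + q)) when l = t)"
    by (rule Sum_any.cong) (auto simp: lookup_single when_def)
  also have "\<dots> = c * (\<Sum>q. lookup f q when t + u = t + q)" by simp
  also have "(\<Sum>q. lookup f q when t + u = t + q) = (\<Sum>q. lookup f q when q = u)"
    by (rule Sum_any.cong) (auto simp: when_def)
  finally show ?thesis by simp
qed

lemma keys_single_times: "keys (single t 1 * f) = (+) t ` keys f"
  for f :: "('k::field) mpoly"
proof
  show "keys (single t 1 * f) \<subseteq> (+) t ` keys f"
    using keys_mult[of "single t 1" f] by auto
  show "(+) t ` keys f \<subseteq> keys (single t 1 * f)"
    by (auto simp: in_keys_iff)
qed

lemma lookup_single_times_out:
  fixes f :: "('k::field) mpoly"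
  assumes "v \<notin> range ((+) t)" shows "lookup (single t c * f) v = 0"
  using keys_mult[of "single t c" f] assms by (auto simp: in_keys_iff split: if_splits)

lemma lookup_Const_times [simp]: "lookup (Const c * f) t = c * lookup f t"
  using lookup_single_times[of 0 c f t] by (simp add: Const_def)

lemma Const_add: "Const (a + b) = Const a + Const b" by (simp add: Const_def single_add)
lemma Const_mult: "Const (a * b) = Const a * Const b" by (simp add: Const_def mult_single)
lemma Const_0 [simp]: "Const 0 = 0" by (simp add: Const_def)
lemma Const_1 [simp]: "Const 1 = 1" by (simp add: Const_def)
lemma Const_uminus: "Const (- a) = - Const a" by (simp add: Const_def single_uminus)
lemma Const_eq_0_iff [simp]: "Const a = 0 \<longleftrightarrow> a = 0"
  unfolding Const_def by (metis single_zero lookup_single_eq lookup_zero)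

lemma lookup_Const: "lookup (Const c) t = (if t = 0 then c else 0)"
  by (simp add: Const_def lookup_single when_def)

lemma single_eq_Const: "single t c = Const c * single t (1::'k::field)"
  by (simp add: Const_def mult_single)

lemma mpoly_expand: "f = (\<Sum>t\<in>keys f. single t (lookup f t))" for f :: "('k::field) mpoly"
proof (rule poly_mapping_eqI)
  fix u
  show "lookup f u = lookup (\<Sum>t\<in>keys f. single t (lookup f t)) u"
    by (simp add: lookup_sum lookup_single when_def in_keys_iff sum.delta')
qed

lemma mpoly_induct [case_names zero monomial add]:
  fixes f :: "('k::field) mpoly"
  assumes "P 0" "\<And>t c. P (single t c)" "\<And>f g. P f \<Longrightarrow> P g \<Longrightarrow> P (f + g)"
  shows "P f"
proof -
  have "P (\<Sum>t\<in>A. single t (lookup f t))" for A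
    by (induction A rule: infinite_finite_induct) (use assms in auto)
  then show ?thesis using mpoly_expand[of f] by metis
qed

lemma lookup_mult_0: "lookup (f * g) 0 = lookup f 0 * lookup g 0" for f g :: "('k::field) mpoly"
proof (induction f rule: mpoly_induct)
  case (monomial t c)
  show ?case
  proof (cases "t = 0")
    case True
    then show ?thesis using lookup_single_times[of 0 c g 0] by simp
  next
    case False
    then have "0 \<notin> range ((+) t)" using plus_eq_0_nat by (metis imageE)
    then show ?thesis using False lookup_single_times_out by (simp add: lookup_single)
  qed
qed (auto simp: lookup_add algebra_simps)

lemma single_decomp:
  assumes "i \<in> keys t"
  obtains u where "t = single i 1 + u" "single t c = Var i * single u (c::'k::field)"
proof -
  have "t = single i 1 + (t - single i 1)"
    by (rule poly_mapping_eqI) (use assms in \<open>auto simp: lookup_add lookup_minus lookup_single when_def in_keys_iff\<close>)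
  then show ?thesis using that by (metis Var_def mult_single mult_1)
qed

text \<open>A monomial other than 1 has a variable as a factor, so a polynomial without constant
  term is a sum of multiples of variables. Membership becomes a test on one coefficient.\<close>

lemma irrelevant_ideal_eq: "irrelevant_ideal V = {f \<in> polys V. lookup f 0 = (0::'k::field)}"
proof -
  let ?R = "poly_ring V :: 'k mpoly ring"
  interpret cring ?R by (rule cring_poly_ring)
  let ?I = "{f \<in> carrier ?R. lookup f 0 = 0}"
  have I: "ideal ?I ?R"
  proof (rule idealI)
    show "ring ?R" by (rule ring_axioms)
    show "subgroup ?I (add_monoid ?R)"
      by (rule add.subgroupI) (auto simp: lookup_add poly_ring_a_inv simp flip: a_inv_def)
  qed (auto simp: lookup_mult_0)
  have sub: "Var ` V \<subseteq> ?I" by (auto simp: Var_def lookup_single when_def in_polys)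
  have "?I \<subseteq> J" if J: "ideal J ?R" "Var ` V \<subseteq> J" for J
  proof
    interpret J: ideal J ?R by fact
    fix f assume f: "f \<in> ?I"
    have "single t (lookup f t) \<in> J" if "t \<in> keys f" for t
    proof -
      have "t \<noteq> 0" using that f by (auto simp: in_keys_iff)
      then obtain i where i: "i \<in> keys t" by fastforce
      then have "i \<in> V" using f that by (auto simp: in_polys)
      obtain u where u: "t = single i 1 + u" "single t (lookup f t) = Var i * single u (lookup f t)"
        using single_decomp[OF i] by metis
      have "keys u \<subseteq> V" using u(1) f that keys_plus_nat by (force simp: in_polys)
      then have "single u (lookup f t) \<in> carrier ?R" by (auto simp: in_polys)
      then show ?thesis using J.I_r_closed[of "Var i" "single u (lookup f t)"] J(2) \<open>i \<in> V\<close> u(2) by auto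
    qed
    moreover have "0 \<in> J" using additive_subgroup.zero_closed[OF J.additive_subgroup_axioms] by simp
    ultimately have "(\<Sum>t\<in>A. single t (lookup f t)) \<in> J" if "A \<subseteq> keys f" for A
      using that by (induction A rule: infinite_finite_induct) (use J.a_closed in auto)
    then show "f \<in> J" using mpoly_expand[of f] by (metis order_refl)
  qed
  then show ?thesis unfolding irrelevant_ideal_def genideal_def using I sub by blast
qed

subsection \<open>Substitution homomorphisms\<close>

definition subst_mon :: "(nat \<Rightarrow> 'k mpoly) \<Rightarrow> (nat \<Rightarrow>\<^sub>0 nat) \<Rightarrow> ('k::field) mpoly" where
  "subst_mon \<phi> t = (\<Prod>i\<in>keys t. \<phi> i ^ lookup t i)"

lemma subst_mon_superset: "finite A \<Longrightarrow> keys t \<subseteq> A \<Longrightarrow> subst_mon \<phi> t = (\<Prod>i\<in>A. \<phi> i ^ lookup t i)"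
  unfolding subst_mon_def by (rule prod.mono_neutral_left) (auto simp: in_keys_iff)

lemma subst_mon_add: "subst_mon \<phi> (s + t) = subst_mon \<phi> s * subst_mon \<phi> t"
proof -
  have "subst_mon \<phi> u = (\<Prod>i\<in>keys s \<union> keys t. \<phi> i ^ lookup u i)" if "keys u \<subseteq> keys s \<union> keys t" for u
    by (rule subst_mon_superset) (use that in auto)
  then show ?thesis by (simp add: keys_plus_nat lookup_add power_add prod.distrib)
qed

lemma poly_subst_superset:
  assumes "finite A" "keys f \<subseteq> A"
  shows "poly_subst \<phi> f = (\<Sum>t\<in>A. Const (lookup f t) * subst_mon \<phi> t)"
  unfolding poly_subst_def subst_mon_def[symmetric]
  by (rule sum.mono_neutral_left) (use assms in \<open>auto simp: in_keys_iff\<close>)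

lemma poly_subst_add: "poly_subst \<phi> (f + g) = poly_subst \<phi> f + poly_subst \<phi> g"
proof -
  have *: "poly_subst \<phi> h = (\<Sum>t\<in>keys f \<union> keys g. Const (lookup h t) * subst_mon \<phi> t)" if "keys h \<subseteq> keys f \<union> keys g" for h
    by (rule poly_subst_superset) (use that in auto)
  show ?thesis using *[of f] *[of g] *[OF keys_add] by (simp add: lookup_add Const_add sum.distrib distrib_right)
qed

lemma poly_subst_0 [simp]: "poly_subst \<phi> 0 = 0" by (simp add: poly_subst_def)

lemma poly_subst_single: "poly_subst \<phi> (single t c) = Const c * subst_mon \<phi> t"
  using poly_subst_superset[of "{t}" "single t c" \<phi>] by simp

lemma poly_subst_mult: "poly_subst \<phi> (f * g) = poly_subst \<phi> f * poly_subst \<phi> g"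
proof (induction f rule: mpoly_induct)
  case (monomial s c)
  show ?case
  proof (induction g rule: mpoly_induct)
    case (monomial t d)
    show ?case by (simp add: mult_single poly_subst_single subst_mon_add Const_mult algebra_simps)
  qed (auto simp: poly_subst_add algebra_simps)
qed (auto simp: poly_subst_add algebra_simps)

lemma poly_subst_Const [simp]: "poly_subst \<phi> (Const c) = Const c"
  by (simp add: Const_def[of c] poly_subst_single subst_mon_def)

lemma poly_subst_1 [simp]: "poly_subst \<phi> 1 = 1"
  using poly_subst_Const[of \<phi> 1] by simp

lemma poly_subst_Var [simp]: "poly_subst \<phi> (Var i) = \<phi> i"
  unfolding Var_def poly_subst_single by (simp add: subst_mon_def)

lemma poly_subst_uminus: "poly_subst \<phi> (- f) = - poly_subst \<phi> f"
  using poly_subst_add[of \<phi> f "- f"] by (simp add: eq_neg_iff_add_eq_0 add.commute)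

lemma poly_subst_diff: "poly_subst \<phi> (f - g) = poly_subst \<phi> f - poly_subst \<phi> g"
  using poly_subst_add[of \<phi> f "- g"] by (simp add: poly_subst_uminus)

lemma poly_subst_power: "poly_subst \<phi> (f ^ k) = poly_subst \<phi> f ^ k"
  by (induction k) (auto simp: poly_subst_mult)

lemma poly_subst_sum: "poly_subst \<phi> (sum f A) = (\<Sum>x\<in>A. poly_subst \<phi> (f x))"
  by (induction A rule: infinite_finite_induct) (auto simp: poly_subst_add)

lemma poly_subst_closed:
  assumes "\<And>i. i \<in> V \<Longrightarrow> \<phi> i \<in> polys W" "f \<in> polys V"
  shows "poly_subst \<phi> f \<in> polys W"
proof -
  have prod: "(\<Prod>i\<in>A. \<phi> i ^ e i) \<in> polys W" if "A \<subseteq> V" for A and e :: "nat \<Rightarrow> nat"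
    using that by (induction A rule: infinite_finite_induct) (auto simp: assms(1))
  show ?thesis unfolding poly_subst_def
    by (intro polys_sum polys_closed prod) (use assms(2) in \<open>auto simp: in_polys\<close>)
qed

subsection \<open>Homogeneous components\<close>

lemma monom_degree_superset: "finite A \<Longrightarrow> keys t \<subseteq> A \<Longrightarrow> monom_degree t = (\<Sum>i\<in>A. lookup t i)"
  unfolding monom_degree_def by (rule sum.mono_neutral_left) (auto simp: in_keys_iff)

lemma monom_degree_add: "monom_degree (s + t) = monom_degree s + monom_degree t"
proof -
  have "monom_degree u = (\<Sum>i\<in>keys s \<union> keys t. lookup u i)" if "keys u \<subseteq> keys s \<union> keys t" for u
    by (rule monom_degree_superset) (use that in auto)
  then show ?thesis by (simp add: keys_plus_nat lookup_add sum.distrib)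
qed

lemma monom_degree_single [simp]: "monom_degree (single i k) = k"
  by (simp add: monom_degree_def)

lemma monom_degree_0 [simp]: "monom_degree 0 = 0" by (simp add: monom_degree_def)

definition hcomp :: "int \<Rightarrow> ('k::field) mpoly \<Rightarrow> 'k mpoly" where
  "hcomp e f = (\<Sum>t\<in>{t \<in> keys f. int (monom_degree t) = e}. single t (lookup f t))"

lemma lookup_hcomp: "lookup (hcomp e f) t = (if int (monom_degree t) = e then lookup f t else 0)"
  by (simp add: hcomp_def lookup_sum lookup_single when_def in_keys_iff sum.delta')

lemma hcomp_add: "hcomp e (f + g) = hcomp e f + hcomp e g"
  by (rule poly_mapping_eqI) (simp add: lookup_hcomp lookup_add)

lemma hcomp_0 [simp]: "hcomp e 0 = 0"
  by (rule poly_mapping_eqI) (simp add: lookup_hcomp)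

lemma hcomp_sum: "hcomp e (sum f A) = (\<Sum>x\<in>A. hcomp e (f x))"
  by (induction A rule: infinite_finite_induct) (auto simp: hcomp_add)

lemma hcomp_homog: "f \<in> homog_part V a \<Longrightarrow> hcomp e f = (if e = a then f else 0)"
  by (rule poly_mapping_eqI) (auto simp: lookup_hcomp homog_part_def in_keys_iff)

lemma hcomp_in: "f \<in> polys V \<Longrightarrow> hcomp e f \<in> homog_part V e"
  by (auto simp: homog_part_def in_polys in_keys_iff lookup_hcomp split: if_splits)

lemma hcomp_polys: "f \<in> polys V \<Longrightarrow> hcomp e f \<in> polys V"
  using hcomp_in unfolding homog_part_def by blast

lemma hcomp_single_times: "hcomp e (single s c * f) = single s c * hcomp (e - int (monom_degree s)) f"
proof (rule poly_mapping_eqI)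
  fix v
  show "lookup (hcomp e (single s c * f)) v = lookup (single s c * hcomp (e - int (monom_degree s)) f) v"
  proof (cases "v \<in> range ((+) s)")
    case True
    then obtain u where "v = s + u" by blast
    then show ?thesis by (auto simp: lookup_hcomp monom_degree_add)
  next
    case False
    then show ?thesis by (simp add: lookup_hcomp lookup_single_times_out)
  qed
qed

lemma hcomp_homog_times:
  assumes "g \<in> homog_part V a" shows "hcomp e (g * f) = g * hcomp (e - a) f"
proof -
  have "hcomp e ((\<Sum>t\<in>keys g. single t (lookup g t)) * f) = (\<Sum>t\<in>keys g. single t (lookup g t)) * hcomp (e - a) f"
    unfolding sum_distrib_right hcomp_sum
    by (rule sum.cong) (use assms in \<open>auto simp: hcomp_single_times homog_part_def\<close>)
  then show ?thesis using mpoly_expand[of g] by simp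
qed

lemma hcomp_times_homog:
  assumes "g \<in> homog_part V a" shows "hcomp e (f * g) = hcomp (e - a) f * g"
  using hcomp_homog_times[OF assms] by (simp add: mult.commute)

lemma homog_part_mult:
  assumes "f \<in> homog_part V a" "g \<in> homog_part V b" shows "f * g \<in> homog_part V (a + b)"
proof -
  have "f * g = hcomp (a + b) (f * g)" using hcomp_homog_times[OF assms(1), of "a+b" g] hcomp_homog[OF assms(2)] by simp
  moreover have "f * g \<in> polys V" using assms unfolding homog_part_def by simp
  ultimately show ?thesis using hcomp_in by metis
qed

lemma homog_part_0 [simp]: "0 \<in> homog_part V a"
  by (simp add: homog_part_def)

lemma Var_homog: "i \<in> V \<Longrightarrow> Var i \<in> homog_part V 1"
  by (auto simp: homog_part_def Var_def in_polys)

lemma Const_homog: "Const c \<in> homog_part V 0"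
  by (auto simp: homog_part_def Const_def in_polys)

lemma homog_neg: "f \<in> homog_part V e \<Longrightarrow> e < 0 \<Longrightarrow> f = 0"
  using hcomp_homog[of f V e e] by (intro poly_mapping_eqI) (metis lookup_hcomp lookup_zero of_nat_less_0_iff)

section \<open>Graded free modules\<close>

lemma imul_image:
  assumes "0 \<in> F" "\<And>x y. x \<in> F \<Longrightarrow> y \<in> F \<Longrightarrow> x + y \<in> F" "\<And>i x. i \<in> V \<Longrightarrow> x \<in> F \<Longrightarrow> act i x \<in> F"
    and \<pi>: "\<And>x y. x \<in> F \<Longrightarrow> y \<in> F \<Longrightarrow> \<pi> (x + y) = \<pi> x + \<pi> y"
      "\<And>i x. i \<in> V \<Longrightarrow> x \<in> F \<Longrightarrow> \<pi> (act i x) = act' i (\<pi> x)"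
    and "set l \<subseteq> V"
  shows "imul act l F \<subseteq> F \<and> \<pi> ` imul act l F = imul act' l (\<pi> ` F)"
  using assms(6)
proof (induction l)
  case Nil
  then show ?case using assms(1) \<pi>(1)[of 0 0] by simp
next
  case (Cons a l)
  then have IH: "imul act l F \<subseteq> F" "imul act' l (\<pi> ` F) = \<pi> ` imul act l F" and a: "a \<in> V" by auto
  have 1: "imul act (a # l) F \<subseteq> F" using IH(1) assms(2,3) a by auto
  have *: "\<pi> (y + act a x) = \<pi> y + act' a (\<pi> x)" if "y \<in> imul act l F" "x \<in> F" for x y
    using that IH(1) assms(3)[OF a] \<pi>(1)[of y "act a x"] \<pi>(2)[OF a] by auto
  have "\<pi> ` imul act (a # l) F = {\<pi> (y + act a x) |y x. y \<in> imul act l F \<and> x \<in> F}" by auto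
  also have "\<dots> = {\<pi> y + act' a (\<pi> x) |y x. y \<in> imul act l F \<and> x \<in> F}" using * by metis
  also have "\<dots> = imul act' (a # l) (\<pi> ` F)" unfolding imul.simps IH(2) by blast
  finally show ?case using 1 by blast
qed

lemma (in ops) imul_submod: "submod M \<Longrightarrow> set l \<subseteq> V \<Longrightarrow> submod (imul act l M)"
  by (induction l) (auto simp: submod_zero submod_reg simp del: Collect_ex_eq)

definition vscale :: "'k::field \<Rightarrow> (nat \<Rightarrow> 'k mpoly) \<Rightarrow> nat \<Rightarrow> 'k mpoly" where
  "vscale c v = (\<lambda>j. Const c * v j)"

definition vact :: "nat \<Rightarrow> (nat \<Rightarrow> ('k::field) mpoly) \<Rightarrow> nat \<Rightarrow> 'k mpoly" where
  "vact i v = (\<lambda>j. Var i * v j)"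

lemma ops_v: "ops vscale vact"
  by unfold_locales (auto simp: vscale_def vact_def algebra_simps fun_eq_iff)

definition pscale :: "'k::field \<Rightarrow> 'k mpoly \<Rightarrow> 'k mpoly" where
  "pscale c f = Const c * f"

lemma ops_p: "ops pscale (\<lambda>i f. \<psi> i * f)"
  by unfold_locales (auto simp: pscale_def algebra_simps)

abbreviation free :: "nat set \<Rightarrow> int list \<Rightarrow> (nat \<Rightarrow> ('k::field) mpoly) set" where
  "free V as \<equiv> carrier (free_mod V as)"

lemma free_mod_simps [simp]:
  "add (free_mod V as) = (+)" "ring.zero (free_mod V as) = 0" "smult (free_mod V as) r v = (\<lambda>j. r * v j)"
  by (simp_all add: free_mod_def plus_fun_def[abs_def] zero_fun_def)

lemma in_free: "v \<in> free V as \<longleftrightarrow> (\<forall>j. v j \<in> polys V) \<and> (\<forall>j\<ge>length as. v j = 0)"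
  unfolding free_mod_def by (auto simp: not_less) (metis not_less polys_closed(1))

lemma free_submod: "ops.submod vscale vact V (free V as)"
proof -
  interpret ops vscale vact V by (rule ops_v)
  show ?thesis by (rule submodI) (auto simp: in_free vscale_def vact_def)
qed

text \<open>The submodule generated by the multiples of the variables in \<open>P\<close>.\<close>

definition vmon :: "nat set \<Rightarrow> int list \<Rightarrow> nat set \<Rightarrow> (nat \<Rightarrow> ('k::field) mpoly) set" where
  "vmon V as P = {v \<in> free V as. \<forall>j. \<forall>t\<in>keys (v j). \<exists>i\<in>P. i \<in> keys t}"

lemma vmon_empty: "vmon V as {} = {0}"
  by (auto simp: vmon_def in_free fun_eq_iff)

lemma vmon_submod: "ops.submod vscale vact V (vmon V as P)"
proof -
  interpret ops vscale vact V by (rule ops_v)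
  note F = submodD[OF free_submod[of V as]]
  show ?thesis
  proof (rule submodI)
    show "0 \<in> vmon V as P" using F(1) by (simp add: vmon_def)
  next
    fix x y :: "nat \<Rightarrow> 'a mpoly" assume "x \<in> vmon V as P" "y \<in> vmon V as P"
    then show "x + y \<in> vmon V as P" using F(2)[of x y] keys_add[of "x j" "y j" for j]
      unfolding vmon_def by fastforce
  next
    fix x :: "nat \<Rightarrow> 'a mpoly" assume "x \<in> vmon V as P"
    then show "- x \<in> vmon V as P" using F(3)[of x] unfolding vmon_def by (auto simp: in_keys_iff)
  next
    fix c and x :: "nat \<Rightarrow> 'a mpoly" assume "x \<in> vmon V as P"
    then show "vscale c x \<in> vmon V as P" using F(4)[of x c] unfolding vmon_def by (auto simp: in_keys_iff vscale_def)
  next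
    fix i and x :: "nat \<Rightarrow> 'a mpoly" assume "i \<in> V" "x \<in> vmon V as P"
    then show "vact i x \<in> vmon V as P" using F(5)[of i x] unfolding vmon_def
      by (auto simp: vact_def Var_def keys_single_times keys_plus_nat)
  qed
qed

text \<open>The terms divisible by \<open>Var a\<close> are collected in \<open>x\<close>. The bound
  on \<open>keys y\<close> says that the remainder has only exponents of \<open>f\<close>, so
  divisibility of its terms by other variables passes from \<open>f\<close> to
  \<open>y\<close>.\<close>

lemma poly_split_var:
  assumes "f \<in> polys V" "a \<in> V"
  obtains y x where "y \<in> polys V" "x \<in> polys V" "f = y + Var a * x" "keys y \<subseteq> {t \<in> keys f. a \<notin> keys t}"
proof -
  let ?A = "{t \<in> keys f. a \<in> keys t}" and ?B = "{t \<in> keys f. a \<notin> keys t}"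
  define y where "y = (\<Sum>t\<in>?B. single t (lookup f t))"
  have ex: "\<forall>t\<in>?A. \<exists>u. t = single a 1 + u \<and> single t (lookup f t) = Var a * single u (lookup f t)"
    using single_decomp by (metis (mono_tags, lifting) mem_Collect_eq)
  obtain u where u': "\<forall>t\<in>?A. t = single a 1 + u t \<and> single t (lookup f t) = Var a * single (u t) (lookup f t)"
    using bchoice[OF ex] by (elim exE)
  have u: "t = single a 1 + u t" "single t (lookup f t) = Var a * single (u t) (lookup f t)" if "t \<in> ?A" for t
    using bspec[OF u' that] by blast+
  define x where "x = (\<Sum>t\<in>?A. single (u t) (lookup f t))"
  have "keys f = ?B \<union> ?A" by auto
  then have "f = (\<Sum>t\<in>?B \<union> ?A. single t (lookup f t))" using mpoly_expand[of f] by metis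
  also have "\<dots> = y + (\<Sum>t\<in>?A. single t (lookup f t))"
    unfolding y_def by (rule sum.union_disjoint) auto
  also have "(\<Sum>t\<in>?A. single t (lookup f t)) = Var a * x"
    unfolding x_def sum_distrib_left by (rule sum.cong) (use u(2) in auto)
  finally have "f = y + Var a * x" .
  moreover have "y \<in> polys V" unfolding y_def using assms(1) by (intro polys_sum) (auto simp: in_polys)
  moreover have "x \<in> polys V" unfolding x_def
  proof (rule polys_sum)
    fix t assume t: "t \<in> ?A"
    have "keys (u t) \<subseteq> keys t" using u(1)[OF t] keys_plus_nat by (metis Un_upper2)
    then show "single (u t) (lookup f t) \<in> polys V" using t assms(1) by (auto simp: in_polys)
  qed
  moreover have "keys y \<subseteq> ?B"
    unfolding y_def by (auto simp: in_keys_iff lookup_sum lookup_single when_def sum.delta' split: if_splits)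
  ultimately show ?thesis using that by blast
qed

text \<open>Matches the recursion of \<open>imul\<close> and \<open>regular_on\<close>, with one
  more variable in \<open>P\<close> at each step.\<close>

lemma vmon_step:
  assumes "a \<in> V"
  shows "{y + vact a x |y x. y \<in> vmon V as P \<and> x \<in> free V as} = vmon V as (insert a P)" (is "?L = ?R")
proof
  interpret ops vscale vact V by (rule ops_v)
  note F = submodD[OF free_submod[of V as]] and R = submodD[OF vmon_submod[of V as "insert a P"]]
  show "?L \<subseteq> ?R"
  proof safe
    fix y x :: "nat \<Rightarrow> 'a mpoly" assume "y \<in> vmon V as P" "x \<in> free V as"
    then have "y \<in> ?R" "vact a x \<in> ?R" using F(5)[OF assms, of x] unfolding vmon_def
      by (auto simp: vact_def Var_def keys_single_times keys_plus_nat)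
    then show "y + vact a x \<in> ?R" by (rule R(2))
  qed
  show "?R \<subseteq> ?L"
  proof
    fix v :: "nat \<Rightarrow> 'a mpoly" assume v: "v \<in> ?R"
    then have vp: "v j \<in> polys V" "j \<ge> length as \<Longrightarrow> v j = 0" for j by (auto simp: vmon_def in_free)
    have ex: "\<forall>j. \<exists>y x. y \<in> polys V \<and> x \<in> polys V \<and> v j = y + Var a * x \<and> keys y \<subseteq> {t \<in> keys (v j). a \<notin> keys t} \<and>
      (j \<ge> length as \<longrightarrow> y = 0 \<and> x = 0)" (is "\<forall>j. ?P j")
    proof
    fix j show "?P j"
    proof (cases "j \<ge> length as")
      case True then show ?thesis using vp(2)[of j] by simp
    next
      case False
      obtain y x where "y \<in> polys V" "x \<in> polys V" "v j = y + Var a * x" "keys y \<subseteq> {t \<in> keys (v j). a \<notin> keys t}"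
        by (rule poly_split_var[OF vp(1)[of j] assms])
      then show ?thesis using False by (intro exI[of _ y] exI[of _ x]) simp
    qed
    qed
    from choice[OF ex] obtain y where y: "\<forall>j. \<exists>x. y j \<in> polys V \<and> x \<in> polys V \<and> v j = y j + Var a * x \<and> keys (y j) \<subseteq> {t \<in> keys (v j). a \<notin> keys t} \<and>
      (j \<ge> length as \<longrightarrow> y j = 0 \<and> x = 0)" by (elim exE)
    from choice[OF y] obtain x where x: "\<forall>j. y j \<in> polys V \<and> x j \<in> polys V \<and> v j = y j + Var a * x j \<and> keys (y j) \<subseteq> {t \<in> keys (v j). a \<notin> keys t} \<and>
      (j \<ge> length as \<longrightarrow> y j = 0 \<and> x j = 0)" by (elim exE)
    have yx: "y j \<in> polys V" "x j \<in> polys V" "v j = y j + Var a * x j"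
      "keys (y j) \<subseteq> {t \<in> keys (v j). a \<notin> keys t}" "j \<ge> length as \<Longrightarrow> y j = 0 \<and> x j = 0" for j
      using spec[OF x, of j] by blast+
    have "x \<in> free V as" "y \<in> free V as" using yx by (auto simp: in_free)
    moreover have "y \<in> vmon V as P"
      using \<open>y \<in> free V as\<close> yx(4) v unfolding vmon_def by fastforce
    moreover have "v = y + vact a x" using yx(3) by (auto simp: vact_def)
    ultimately show "v \<in> ?L" by blast
  qed
qed

text \<open>Multiplying a monomial by a variable outside \<open>P\<close> does not make it divisible
  by a variable in \<open>P\<close>, hence such a variable is a nonzerodivisor modulo
  \<open>vmon V as P\<close>. \<open>distinct l\<close> keeps the next variable outside the enlarged
  \<open>P\<close>.\<close>

lemma free_regular:
  assumes "distinct l" "set l \<subseteq> V" "set l \<inter> P = {}"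
  shows "regular_on vact l (free V as) (vmon V as P)"
  using assms
proof (induction l arbitrary: P)
  case (Cons a l)
  have "x \<in> vmon V as P" if x: "x \<in> free V as" "vact a x \<in> vmon V as P" for x :: "nat \<Rightarrow> 'a mpoly"
    unfolding vmon_def
  proof (intro CollectI conjI allI ballI)
    fix j t assume "t \<in> keys (x j)"
    then have "single a 1 + t \<in> keys (vact a x j)" by (simp add: vact_def Var_def keys_single_times)
    then obtain i where "i \<in> P" "i \<in> keys (single a (1::nat) + t)" using x(2) unfolding vmon_def by blast
    then show "\<exists>i\<in>P. i \<in> keys t" using Cons.prems by (auto simp: keys_plus_nat)
  qed (use x in simp)
  moreover have "regular_on vact l (free V as) (vmon V as (insert a P) :: (nat \<Rightarrow> 'a mpoly) set)"
    using Cons.prems by (intro Cons.IH) auto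
  ultimately show ?case using Cons.prems by (simp add: vmon_step del: Collect_ex_eq)
qed simp

lemma vmon_sub: "vmon V as P \<subseteq> free V as"
  by (auto simp: vmon_def)

lemma free_acyclic:
  assumes "distinct l" "set l \<subseteq> V" "q > 0"
  shows "kcyc vact l q (free V as) {0} \<subseteq> kbnd vact l q (free V as) {0}"
proof -
  interpret ops vscale vact V by (rule ops_v)
  have "regular_on vact l (free V as) {0}"
    using free_regular[OF assms(1,2), of "{}" as] by (simp add: vmon_empty)
  then show ?thesis using submodD(1)[OF free_submod]
    by (intro koszul_acyclic[OF free_submod assms(2,3) submod_zero]) auto
qed

lemma imul_free:
  assumes "set l \<subseteq> V"
  shows "imul vact l (free V as) = vmon V as (set l)"
  using assms by (induction l) (auto simp: vmon_empty vmon_step simp del: Collect_ex_eq)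

lemma vmon_irrelevant: "vmon V as V = {v \<in> free V as. \<forall>j<length as. v j \<in> irrelevant_ideal V}"
proof -
  have "(\<forall>t\<in>keys f. \<exists>i\<in>V. i \<in> keys t) \<longleftrightarrow> lookup f 0 = 0" if "f \<in> polys V" for f :: "'a mpoly"
  proof
    assume "\<forall>t\<in>keys f. \<exists>i\<in>V. i \<in> keys t"
    then show "lookup f 0 = 0" by (metis in_keys_iff keys_zero empty_iff)
  next
    assume *: "lookup f 0 = 0"
    show "\<forall>t\<in>keys f. \<exists>i\<in>V. i \<in> keys t"
    proof
      fix t assume t: "t \<in> keys f"
      then have "t \<noteq> 0" using * by (auto simp: in_keys_iff)
      then obtain i where "i \<in> keys t" by fastforce
      then show "\<exists>i\<in>V. i \<in> keys t" using t that by (auto simp: in_polys)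
    qed
  qed
  then show ?thesis unfolding vmon_def irrelevant_ideal_eq in_free by (auto simp: not_less) (metis keys_zero empty_iff not_less lookup_zero)+
qed

lemma vmon_const: "v \<in> vmon V as V \<longleftrightarrow> v \<in> free V as \<and> (\<forall>j. lookup (v j) 0 = 0)"
  unfolding vmon_irrelevant irrelevant_ideal_eq in_free by auto (metis lookup_zero not_less)

definition unit_vec :: "nat \<Rightarrow> nat \<Rightarrow> ('k::field) mpoly" where
  "unit_vec j = (\<lambda>i. if i = j then 1 else 0)"

lemma unit_vec_free: "j < length as \<Longrightarrow> unit_vec j \<in> free V as"
  by (auto simp: unit_vec_def in_free)

lemma free_quot_zero: "free V as \<subseteq> vmon V as V \<longleftrightarrow> length as = 0"
proof
  assume *: "(free V as :: (nat \<Rightarrow> 'a mpoly) set) \<subseteq> vmon V as V"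
  show "length as = 0"
  proof (rule ccontr)
    assume "length as \<noteq> 0"
    then have "(unit_vec 0 :: nat \<Rightarrow> 'a mpoly) \<in> free V as" by (intro unit_vec_free) simp
    then have "(unit_vec 0 :: nat \<Rightarrow> 'a mpoly) \<in> vmon V as V" by (rule subsetD[OF *])
    then have "lookup (unit_vec 0 0 :: 'a mpoly) 0 = 0" unfolding vmon_const by (elim conjE spec)
    then show False by (simp add: unit_vec_def lookup_one)
  qed
qed (auto simp: vmon_const in_free)

text \<open>The classes modulo the irrelevant ideal are the vectors of constant terms. Rank at least
  2 is excluded by two coordinates: the first two unit vectors cannot both be multiples of the same
  \<open>z\<close>.\<close>

lemma free_quot_line: "quot_line vscale (free V as :: (nat \<Rightarrow> 'k::field mpoly) set) (vmon V as V) \<longleftrightarrow> length as = 1"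
proof
  interpret ops vscale vact V by (rule ops_v)
  note F = submodD[OF free_submod[of V as]]
  assume "quot_line vscale (free V as :: (nat \<Rightarrow> 'k::field mpoly) set) (vmon V as V)"
  then obtain z :: "nat \<Rightarrow> 'k mpoly" where z: "z \<in> free V as" "z \<notin> vmon V as V"
    "\<And>y. y \<in> free V as \<Longrightarrow> \<exists>c. y + vscale c z \<in> vmon V as V" unfolding quot_line_def by blast
  have "length as \<noteq> 0" using z(1,2) free_quot_zero[of V as] by auto
  moreover have "\<not> length as \<ge> 2"
  proof
    assume l: "length as \<ge> 2"
    then have "0 < length as" "1 < length as" by linarith+
    note z' = this[THEN unit_vec_free, THEN z(3)]
    obtain c where c: "unit_vec 0 + vscale c z \<in> vmon V as V" using z'(1) by blast
    obtain d where d: "unit_vec 1 + vscale d z \<in> vmon V as V" using z'(2) by blast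
    have "1 + c * lookup (z 0) 0 = 0" "c * lookup (z 1) 0 = 0"
      using c[unfolded vmon_const, THEN conjunct2, THEN spec, of 0] c[unfolded vmon_const, THEN conjunct2, THEN spec, of 1]
      by (simp_all add: lookup_add vscale_def unit_vec_def lookup_one)
    moreover have "1 + d * lookup (z 1) 0 = 0"
      using d[unfolded vmon_const, THEN conjunct2, THEN spec, of 1]
      by (simp_all add: lookup_add vscale_def unit_vec_def lookup_one)
    ultimately show False by auto
  qed
  ultimately show "length as = 1" by linarith
next
  interpret ops vscale vact V by (rule ops_v)
  note F = submodD[OF free_submod[of V as]]
  assume l: "length as = 1"
  show "quot_line vscale (free V as :: (nat \<Rightarrow> 'k::field mpoly) set) (vmon V as V)"
    unfolding quot_line_def
  proof (intro bexI conjI ballI)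
    show u: "(unit_vec 0 :: nat \<Rightarrow> 'k mpoly) \<in> free V as" using l by (intro unit_vec_free) simp
    show "(unit_vec 0 :: nat \<Rightarrow> 'k mpoly) \<notin> vmon V as V" unfolding vmon_const
      by (auto intro!: exI[of _ 0] simp: unit_vec_def lookup_one)
    fix y :: "nat \<Rightarrow> 'k mpoly" assume y: "y \<in> free V as"
    let ?c = "- lookup (y 0) 0"
    have "lookup ((y + vscale ?c (unit_vec 0)) j) 0 = 0" for j
      using y l by (cases j) (auto simp: lookup_add vscale_def unit_vec_def lookup_one lookup_Const in_free)
    then have "y + vscale ?c (unit_vec 0) \<in> vmon V as V" unfolding vmon_const using F(2,4) u y by blast
    then show "\<exists>c. y + vscale c (unit_vec 0) \<in> vmon V as V" by blast
  qed
qed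

section \<open>Minimal resolutions compute Koszul homology\<close>

text \<open>Linearity is asked on \<open>F\<close> only, because the maps of a resolution are
  unconstrained outside the carriers.\<close>

definition act_hom where
  "act_hom s act s' act' V F \<pi> \<longleftrightarrow>
     (\<forall>x\<in>F. \<forall>y\<in>F. \<pi> (x + y) = \<pi> x + \<pi> y) \<and> (\<forall>c. \<forall>x\<in>F. \<pi> (s c x) = s' c (\<pi> x)) \<and>
     (\<forall>i\<in>V. \<forall>x\<in>F. \<pi> (act i x) = act' i (\<pi> x))"

lemma act_homD:
  assumes "act_hom s act s' act' V F \<pi>"
  shows "x \<in> F \<Longrightarrow> y \<in> F \<Longrightarrow> \<pi> (x + y) = \<pi> x + \<pi> y" "x \<in> F \<Longrightarrow> \<pi> (s c x) = s' c (\<pi> x)"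
    "i \<in> V \<Longrightarrow> x \<in> F \<Longrightarrow> \<pi> (act i x) = act' i (\<pi> x)"
  using assms by (simp_all add: act_hom_def)

lemma act_hom_zero:
  fixes \<pi> :: "'b::ab_group_add \<Rightarrow> 'a::ab_group_add"
  assumes "act_hom s act s' act' V F \<pi>" "0 \<in> F" shows "\<pi> 0 = 0"
  using act_homD(1)[OF assms(1,2,2)] by simp

lemma act_hom_uminus:
  fixes \<pi> :: "'b::ab_group_add \<Rightarrow> 'a::ab_group_add"
  assumes "act_hom s act s' act' V F \<pi>" "0 \<in> F" "x \<in> F" "- x \<in> F" shows "\<pi> (- x) = - \<pi> x"
  using act_homD(1)[OF assms(1,3,4)] act_hom_zero[OF assms(1,2)] by (simp add: eq_neg_iff_add_eq_0 add.commute)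

lemma act_hom_image:
  assumes "ops s act" "ops s' act'" and F: "ops.submod s act V F" and h: "act_hom s act s' act' V F \<pi>"
  shows "ops.submod s' act' V (\<pi> ` F)"
proof -
  interpret A: ops s act V by fact
  interpret B: ops s' act' V by fact
  note F' = A.submodD[OF F] and h' = act_homD[OF h]
  show ?thesis
  proof (rule B.submodI)
    show "0 \<in> \<pi> ` F" using act_hom_zero[OF h] F'(1) by force
  next
    fix x y assume "x \<in> \<pi> ` F" "y \<in> \<pi> ` F"
    then obtain u v where "u \<in> F" "v \<in> F" "x = \<pi> u" "y = \<pi> v" by blast
    then have "u + v \<in> F" "x + y = \<pi> (u + v)" using F'(2) h'(1) by simp_all
    then show "x + y \<in> \<pi> ` F" by blast
  next
    fix x assume "x \<in> \<pi> ` F"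
    then obtain u where "u \<in> F" "x = \<pi> u" by blast
    then have "- u \<in> F" "- x = \<pi> (- u)" using F'(3) act_hom_uminus[OF h F'(1)] by simp_all
    then show "- x \<in> \<pi> ` F" by blast
  next
    fix c x assume "x \<in> \<pi> ` F"
    then obtain u where "u \<in> F" "x = \<pi> u" by blast
    then have "s c u \<in> F" "s' c x = \<pi> (s c u)" using F'(4) h'(2) by simp_all
    then show "s' c x \<in> \<pi> ` F" by blast
  next
    fix i x assume "i \<in> V" "x \<in> \<pi> ` F"
    then obtain u where "u \<in> F" "x = \<pi> u" by blast
    then have "act i u \<in> F" "act' i x = \<pi> (act i u)" using F'(5) h'(3) \<open>i \<in> V\<close> by simp_all
    then show "act' i x \<in> \<pi> ` F" by blast
  qed
qed

lemma act_hom_kernel: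
  assumes "ops s act" "ops s' act'" and F: "ops.submod s act V F" and h: "act_hom s act s' act' V F \<pi>"
  shows "ops.submod s act V {x \<in> F. \<pi> x = 0}"
proof -
  interpret A: ops s act V by fact
  interpret B: ops s' act' V by fact
  note F' = A.submodD[OF F] and h' = act_homD[OF h]
  show ?thesis
    by (rule A.submodI) (auto simp: h' F' act_hom_zero[OF h] act_hom_uminus[OF h])
qed

lemma imul_act_hom:
  assumes "ops s act" "ops s' act'" and F: "ops.submod s act V F" and h: "act_hom s act s' act' V F \<pi>"
    and "set l \<subseteq> V"
  shows "imul act l F \<subseteq> F" "\<pi> ` imul act l F = imul act' l (\<pi> ` F)"
proof -
  interpret A: ops s act V by fact
  note F' = A.submodD[OF F] and h' = act_homD[OF h]
  have "imul act l F \<subseteq> F \<and> \<pi> ` imul act l F = imul act' l (\<pi> ` F)"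
    by (rule imul_image[where V=V]) (use F' h' \<open>set l \<subseteq> V\<close> in auto)
  then show "imul act l F \<subseteq> F" "\<pi> ` imul act l F = imul act' l (\<pi> ` F)" by auto
qed

text \<open>For \<open>q > 0\<close>, cycles of \<open>Z\<close> bound in \<open>F\<close> because
  \<open>F\<close> is acyclic. For \<open>q = 0\<close>, a cycle is any element of \<open>Z\<close>,
  and it bounds in \<open>F\<close> because it lies in \<open>vmon V as V\<close>. This is where
  minimality enters the shift.\<close>

lemma koszul_shift_free:
  fixes s' :: "'k::field \<Rightarrow> 'b::ab_group_add \<Rightarrow> 'b" and \<pi> :: "(nat \<Rightarrow> 'k mpoly) \<Rightarrow> 'b"
  assumes l: "distinct l" "set l = V" and "ops s' act'"
    and h: "act_hom vscale vact s' act' V (free V as) \<pi>"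
    and Z: "Z = {x \<in> free V as. \<pi> x = 0}" "Z \<subseteq> vmon V as V" and q: "q \<ge> 0"
  shows "quot_iso (fscale s') (kcyc act' l (q + 1) (\<pi> ` free V as) {0}) (kbnd act' l (q + 1) (\<pi> ` free V as) {0})
    (fscale vscale) (kcyc vact l q Z {0}) (kbnd vact l q Z {0})"
proof -
  interpret A: ops vscale vact V by (rule ops_v)
  interpret B: ops s' act' V by fact
  have lV: "set l \<subseteq> V" using l by simp
  have ZF: "Z \<subseteq> free V as" using Z(1) by blast
  have Zs: "A.submod Z" unfolding Z(1) by (rule act_hom_kernel[OF ops_v \<open>ops s' act'\<close> free_submod h])
  show ?thesis
  proof (rule koszul_shift[OF ops_v \<open>ops s' act'\<close> free_submod Zs _ lV _ _ _ refl Z(1)])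
    show "B.submod (\<pi> ` free V as)" by (rule act_hom_image[OF ops_v \<open>ops s' act'\<close> free_submod h])
    show "kcyc vact l (q + 1) (free V as) {0 :: nat \<Rightarrow> 'k mpoly} \<subseteq> kbnd vact l (q + 1) (free V as) {0}"
      using q by (intro free_acyclic[OF l(1) lV]) simp
    show "kcyc vact l q Z {0} \<subseteq> kbnd vact l q (free V as) {0}"
    proof (cases "q = 0")
      case False
      have "kcyc vact l q Z {0} \<subseteq> kcyc vact l q (free V as) {0}"
      proof
        fix f assume "f \<in> kcyc vact l q Z {0}"
        then show "f \<in> kcyc vact l q (free V as) {0}" unfolding kcyc_null using subsetD[OF kchains_mono[OF ZF]] by blast
      qed
      also have "\<dots> \<subseteq> kbnd vact l q (free V as) {0}" using False q by (intro free_acyclic[OF l(1) lV]) auto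
      finally show ?thesis .
    next
      case True
      show ?thesis
      proof
        fix z assume z: "z \<in> kcyc vact l q Z {0}"
        then have zc: "z \<in> kchains (length l) 0 Z" unfolding kcyc_null True by simp
        obtain x where x: "z = kbot (length l) x" "x \<in> Z" using chain_kbot[OF zc] by blast
        have "x \<in> imul vact l (free V as)" using x(2) Z(2) l(2) by (auto simp: imul_free[OF lV])
        then have "\<exists>g\<in>kchains (length l) 1 (free V as). z = kd vact l g"
          using A.imul_boundary[OF free_submod lV] x by blast
        moreover have "z \<in> kchains (length l) 0 (free V as)"
          using subsetD[OF kchains_mono[OF ZF] zc] .
        ultimately show "z \<in> kbnd vact l q (free V as) {0}" unfolding kbnd_null True by simp
      qed
    qed
  qed (use act_homD[OF h] in auto)
qed

text \<open>The surjection from \<open>F\<close> onto its image \<open>M\<close> always induces a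
  surjection from \<open>F / m F\<close> onto \<open>M / m M\<close>, with \<open>m\<close> the
  irrelevant ideal; it is injective because the kernel lies in \<open>m F\<close>.\<close>

lemma quot_iso_cover:
  fixes s' :: "'k::field \<Rightarrow> 'b::ab_group_add \<Rightarrow> 'b" and \<pi> :: "(nat \<Rightarrow> 'k mpoly) \<Rightarrow> 'b"
  assumes l: "set l = V" and "ops s' act'"
    and h: "act_hom vscale vact s' act' V (free V as) \<pi>"
    and Z: "{x \<in> free V as. \<pi> x = 0} \<subseteq> vmon V as V"
  shows "quot_iso vscale (free V as) (vmon V as V) s' (\<pi> ` free V as) (imul act' l (\<pi> ` free V as))"
proof -
  interpret A: ops vscale vact V by (rule ops_v)
  note F = A.submodD[OF free_submod[of V as]]
  have lV: "set l \<subseteq> V" using l by simp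
  have im: "\<pi> ` vmon V as V = imul act' l (\<pi> ` free V as)"
    using imul_act_hom(2)[OF ops_v \<open>ops s' act'\<close> free_submod h lV] l by (simp add: imul_free[OF lV])
  show ?thesis
  proof (rule quot_isoI[of "\<lambda>x y. x \<in> free V as \<and> y = \<pi> x"], goal_cases)
    case (3 x y x' y')
    then show ?case using act_homD(1)[OF h] F(2) by auto
  next
    case (4 c x y)
    then show ?case using act_homD(2)[OF h] F(4) by auto
  next
    case (7 x y)
    then show ?case using im by blast
  next
    case (8 x y)
    then have "y \<in> \<pi> ` vmon V as V" using im by simp
    then obtain w where w: "w \<in> vmon V as V" "y = \<pi> w" by blast
    have wf: "w \<in> free V as" using w vmon_sub by blast
    have "\<pi> (x + - w) = \<pi> x + \<pi> (- w)" using 8 wf F(3) by (intro act_homD(1)[OF h]) blast+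
    also have "\<pi> (- w) = - \<pi> w" using wf F(3) by (intro act_hom_uminus[OF h F(1)])
    finally have "\<pi> (x + - w) = 0" using 8 w(2) by (metis add.right_inverse)
    then have "x + - w \<in> vmon V as V" using Z 8 F(2,3) wf by blast
    then have "(x + - w) + w \<in> vmon V as V" using A.submodD(2)[OF vmon_submod] w(1) by blast
    then show ?case by simp
  qed auto
qed

lemma kernel_ideal: "ideal {f \<in> polys V. poly_subst \<psi> f = (0::'k::field mpoly)} (poly_ring V)"
proof -
  interpret cring "poly_ring V :: 'k mpoly ring" by (rule cring_poly_ring)
  show ?thesis
  proof (rule idealI)
    show "ring (poly_ring V :: 'k mpoly ring)" by (rule ring_axioms)
    show "subgroup {f \<in> polys V. poly_subst \<psi> f = (0::'k mpoly)} (add_monoid (poly_ring V))"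
      by (rule add.subgroupI) (auto simp: poly_subst_add poly_ring_a_inv poly_subst_uminus simp flip: a_inv_def intro: exI[of _ 0])
  qed (auto simp: poly_subst_mult)
qed

lemma coset_eq_iff:
  assumes "ideal J (poly_ring V)" "f \<in> polys V" "g \<in> polys V"
  shows "J +>\<^bsub>poly_ring V\<^esub> f = J +>\<^bsub>poly_ring V\<^esub> g \<longleftrightarrow> f - g \<in> J"
proof -
  interpret ideal J "poly_ring V" by fact
  show ?thesis using quotient_eq_iff_same_a_r_cos[OF assms] assms(2,3) by (simp add: poly_ring_minus)
qed

lemma quot_simps:
  assumes "ideal J (poly_ring V)"
  shows "carrier (poly_ring V Quot J) = (\<lambda>f. J +>\<^bsub>poly_ring V\<^esub> f) ` polys V"
    "f \<in> polys V \<Longrightarrow> g \<in> polys V \<Longrightarrow> (J +>\<^bsub>poly_ring V\<^esub> f) \<oplus>\<^bsub>poly_ring V Quot J\<^esub> (J +>\<^bsub>poly_ring V\<^esub> g) = J +>\<^bsub>poly_ring V\<^esub> (f + g)"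
    "f \<in> polys V \<Longrightarrow> g \<in> polys V \<Longrightarrow> (J +>\<^bsub>poly_ring V\<^esub> f) \<otimes>\<^bsub>poly_ring V Quot J\<^esub> (J +>\<^bsub>poly_ring V\<^esub> g) = J +>\<^bsub>poly_ring V\<^esub> (f * g)"
    "\<zero>\<^bsub>poly_ring V Quot J\<^esub> = J +>\<^bsub>poly_ring V\<^esub> 0" "\<one>\<^bsub>poly_ring V Quot J\<^esub> = J +>\<^bsub>poly_ring V\<^esub> 1"
proof -
  interpret ideal J "poly_ring V" by fact
  interpret C: cring "poly_ring V" by (rule cring_poly_ring)
  interpret abelian_subgroup J "poly_ring V"
    by (rule abelian_subgroupI3) (auto intro: additive_subgroup_axioms C.abelian_group_axioms)
  show "carrier (poly_ring V Quot J) = (\<lambda>f. J +>\<^bsub>poly_ring V\<^esub> f) ` polys V"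
    by (auto simp: FactRing_def A_RCOSETS_def')
  show "f \<in> polys V \<Longrightarrow> g \<in> polys V \<Longrightarrow> (J +>\<^bsub>poly_ring V\<^esub> f) \<oplus>\<^bsub>poly_ring V Quot J\<^esub> (J +>\<^bsub>poly_ring V\<^esub> g) = J +>\<^bsub>poly_ring V\<^esub> (f + g)"
    using a_rcos_sum[of f g] by (simp add: FactRing_def)
  show "f \<in> polys V \<Longrightarrow> g \<in> polys V \<Longrightarrow> (J +>\<^bsub>poly_ring V\<^esub> f) \<otimes>\<^bsub>poly_ring V Quot J\<^esub> (J +>\<^bsub>poly_ring V\<^esub> g) = J +>\<^bsub>poly_ring V\<^esub> (f * g)"
    using rcoset_mult_add[of f g] by (simp add: FactRing_def)
  have "J \<subseteq> polys V" using a_Hcarr by blast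
  then show "\<zero>\<^bsub>poly_ring V Quot J\<^esub> = J +>\<^bsub>poly_ring V\<^esub> 0"
    using C.a_coset_add_zero[of J] by (simp add: FactRing_def)
  show "\<one>\<^bsub>poly_ring V Quot J\<^esub> = J +>\<^bsub>poly_ring V\<^esub> 1" by (simp add: FactRing_def)
qed

lemma a_kernel_free:
  assumes "ring.zero N = z"
  shows "a_kernel (free_mod V as) N f = {x \<in> free V as. f x = z}"
  using assms by (simp add: a_kernel_def kernel_def)

text \<open>With the resolution broken into short exact sequences of syzygies, \<open>p\<close>
  shifts lead from degree \<open>p\<close> for \<open>A\<close> to degree 0 for the
  \<open>p\<close>-th syzygy module \<open>Z p\<close>, whose homology is
  \<open>Z p / m Z p\<close>. As \<open>F p\<close> covers \<open>Z p\<close> minimally, this is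
  \<open>F p / m F p\<close>.\<close>

theorem resolution_koszul:
  fixes \<psi> :: "nat \<Rightarrow> 'k::field mpoly"
  assumes l: "distinct l" "set l = V"
    and res: "minimal_graded_free_resolution V {f \<in> polys V. poly_subst \<psi> f = 0} F d \<epsilon>" and p: "p \<ge> 1"
  defines "A \<equiv> poly_subst \<psi> ` polys V"
  shows "quot_iso (fscale pscale) (kcyc (\<lambda>i f. \<psi> i * f) l (int p) A {0}) (kbnd (\<lambda>i f. \<psi> i * f) l (int p) A {0})
    vscale (free V (F p)) (vmon V (F p) V)"
proof -
  let ?R = "poly_ring V :: 'k mpoly ring"
  define J where "J = {f \<in> polys V. poly_subst \<psi> f = 0}"
  let ?act = "\<lambda>i f. \<psi> i * f"
  interpret V: ops vscale vact V by (rule ops_v)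
  note opsp = ops_p[of \<psi>]
  have J: "ideal J ?R" unfolding J_def by (rule kernel_ideal)
  note qs = quot_simps[OF J]
  from res have g: "graded_free_resolution V J F d \<epsilon>"
    and min: "\<And>k v j. v \<in> free V (F (Suc k)) \<Longrightarrow> j < length (F k) \<Longrightarrow> d k v j \<in> irrelevant_ideal V"
    unfolding minimal_graded_free_resolution_def J_def by auto
  note g' = g[unfolded graded_free_resolution_def]
  have eps: "\<epsilon> \<in> module_homs ?R (free_mod V (F 0)) (quot_mod V J)"
    using g' by (elim conjE)
  have "\<forall>k. d k \<in> module_homs ?R (free_mod V (F (Suc k))) (free_mod V (F k))"
    using g' by (elim conjE)
  note dk = this[rule_format]
  have surj: "\<epsilon> ` free V (F 0) = carrier (quot_mod V J)"
    using g' by (elim conjE)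
  have ex0: "d 0 ` free V (F (Suc 0)) = a_kernel (free_mod V (F 0)) (quot_mod V J) \<epsilon>"
    using g' by (elim conjE)
  have "\<forall>k. d (Suc k) ` free V (F (Suc (Suc k))) = a_kernel (free_mod V (F (Suc k))) (free_mod V (F k)) (d k)"
    using g' by (elim conjE)
  note exk = this[rule_format]
  have qcar: "carrier (quot_mod V J) = (\<lambda>f. J +>\<^bsub>?R\<^esub> f) ` polys V"
    and qadd: "add (quot_mod V J) = add (?R Quot J)" and qz: "ring.zero (quot_mod V J) = J +>\<^bsub>?R\<^esub> 0"
    and qsm: "\<And>r a. smult (quot_mod V J) r a = (J +>\<^bsub>?R\<^esub> r) \<otimes>\<^bsub>?R Quot J\<^esub> a"
    using qs by (simp_all add: quot_mod_def Let_def)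
  \<comment> \<open>The augmentation has values in cosets, while the shifts work in an abelian group
    type. It is transported to \<open>A\<close>: a coset goes to the image of a representative, and
    \<open>repu\<close> shows that any representative will do.\<close>
  define \<pi> where "\<pi> v = poly_subst \<psi> (SOME f. f \<in> polys V \<and> \<epsilon> v = J +>\<^bsub>?R\<^esub> f)" for v
  have rep: "\<exists>f\<in>polys V. \<epsilon> v = J +>\<^bsub>?R\<^esub> f \<and> \<pi> v = poly_subst \<psi> f" if "v \<in> free V (F 0)" for v
  proof -
    have "\<epsilon> v \<in> carrier (quot_mod V J)" using surj that by blast
    then have "\<exists>f. f \<in> polys V \<and> \<epsilon> v = J +>\<^bsub>?R\<^esub> f" using qcar by blast
    from someI_ex[OF this] show ?thesis unfolding \<pi>_def by blast
  qed
  have repu: "\<pi> v = poly_subst \<psi> f" if fv: "f \<in> polys V" "\<epsilon> v = J +>\<^bsub>?R\<^esub> f" "v \<in> free V (F 0)" for f v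
  proof -
    obtain g where g: "g \<in> polys V" "\<epsilon> v = J +>\<^bsub>?R\<^esub> g" "\<pi> v = poly_subst \<psi> g" using rep fv(3) by blast
    then have "f - g \<in> J" using coset_eq_iff[OF J fv(1) g(1)] fv(2) by simp
    then show ?thesis using g(3) by (simp add: J_def poly_subst_diff)
  qed
  have e_add: "\<epsilon> (x + y) = \<epsilon> x \<oplus>\<^bsub>?R Quot J\<^esub> \<epsilon> y" if "x \<in> free V (F 0)" "y \<in> free V (F 0)" for x y
    using eps that by (simp add: module_homs_def qadd)
  have e_sm: "\<epsilon> (\<lambda>j. r * x j) = (J +>\<^bsub>?R\<^esub> r) \<otimes>\<^bsub>?R Quot J\<^esub> \<epsilon> x" if "r \<in> polys V" "x \<in> free V (F 0)" for r x
    using eps that by (simp add: module_homs_def qsm)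
  have sm_free: "(\<lambda>j. r * x j) \<in> free V as" if "r \<in> polys V" "x \<in> free V as" for r x as
    using that by (auto simp: in_free)
  have \<pi>_sm: "\<pi> (\<lambda>j. r * x j) = poly_subst \<psi> r * \<pi> x" if rx: "r \<in> polys V" "x \<in> free V (F 0)" for r x
  proof -
    obtain f where f: "f \<in> polys V" "\<epsilon> x = J +>\<^bsub>?R\<^esub> f" "\<pi> x = poly_subst \<psi> f" using rep rx(2) by blast
    have "\<pi> (\<lambda>j. r * x j) = poly_subst \<psi> (r * f)"
      using f rx e_sm qs(3) sm_free by (intro repu) auto
    then show ?thesis using f(3) by (simp add: poly_subst_mult)
  qed
  have \<pi>hom: "act_hom vscale vact pscale ?act V (free V (F 0)) \<pi>"
    unfolding act_hom_def
  proof (intro conjI ballI allI)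
    fix x y :: "nat \<Rightarrow> 'k mpoly" assume xy: "x \<in> free V (F 0)" "y \<in> free V (F 0)"
    obtain f where f: "f \<in> polys V" "\<epsilon> x = J +>\<^bsub>?R\<^esub> f" "\<pi> x = poly_subst \<psi> f" using rep xy(1) by blast
    obtain g where g: "g \<in> polys V" "\<epsilon> y = J +>\<^bsub>?R\<^esub> g" "\<pi> y = poly_subst \<psi> g" using rep xy(2) by blast
    have "\<pi> (x + y) = poly_subst \<psi> (f + g)"
      using f g xy e_add qs(2) V.submodD(2)[OF free_submod] by (intro repu) auto
    then show "\<pi> (x + y) = \<pi> x + \<pi> y" using f(3) g(3) by (simp add: poly_subst_add)
  next
    fix c and x :: "nat \<Rightarrow> 'k mpoly" assume "x \<in> free V (F 0)"
    then show "\<pi> (vscale c x) = pscale c (\<pi> x)" unfolding vscale_def pscale_def by (simp add: \<pi>_sm)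
  next
    fix i and x :: "nat \<Rightarrow> 'k mpoly" assume "i \<in> V" "x \<in> free V (F 0)"
    then show "\<pi> (vact i x) = \<psi> i * \<pi> x" unfolding vact_def by (simp add: \<pi>_sm)
  qed
  have dhom: "act_hom vscale vact vscale vact V (free V (F (Suc k))) (d k)" for k
    using dk[of k] unfolding act_hom_def module_homs_def by (simp add: vscale_def vact_def)
  have dmem: "d k v \<in> free V (F k)" if "v \<in> free V (F (Suc k))" for k v
    using dk[of k] that unfolding module_homs_def by auto
  have \<pi>img: "\<pi> ` free V (F 0) = A"
  proof
    show "\<pi> ` free V (F 0) \<subseteq> A" using rep unfolding A_def by blast
    show "A \<subseteq> \<pi> ` free V (F 0)"
    proof
      fix a assume "a \<in> A"
      then obtain f where f: "f \<in> polys V" "a = poly_subst \<psi> f" unfolding A_def by blast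
      then have "J +>\<^bsub>?R\<^esub> f \<in> \<epsilon> ` free V (F 0)" using surj qcar by blast
      then obtain v where v: "v \<in> free V (F 0)" "\<epsilon> v = J +>\<^bsub>?R\<^esub> f" by auto
      have "a = \<pi> v" using repu[OF f(1) v(2,1)] f(2) by simp
      then show "a \<in> \<pi> ` free V (F 0)" using v(1) by (rule image_eqI)
    qed
  qed
  have \<pi>ker: "\<epsilon> x = J +>\<^bsub>?R\<^esub> 0 \<longleftrightarrow> \<pi> x = 0" if xf: "x \<in> free V (F 0)" for x
  proof -
    obtain f where f: "f \<in> polys V" "\<epsilon> x = J +>\<^bsub>?R\<^esub> f" "\<pi> x = poly_subst \<psi> f" using rep xf by blast
    then have "\<epsilon> x = J +>\<^bsub>?R\<^esub> 0 \<longleftrightarrow> f \<in> J" using coset_eq_iff[OF J f(1), of 0] by simp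
    then show ?thesis using f by (simp add: J_def)
  qed
  \<comment> \<open>For \<open>p >= 1\<close> this is the \<open>p\<close>-th syzygy module inside
    \<open>F (p - 1)\<close>: an image by definition, a kernel by exactness, and contained in the
    irrelevant multiple of \<open>F (p - 1)\<close> by minimality.\<close>
  define Z where "Z p = d (p - 1) ` free V (F p)" for p
  have Z1: "Z 1 = {x \<in> free V (F 0). \<pi> x = 0}"
    unfolding Z_def using ex0 \<pi>ker by (auto simp: a_kernel_free[OF qz])
  have Zk: "Z (Suc (Suc k)) = {x \<in> free V (F (Suc k)). d k x = 0}" for k
    unfolding Z_def using exk[of k] a_kernel_free[of "free_mod V (F k)" 0] by simp
  have Zm: "Z (Suc k) \<subseteq> vmon V (F k) V" for k
    unfolding Z_def vmon_irrelevant using min dmem by auto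
  let ?H = "\<lambda>q. kcyc ?act l q A {0}" and ?B = "\<lambda>q. kbnd ?act l q A {0}"
  have main: "quot_iso (fscale pscale) (?H (q + int (Suc k))) (?B (q + int (Suc k)))
     (fscale vscale) (kcyc vact l q (Z (Suc k)) {0}) (kbnd vact l q (Z (Suc k)) {0})" if "q \<ge> 0" for q k
    using that
  proof (induction k arbitrary: q)
    case 0
    have "q + int (Suc 0) = q + 1" by simp
    then show ?case
      using koszul_shift_free[OF l opsp \<pi>hom Z1[unfolded One_nat_def] Zm 0] by (simp only: \<pi>img)
  next
    \<comment> \<open>Each further syzygy costs one degree, so the induction hypothesis is used at
      \<open>q + 1\<close>.\<close>
    case (Suc k)
    have i: "d k ` free V (F (Suc k)) = Z (Suc k)" by (simp add: Z_def)
    have "quot_iso (fscale pscale) (?H (q + 1 + int (Suc k))) (?B (q + 1 + int (Suc k)))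
     (fscale vscale) (kcyc vact l (q + 1) (Z (Suc k)) {0}) (kbnd vact l (q + 1) (Z (Suc k)) {0})"
      using Suc.prems by (intro Suc.IH) simp
    moreover have "quot_iso (fscale vscale) (kcyc vact l (q + 1) (Z (Suc k)) {0}) (kbnd vact l (q + 1) (Z (Suc k)) {0})
      (fscale vscale) (kcyc vact l q (Z (Suc (Suc k))) {0}) (kbnd vact l q (Z (Suc (Suc k))) {0})"
      using koszul_shift_free[OF l ops_v dhom Zk Zm Suc.prems, of k] by (simp only: i)
    moreover have "q + int (Suc (Suc k)) = q + 1 + int (Suc k)" by simp
    ultimately show ?case using quot_iso_trans by (simp only:)
  qed
  obtain k where k: "p = Suc k" using p by (cases p) auto
  have i: "d k ` free V (F (Suc k)) = Z (Suc k)" by (simp add: Z_def)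
  have lV: "set l \<subseteq> V" using l by simp
  have Zs: "V.submod (Z (Suc k))" using act_hom_image[OF ops_v ops_v free_submod dhom] i by metis
  have "{x \<in> free V (F (Suc k)). d k x = 0} \<subseteq> vmon V (F (Suc k)) V" using Zk Zm by metis
  then have 1: "quot_iso vscale (free V (F p)) (vmon V (F p) V) vscale (Z p) (imul vact l (Z p))"
    using quot_iso_cover[OF l(2) ops_v dhom, of k] by (simp only: i k)
  have 2: "quot_iso vscale (Z p) (imul vact l (Z p)) (fscale vscale) (kcyc vact l 0 (Z p) {0}) (kbnd vact l 0 (Z p) {0})"
    using V.koszul_bot[OF Zs lV] by (simp only: k)
  have 3: "quot_iso (fscale pscale) (?H (int p)) (?B (int p)) (fscale vscale) (kcyc vact l 0 (Z p) {0}) (kbnd vact l 0 (Z p) {0})"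
    using main[of 0 k] by (simp only: k add_0 order_refl simp_thms)
  show ?thesis by (rule quot_iso_trans[OF 3 quot_iso_sym[OF quot_iso_trans[OF 1 2]]])
qed

section \<open>Existence of minimal resolutions\<close>

definition vcomp :: "int list \<Rightarrow> int \<Rightarrow> (nat \<Rightarrow> ('k::field) mpoly) \<Rightarrow> nat \<Rightarrow> 'k mpoly" where
  "vcomp as e v = (\<lambda>j. hcomp (e - as ! j) (v j))"

lemma Const_diff: "Const (a - b) = Const a - Const b"
  by (simp add: Const_def single_diff)

lemma vcomp_add: "vcomp as e (v + w) = vcomp as e v + vcomp as e w"
  by (auto simp: vcomp_def hcomp_add)

lemma vcomp_zero [simp]: "vcomp as e 0 = 0"
  by (auto simp: vcomp_def)

lemma vcomp_vact: "vcomp as e (vact i v) = vact i (vcomp as (e - 1) v)"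
proof
  fix j
  have e: "e - as ! j - 1 = e - 1 - as ! j" by simp
  show "vcomp as e (vact i v) j = vact i (vcomp as (e - 1) v) j"
    using hcomp_homog_times[OF Var_homog[of i UNIV], of "e - as ! j" "v j"] e by (simp only: vcomp_def vact_def) simp
qed

lemma sum_fun_apply: "sum f A j = (\<Sum>x\<in>A. f x j)" for f :: "'i \<Rightarrow> nat \<Rightarrow> 'b::comm_monoid_add"
  by (induction A rule: infinite_finite_induct) auto

lemma in_free_part: "v \<in> free_part V as e \<longleftrightarrow> v \<in> free V as \<and> (\<forall>j. v j \<in> homog_part V (e - as ! j))"
  unfolding free_part_def in_free by (auto, metis homog_part_0 not_less)

lemma vcomp_free: "v \<in> free V as \<Longrightarrow> vcomp as e v \<in> free_part V as e"
  unfolding in_free_part in_free by (auto simp: vcomp_def hcomp_polys hcomp_in)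

lemma vcomp_homog: "v \<in> free_part V as a \<Longrightarrow> vcomp as e v = (if e = a then v else 0)"
proof
  fix j
  assume "v \<in> free_part V as a"
  then have "v j \<in> homog_part V (a - as ! j)" by (simp add: in_free_part)
  from hcomp_homog[OF this, of "e - as ! j"] show "vcomp as e v j = (if e = a then v else 0) j"
    by (simp add: vcomp_def)
qed

lemma hcomp_decomp_superset:
  assumes "finite E" "\<And>t. t \<in> keys f \<Longrightarrow> int (monom_degree t) + b \<in> E"
  shows "f = (\<Sum>e\<in>E. hcomp (e - b) f)"
proof (rule poly_mapping_eqI)
  fix t
  have "(\<Sum>e\<in>E. lookup (hcomp (e - b) f) t) = (\<Sum>e\<in>E. if e = int (monom_degree t) + b then lookup f t else 0)"
    by (rule sum.cong) (auto simp: lookup_hcomp)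
  also have "\<dots> = lookup f t" using assms by (auto simp: sum.delta' in_keys_iff)
  finally show "lookup f t = lookup (\<Sum>e\<in>E. hcomp (e - b) f) t" by (simp add: lookup_sum)
qed

lemma vcomp_decomp:
  assumes "v \<in> free V as"
  obtains E where "finite E" "v = (\<Sum>e\<in>E. vcomp as e v)"
proof -
  define E where "E = (\<Union>j<length as. (\<lambda>t. int (monom_degree t) + as ! j) ` keys (v j))"
  have "v j = (\<Sum>e\<in>E. vcomp as e v) j" for j
  proof (cases "j < length as")
    case True
    have "v j = (\<Sum>e\<in>E. hcomp (e - as ! j) (v j))"
      by (rule hcomp_decomp_superset) (use True in \<open>auto simp: E_def\<close>)
    then show ?thesis by (simp add: sum_fun_apply vcomp_def)
  next
    case False
    then show ?thesis using assms by (simp add: in_free sum_fun_apply vcomp_def)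
  qed
  then have "v = (\<Sum>e\<in>E. vcomp as e v)" by blast
  moreover have "finite E" by (simp add: E_def)
  ultimately show ?thesis using that by blast
qed

definition graded_submod :: "nat set \<Rightarrow> int list \<Rightarrow> (nat \<Rightarrow> ('k::field) mpoly) set \<Rightarrow> bool" where
  "graded_submod V as Z \<longleftrightarrow> ops.submod vscale vact V Z \<and> Z \<subseteq> free V as \<and> (\<forall>e. \<forall>v\<in>Z. vcomp as e v \<in> Z)"

text \<open>The \<open>R\<close>-linear map with columns \<open>g 0\<close>, ...,
  \<open>g (n - 1)\<close>.\<close>

definition comb :: "nat \<Rightarrow> (nat \<Rightarrow> nat \<Rightarrow> ('k::field) mpoly) \<Rightarrow> (nat \<Rightarrow> 'k mpoly) \<Rightarrow> nat \<Rightarrow> 'k mpoly" where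
  "comb n g v = (\<lambda>i. \<Sum>j<n. v j * g j i)"

lemma comb_add: "comb n g (v + w) = comb n g v + comb n g w"
  by (auto simp: comb_def distrib_right sum.distrib)

lemma comb_smult: "comb n g (\<lambda>j. r * v j) = (\<lambda>i. r * comb n g v i)"
  by (auto simp: comb_def sum_distrib_left mult.assoc)

lemma comb_hom: "act_hom vscale vact vscale vact V F (comb n g)"
  unfolding act_hom_def by (simp add: comb_add vscale_def vact_def comb_smult)

lemma comb_mem:
  assumes "\<And>j. j < n \<Longrightarrow> g j \<in> free V as" "\<And>j. v j \<in> polys V"
  shows "comb n g v \<in> free V as"
  unfolding in_free comb_def using assms by (auto simp: in_free intro!: polys_sum sum.neutral)

lemma comb_vcomp:
  assumes "\<And>j. j < length bs \<Longrightarrow> g j \<in> free_part V as (bs ! j)"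
  shows "comb (length bs) g (vcomp bs e v) = vcomp as e (comb (length bs) g v)"
proof
  fix i
  have "hcomp (e - as ! i) (v j * g j i) = hcomp (e - bs ! j) (v j) * g j i" if "j < length bs" for j
    using hcomp_times_homog[of "g j i" V "bs ! j - as ! i" "e - as ! i" "v j"] assms[OF that]
    by (simp add: in_free_part)
  then show "comb (length bs) g (vcomp bs e v) i = vcomp as e (comb (length bs) g v) i"
    by (simp add: comb_def vcomp_def hcomp_sum)
qed

lemma comb_free_part:
  assumes "\<And>j. j < length bs \<Longrightarrow> g j \<in> free_part V as (bs ! j)" "v \<in> free_part V bs e"
  shows "comb (length bs) g v \<in> free_part V as e"
proof -
  have "comb (length bs) g v \<in> free V as"
    by (rule comb_mem) (use assms in \<open>auto simp: in_free_part in_free\<close>)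
  then have "vcomp as e (comb (length bs) g v) \<in> free_part V as e" by (rule vcomp_free)
  then show ?thesis using comb_vcomp[where bs=bs and e=e and v=v, OF assms(1)] vcomp_homog[OF assms(2), of e] by simp
qed

text \<open>A variable raises the degree by one, so the degree \<open>e\<close> part of
  \<open>m Z\<close> sees only the degree \<open>e - 1\<close> part of \<open>Z\<close>. With a
  smaller module as \<open>Z'\<close> this is the inductive step of
  \<open>graded_nakayama\<close>.\<close>

lemma imul_vcomp:
  assumes "set l \<subseteq> V" "w \<in> imul vact l Z" "\<And>v. v \<in> Z \<Longrightarrow> vcomp as (e - 1) v \<in> Z'"
  shows "vcomp as e w \<in> imul vact l Z'"
  using assms(1,2)
proof (induction l arbitrary: w)
  case (Cons a l)
  then obtain y x where w: "w = y + vact a x" "y \<in> imul vact l Z" "x \<in> Z" by auto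
  have "vcomp as e w = vcomp as e y + vact a (vcomp as (e - 1) x)"
    using w(1) Cons.prems(1) by (simp add: vcomp_add vcomp_vact)
  moreover have "vcomp as e y \<in> imul vact l Z'" using Cons w by auto
  moreover have "vcomp as (e - 1) x \<in> Z'" using assms(3) w(3) .
  ultimately show ?case unfolding imul.simps by blast
qed simp

text \<open>Finitely many generators of \<open>Z\<close> modulo \<open>m Z\<close> are replaced by
  their homogeneous components, of which there are again finitely many. A spanning subfamily of
  least size is then linearly independent modulo \<open>m Z\<close>.\<close>

lemma homogeneous_basis:
  fixes Z :: "(nat \<Rightarrow> 'k::field mpoly) set"
  assumes lV: "set l \<subseteq> V" and Z: "graded_submod V as Z"
    and fin: "quot_fin vscale Z (imul vact l Z)"
  obtains bs g where "\<And>j. j < length bs \<Longrightarrow> g j \<in> Z \<inter> free_part V as (bs ! j)"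
    "\<And>z. z \<in> Z \<Longrightarrow> \<exists>c. z + (\<Sum>j<length bs. vscale (c j) (g j)) \<in> imul vact l Z"
    "\<And>c j. (\<Sum>j<length bs. vscale (c j) (g j)) \<in> imul vact l Z \<Longrightarrow> j < length bs \<Longrightarrow> c j = 0"
proof -
  interpret ops vscale vact V by (rule ops_v)
  have Zs: "submod Z" and ZF: "Z \<subseteq> free V as" and Zg: "\<And>e v. v \<in> Z \<Longrightarrow> vcomp as e v \<in> Z"
    using Z unfolding graded_submod_def by blast+
  let ?I = "imul vact l Z"
  have Is: "submod ?I" by (rule imul_submod[OF Zs lV])
  from fin obtain k :: nat and g0 where g0: "\<And>i. i < k \<Longrightarrow> g0 i \<in> Z"
    "\<And>z. z \<in> Z \<Longrightarrow> \<exists>c. z + (\<Sum>i<k. vscale (c i) (g0 i)) \<in> ?I" unfolding quot_fin_def by blast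
  have "\<forall>i. \<exists>E. i < k \<longrightarrow> finite E \<and> g0 i = (\<Sum>e\<in>E. vcomp as e (g0 i))"
  proof
    fix i show "\<exists>E. i < k \<longrightarrow> finite E \<and> g0 i = (\<Sum>e\<in>E. vcomp as e (g0 i))"
    proof (cases "i < k")
      case True
      obtain E where "finite E" "g0 i = (\<Sum>e\<in>E. vcomp as e (g0 i))"
        by (rule vcomp_decomp[OF subsetD[OF ZF g0(1)[OF True]]])
      then show ?thesis by (intro exI[of _ E] impI conjI)
    qed simp
  qed
  from choice[OF this] obtain E where EE: "\<forall>i. i < k \<longrightarrow> finite (E i) \<and> g0 i = (\<Sum>e\<in>E i. vcomp as e (g0 i))"
    by (elim exE)
  have E: "finite (E i)" "g0 i = (\<Sum>e\<in>E i. vcomp as e (g0 i))" if "i < k" for i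
    by (rule conjunct1[OF EE[rule_format, OF that]], rule conjunct2[OF EE[rule_format, OF that]])
  define S where "S = (SIGMA i:{..<k}. E i)"
  define h where "h p = vcomp as (snd p) (g0 (fst p))" for p
  define spans where "spans I \<longleftrightarrow> (\<forall>z\<in>Z. \<exists>c. z + (\<Sum>p\<in>I. vscale (c p) (h p)) \<in> ?I)" for I
  have "finite S" unfolding S_def using E(1) by blast
  have "spans S" unfolding spans_def
  proof
    fix z assume "z \<in> Z"
    then obtain c where c: "z + (\<Sum>i<k. vscale (c i) (g0 i)) \<in> ?I" using g0(2) by blast
    have "(\<Sum>i<k. vscale (c i) (g0 i)) = (\<Sum>i<k. \<Sum>e\<in>E i. vscale (c i) (h (i, e)))"
    proof (rule sum.cong)
      fix i assume "i \<in> {..<k}"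
      then have "vscale (c i) (g0 i) = vscale (c i) (\<Sum>e\<in>E i. h (i, e))" using E(2) by (simp add: h_def)
      also have "\<dots> = (\<Sum>e\<in>E i. vscale (c i) (h (i, e)))"
        by (auto simp: vscale_def sum_fun_apply sum_distrib_left)
      finally show "vscale (c i) (g0 i) = (\<Sum>e\<in>E i. vscale (c i) (h (i, e)))" .
    qed simp
    also have "\<dots> = (\<Sum>p\<in>S. vscale (c (fst p)) (h p))"
      unfolding S_def using E(1) by (subst sum.Sigma) (auto intro!: sum.cong)
    finally show "\<exists>c. z + (\<Sum>p\<in>S. vscale (c p) (h p)) \<in> ?I" using c by (intro exI[of _ "\<lambda>p. c (fst p)"]) simp
  qed
  have "\<exists>n I. I \<subseteq> S \<and> spans I \<and> card I = n" using \<open>spans S\<close> by blast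
  then obtain n where n: "\<exists>I. I \<subseteq> S \<and> spans I \<and> card I = n" "\<And>m. m < n \<Longrightarrow> \<not> (\<exists>I. I \<subseteq> S \<and> spans I \<and> card I = m)"
    using exists_least_iff[of "\<lambda>n. \<exists>I. I \<subseteq> S \<and> spans I \<and> card I = n"] by blast
  then obtain I where I: "I \<subseteq> S" "spans I" "card I = n" by blast
  have finI: "finite I" using I(1) \<open>finite S\<close> finite_subset by blast
  have hZ: "h p \<in> Z \<inter> free_part V as (snd p)" if "p \<in> S" for p
  proof -
    have "g0 (fst p) \<in> Z" using that g0(1) by (auto simp: S_def)
    then show ?thesis unfolding h_def using Zg vcomp_free ZF by blast
  qed
  have indep: "c p0 = 0" if rel: "(\<Sum>p\<in>I. vscale (c p) (h p)) \<in> ?I" and p0: "p0 \<in> I" for c p0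
  proof (rule ccontr)
    assume nz: "c p0 \<noteq> 0"
    have "spans (I - {p0})" unfolding spans_def
    proof
      fix z assume "z \<in> Z"
      then obtain b where b: "z + (\<Sum>p\<in>I. vscale (b p) (h p)) \<in> ?I" using I(2) unfolding spans_def by blast
      \<comment> \<open>Subtracting \<open>t\<close> times the relation removes \<open>p0\<close>
        from the spanning family, against the minimality of \<open>I\<close>.\<close>
      define t where "t = b p0 / c p0"
      have "z + (\<Sum>p\<in>I. vscale (b p) (h p)) - vscale t (\<Sum>p\<in>I. vscale (c p) (h p)) \<in> ?I"
        by (rule submodD(6)[OF Is b submodD(4)[OF Is rel]])
      moreover have "(\<Sum>p\<in>I. vscale (b p) (h p)) - vscale t (\<Sum>p\<in>I. vscale (c p) (h p)) =
          (\<Sum>p\<in>I. vscale (b p - t * c p) (h p))"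
        by (rule ext) (simp add: sum_fun_apply vscale_def Const_mult Const_diff left_diff_distrib sum_subtractf
            sum_distrib_left mult.assoc)
      moreover have "\<dots> = (\<Sum>p\<in>I - {p0}. vscale (b p - t * c p) (h p))"
      proof -
        have "vscale (b p0 - t * c p0) (h p0) = 0" using nz by (simp add: t_def vscale_def zero_fun_def)
        then show ?thesis using sum.remove[OF finI p0, of "\<lambda>p. vscale (b p - t * c p) (h p)"] by simp
      qed
      ultimately have "z + (\<Sum>p\<in>I - {p0}. vscale (b p - t * c p) (h p)) \<in> ?I" by (simp only: add_diff_eq[symmetric])
      then show "\<exists>c. z + (\<Sum>p\<in>I - {p0}. vscale (c p) (h p)) \<in> ?I" by (rule exI[of _ "\<lambda>p. b p - t * c p"])
    qed
    moreover have "card (I - {p0}) < n" using I(3) finI p0 by (metis card_Diff1_less)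
    moreover have "I - {p0} \<subseteq> S" using I(1) by blast
    ultimately have "\<exists>I'. I' \<subseteq> S \<and> spans I' \<and> card I' = card (I - {p0})"
      by (intro exI[of _ "I - {p0}"]) simp
    moreover have "card (I - {p0}) < n" by fact
    ultimately show False using n(2) by blast
  qed
  obtain \<beta> where \<beta>: "bij_betw \<beta> {..<n} I"
    using ex_bij_betw_nat_finite[OF finI] I(3) by (auto simp: atLeast0LessThan)
  have reindex: "(\<Sum>j<n. f (\<beta> j)) = (\<Sum>p\<in>I. f p)" for f :: "nat \<times> int \<Rightarrow> nat \<Rightarrow> 'k mpoly"
    using sum.reindex_bij_betw[OF \<beta>] .
  let ?bs = "map (\<lambda>j. snd (\<beta> j)) [0..<n]" and ?g = "\<lambda>j. h (\<beta> j)"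
  show ?thesis
  proof (rule that[of ?bs ?g])
    fix j assume "j < length ?bs"
    then show "?g j \<in> Z \<inter> free_part V as (?bs ! j)" using hZ[of "\<beta> j"] I(1) bij_betwE[OF \<beta>] by auto
  next
    fix z assume "z \<in> Z"
    then obtain c where "z + (\<Sum>p\<in>I. vscale (c p) (h p)) \<in> ?I" using I(2) unfolding spans_def by blast
    then show "\<exists>c. z + (\<Sum>j<length ?bs. vscale (c j) (?g j)) \<in> ?I"
      using reindex[of "\<lambda>p. vscale (c p) (h p)"] by (intro exI[of _ "\<lambda>j. c (\<beta> j)"]) simp
  next
    fix c j assume a: "(\<Sum>j<length ?bs. vscale (c j) (?g j)) \<in> ?I" and j: "j < length ?bs"
    let ?inv = "the_inv_into {..<n} \<beta>"
    have inv: "?inv (\<beta> j) = j" if "j < n" for j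
      using that \<beta> by (intro the_inv_into_f_f) (auto simp: bij_betw_def)
    have "(\<Sum>j<n. vscale (c j) (?g j)) = (\<Sum>p\<in>I. vscale (c (?inv p)) (h p))"
      unfolding reindex[of "\<lambda>p. vscale (c (?inv p)) (h p)", symmetric] by (rule sum.cong) (auto simp: inv)
    then have "c (?inv (\<beta> j)) = 0" using a j bij_betwE[OF \<beta>] by (intro indep) auto
    then show "c j = 0" using inv j by simp
  qed
qed

lemma free_part_below:
  assumes "v \<in> free_part V as e" "\<And>a. a \<in> set as \<Longrightarrow> e < a"
  shows "v = 0"
proof
  fix j
  show "v j = 0 j"
  proof (cases "j < length as")
    case True
    then have "e - as ! j < 0" using assms(2)[of "as ! j"] by simp
    then show ?thesis using assms(1) homog_neg[of "v j" V "e - as ! j"] by (simp add: in_free_part)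
  next
    case False
    then show ?thesis using assms(1) by (simp add: in_free_part in_free)
  qed
qed

lemma submod_sum:
  assumes "ops.submod vscale vact V M" "\<And>x. x \<in> A \<Longrightarrow> f x \<in> M"
  shows "sum f A \<in> M"
proof -
  interpret ops vscale vact V by (rule ops_v)
  note M = submodD[OF assms(1)]
  show ?thesis using assms(2) by (induction A rule: infinite_finite_induct) (simp_all add: M(1,2))
qed

text \<open>Degrees in a free module of finite rank are bounded below, which allows induction on the
  degree. The degree \<open>e\<close> part of \<open>z + y\<close> is a combination of variables
  times elements of \<open>Z\<close> of degree \<open>e - 1\<close>; these are in \<open>Y\<close>
  by induction, hence so is the degree \<open>e\<close> part of \<open>z\<close>.\<close>

theorem graded_nakayama:
  assumes lV: "set l \<subseteq> V" and Z: "graded_submod V as Z" and Y: "ops.submod vscale vact V Y" "Y \<subseteq> Z"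
    and Yg: "\<And>e v. v \<in> Y \<Longrightarrow> vcomp as e v \<in> Y"
    and span: "\<And>z. z \<in> Z \<Longrightarrow> \<exists>y\<in>Y. z + y \<in> imul vact l Z"
  shows "Z \<subseteq> Y"
proof -
  interpret ops vscale vact V by (rule ops_v)
  have Zs: "submod Z" and ZF: "Z \<subseteq> free V as" and Zg: "\<And>e v. v \<in> Z \<Longrightarrow> vcomp as e v \<in> Z"
    using Z unfolding graded_submod_def by blast+
  obtain e0 where e0: "\<And>a. a \<in> set as \<Longrightarrow> e0 \<le> a"
  proof (cases "as = []")
    case False
    then show ?thesis using that[of "Min (set as)"] by simp
  qed (use that in simp)
  \<comment> \<open>\<open>k\<close> measures the distance of the degree \<open>e\<close> from the
    lower bound \<open>e0\<close> of the generator degrees; for \<open>k = 0\<close> the element is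
    zero.\<close>
  have hom: "z \<in> Y" if "z \<in> Z" "z \<in> free_part V as e" "e < e0 + int k" for z e k
    using that
  proof (induction k arbitrary: z e)
    case 0
    then have "z = 0" using e0 by (intro free_part_below[of z V as e]) force+
    then show ?case using submodD(1)[OF Y(1)] by (simp only:)
  next
    case (Suc k)
    obtain y where y: "y \<in> Y" "z + y \<in> imul vact l Z" using span Suc.prems(1) by blast
    have "vcomp as (e - 1) v \<in> Y" if "v \<in> Z" for v
      using Zg[OF that] vcomp_free[OF subsetD[OF ZF that]] Suc.prems(3) by (intro Suc.IH[of _ "e - 1"]) auto
    then have "vcomp as e (z + y) \<in> imul vact l Y" by (intro imul_vcomp[OF lV y(2)])
    moreover have "act_hom vscale vact vscale vact V Y (\<lambda>x. x)" by (simp add: act_hom_def)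
    then have "imul vact l Y \<subseteq> Y" by (rule imul_act_hom(1)[OF ops_v ops_v Y(1) _ lV])
    ultimately have "vcomp as e z + vcomp as e y \<in> Y" unfolding vcomp_add by blast
    then have "vcomp as e z + vcomp as e y - vcomp as e y \<in> Y" using Yg[OF y(1)] by (rule submodD(6)[OF Y(1)])
    then show ?case using vcomp_homog[OF Suc.prems(2), of e] by simp
  qed
  show ?thesis
  proof
    fix z assume z: "z \<in> Z"
    obtain E where E: "finite E" "z = (\<Sum>e\<in>E. vcomp as e z)" by (rule vcomp_decomp[OF subsetD[OF ZF z]])
    have "vcomp as e z \<in> Y" for e
      by (rule hom[of _ e "nat (e - e0 + 1)"]) (use Zg[OF z] vcomp_free[OF subsetD[OF ZF z]] in auto)
    then have "(\<Sum>e\<in>E. vcomp as e z) \<in> Y" by (intro submod_sum[OF Y(1)])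
    then show "z \<in> Y" using E(2) by simp
  qed
qed

text \<open>A homogeneous basis of \<open>Z / m Z\<close> generates \<open>Z\<close> by
  \<open>graded_nakayama\<close>, and its independence forces relations to have no constant terms.
  The kernel is again graded, so that the construction can be repeated.\<close>

lemma minimal_cover:
  fixes Z :: "(nat \<Rightarrow> 'k::field mpoly) set"
  assumes l: "set l = V" and Z: "graded_submod V as Z"
    and fin: "quot_fin vscale Z (imul vact l Z)"
  obtains bs g where "\<And>j. j < length bs \<Longrightarrow> g j \<in> free_part V as (bs ! j)"
    "comb (length bs) g ` free V bs = Z"
    "{v \<in> free V bs. comb (length bs) g v = 0} \<subseteq> vmon V bs V"
    "graded_submod V bs {v \<in> free V bs. comb (length bs) g v = 0}"
proof -
  interpret ops vscale vact V by (rule ops_v)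
  have lV: "set l \<subseteq> V" using l by simp
  have Zs: "submod Z" and ZF: "Z \<subseteq> free V as" and Zg: "\<And>e v. v \<in> Z \<Longrightarrow> vcomp as e v \<in> Z"
    using Z unfolding graded_submod_def by blast+
  obtain bs g where g: "\<And>j. j < length bs \<Longrightarrow> g j \<in> Z \<inter> free_part V as (bs ! j)"
    and span: "\<And>z. z \<in> Z \<Longrightarrow> \<exists>c. z + (\<Sum>j<length bs. vscale (c j) (g j)) \<in> imul vact l Z"
    and indep: "\<And>c j. (\<Sum>j<length bs. vscale (c j) (g j)) \<in> imul vact l Z \<Longrightarrow> j < length bs \<Longrightarrow> c j = 0"
    using homogeneous_basis[OF lV Z fin] by blast
  let ?n = "length bs"
  let ?D = "comb ?n g"
  have gp: "g j \<in> free_part V as (bs ! j)" if "j < ?n" for j using g[OF that] by blast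
  note Dh = comb_hom[of V "free V bs" ?n g]
  have r_z: "(\<lambda>i. r * z i) \<in> Z" if "r \<in> polys V" "z \<in> Z" for r z
  proof -
    \<comment> \<open>\<open>submod\<close> provides closure under scalars and single variables;
      closure under all monomials follows by induction on their degree.\<close>
    have mon: "(\<lambda>i. single t c * w i) \<in> Z" if "keys t \<subseteq> V" "w \<in> Z" for t c w
      using that
    proof (induction "monom_degree t" arbitrary: t w)
      case 0
      then have "t = 0" by (metis lookup_zero monom_degree_def finite_keys sum_eq_0_iff in_keys_iff poly_mapping_eqI)
      then show ?case using submodD(4)[OF Zs 0(3), of c] by (simp add: vscale_def Const_def)
    next
      case (Suc k)
      then have "t \<noteq> 0" by auto
      then obtain i where i: "i \<in> keys t" by fastforce
      obtain u where u: "t = single i 1 + u" "single t c = Var i * single u c" by (rule single_decomp[OF i])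
      have "k = monom_degree u" using Suc(2) u(1) by (simp add: monom_degree_add)
      moreover have "keys u \<subseteq> V" using Suc.prems(1) u(1) by (simp add: keys_plus_nat)
      ultimately have "(\<lambda>i. single u c * w i) \<in> Z" using Suc.hyps(1) Suc.prems(2) by blast
      then have "vact i (\<lambda>i. single u c * w i) \<in> Z" using i Suc.prems(1) by (intro submodD(5)[OF Zs]) auto
      then show ?case unfolding vact_def u(2) by (simp add: mult.assoc)
    qed
    have "(\<lambda>i. r * z i) = (\<Sum>t\<in>keys r. (\<lambda>i. single t (lookup r t) * z i))"
      by (rule ext) (simp add: sum_fun_apply flip: sum_distrib_right mpoly_expand)
    also have "\<dots> \<in> Z" using that by (intro submod_sum[OF Zs] mon) (auto simp: in_polys)
    finally show ?thesis .
  qed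
  have DZ: "?D v \<in> Z" if "v \<in> free V bs" for v
  proof -
    have "?D v = (\<Sum>j<?n. (\<lambda>i. v j * g j i))" by (rule ext) (simp add: comb_def sum_fun_apply)
    also have "\<dots> \<in> Z" using that g by (intro submod_sum[OF Zs] r_z) (auto simp: in_free)
    finally show ?thesis .
  qed
  have cc: "?D (\<lambda>j. if j < ?n then Const (c j) else 0) = (\<Sum>j<?n. vscale (c j) (g j))" for c
    by (rule ext) (simp add: comb_def sum_fun_apply vscale_def)
  have cf: "(\<lambda>j. if j < ?n then Const (c j) else 0) \<in> free V bs" for c
    by (simp add: in_free)
  let ?Y = "?D ` free V bs"
  have "Z \<subseteq> ?Y"
  proof (rule graded_nakayama[OF lV Z])
    show "submod ?Y" by (rule act_hom_image[OF ops_v ops_v free_submod Dh])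
    show "?Y \<subseteq> Z" using DZ by blast
  next
    fix e v assume "v \<in> ?Y"
    then obtain w where w: "w \<in> free V bs" "v = ?D w" by blast
    have "vcomp as e v = ?D (vcomp bs e w)" using comb_vcomp[of bs g V as e w, OF gp] w(2) by simp
    moreover have "vcomp bs e w \<in> free V bs" using vcomp_free[OF w(1)] by (simp add: in_free_part)
    ultimately show "vcomp as e v \<in> ?Y" by blast
  next
    fix z assume "z \<in> Z"
    then obtain c where "z + (\<Sum>j<?n. vscale (c j) (g j)) \<in> imul vact l Z" using span by blast
    then show "\<exists>y\<in>?Y. z + y \<in> imul vact l Z" using cc[of c] imageI[OF cf[of c], of ?D] by (intro bexI[of _ "?D (\<lambda>j. if j < ?n then Const (c j) else 0)"]) simp_all
  qed
  then have img: "?Y = Z" using DZ by blast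
  have ker: "v \<in> vmon V bs V" if v: "v \<in> free V bs" "?D v = 0" for v
  proof -
    define c where "c j = lookup (v j) 0" for j
    let ?c = "\<lambda>j. if j < ?n then Const (c j) else 0"
    \<comment> \<open>Splitting off the constant terms \<open>?c\<close> of a relation
      \<open>v\<close> leaves an element of \<open>m F\<close>. So the image of \<open>?c\<close>
      lies in \<open>m Z\<close>, and independence makes \<open>?c\<close> vanish.\<close>
    have d: "v - ?c \<in> vmon V bs V"
    proof -
      have "v - ?c \<in> free V bs" by (rule submodD(6)[OF free_submod v(1) cf])
      moreover have "lookup ((v - ?c) j) 0 = 0" for j
        using v(1) by (simp add: lookup_minus lookup_Const c_def in_free)
      ultimately show ?thesis unfolding vmon_const by blast
    qed
    have "?D (v - ?c) \<in> ?D ` imul vact l (free V bs)" using d by (simp add: imul_free[OF lV] l)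
    also have "\<dots> = imul vact l Z" using imul_act_hom(2)[OF ops_v ops_v free_submod Dh lV] img by simp
    finally have "- ?D (v - ?c) \<in> imul vact l Z" using submodD(3)[OF imul_submod[OF Zs lV]] by blast
    moreover have "?D v = ?D (v - ?c) + ?D ?c" by (simp only: comb_add[symmetric] diff_add_cancel)
    then have "?D ?c = - ?D (v - ?c)" using v(2) by (simp add: eq_neg_iff_add_eq_0 add.commute)
    ultimately have "(\<Sum>j<?n. vscale (c j) (g j)) \<in> imul vact l Z" using cc[of c] by simp
    then have "c j = 0" if "j < ?n" for j using indep that by blast
    then have "lookup (v j) 0 = 0" for j using v(1) unfolding c_def in_free by (metis lookup_zero not_less)
    then show ?thesis unfolding vmon_const using v(1) by blast
  qed
  have kg: "graded_submod V bs {v \<in> free V bs. ?D v = 0}"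
    unfolding graded_submod_def
  proof (intro conjI allI ballI)
    show "submod {v \<in> free V bs. ?D v = 0}" by (rule act_hom_kernel[OF ops_v ops_v free_submod Dh])
    fix e v assume v: "v \<in> {v \<in> free V bs. ?D v = 0}"
    have "?D (vcomp bs e v) = 0" using comb_vcomp[of bs g V as e v, OF gp] v by simp
    moreover have "vcomp bs e v \<in> free V bs" using vcomp_free[of v V bs e] v by (simp add: in_free_part)
    ultimately show "vcomp bs e v \<in> {v \<in> free V bs. ?D v = 0}" by simp
  qed blast
  show ?thesis using that[of bs g, OF gp img _ kg] ker by blast
qed

lemma hcomp_zero: "hcomp 0 f = Const (lookup f 0)"
proof (rule poly_mapping_eqI)
  fix t
  have "monom_degree t = 0 \<longleftrightarrow> t = 0"
    by (metis monom_degree_0 lookup_zero monom_degree_def finite_keys sum_eq_0_iff in_keys_iff poly_mapping_eqI)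
  then show "lookup (hcomp 0 f) t = lookup (Const (lookup f 0)) t" by (simp add: lookup_hcomp lookup_Const)
qed

text \<open>The shifts transport finiteness: from finite homology of \<open>A\<close> in all degrees
  \<open>q >= 1\<close>, every syzygy module inherits finite homology in all degrees
  \<open>q >= 0\<close>. In degree 0 this is what \<open>minimal_cover\<close> asks for.\<close>

theorem minimal_resolution_exists:
  fixes \<psi> :: "nat \<Rightarrow> 'k::field mpoly" and V :: "nat set"
  defines "A \<equiv> poly_subst \<psi> ` polys V" and "J \<equiv> {f \<in> polys V. poly_subst \<psi> f = 0}"
  assumes l: "distinct l" "set l = V"
    and Jg: "\<And>e f. f \<in> J \<Longrightarrow> hcomp e f \<in> J"
    and fin: "\<And>q. q \<ge> 1 \<Longrightarrow> quot_fin (fscale pscale) (kcyc (\<lambda>i f. \<psi> i * f) l q A {0}) (kbnd (\<lambda>i f. \<psi> i * f) l q A {0})"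
  shows "\<exists>F d \<epsilon>. minimal_graded_free_resolution V J F d \<epsilon>"
proof -
  interpret ops vscale vact V by (rule ops_v)
  let ?R = "poly_ring V :: 'k mpoly ring"
  have J: "ideal J ?R" unfolding J_def by (rule kernel_ideal)
  note qs = quot_simps[OF J]
  have lV: "set l \<subseteq> V" using l by simp
  define \<pi> where "\<pi> v = poly_subst \<psi> (v 0)" for v :: "nat \<Rightarrow> 'k mpoly"
  define Z1 where "Z1 = {v \<in> free V [0]. \<pi> v = 0}"
  have \<pi>h: "act_hom vscale vact pscale (\<lambda>i f. \<psi> i * f) V (free V [0]) \<pi>"
    unfolding act_hom_def by (simp add: \<pi>_def poly_subst_add poly_subst_mult vscale_def vact_def pscale_def)
  have emb: "(\<lambda>j. if j = 0 then f else 0) \<in> free V [0]" if "f \<in> polys V" for f :: "'k mpoly"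
    using that by (simp add: in_free)
  have \<pi>img: "\<pi> ` free V [0] = A"
  proof
    show "\<pi> ` free V [0] \<subseteq> A" by (auto simp: \<pi>_def A_def in_free)
    show "A \<subseteq> \<pi> ` free V [0]"
    proof
      fix a assume "a \<in> A"
      then obtain f where f: "f \<in> polys V" "a = poly_subst \<psi> f" unfolding A_def by blast
      then have "a = \<pi> (\<lambda>j. if j = 0 then f else 0)" by (simp add: \<pi>_def)
      then show "a \<in> \<pi> ` free V [0]" using emb[OF f(1)] by (rule image_eqI)
    qed
  qed
  have Z1_iff: "v \<in> Z1 \<longleftrightarrow> v \<in> free V [0] \<and> v 0 \<in> J" for v
    by (auto simp: Z1_def \<pi>_def J_def in_free)
  \<comment> \<open>The degree 0 part of an element of \<open>J\<close> is a constant in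
    \<open>J\<close>. The substitution fixes constants, so it is 0.\<close>
  have Jc: "lookup f 0 = 0" if "f \<in> J" for f
    using Jg[OF that, of 0] by (simp add: hcomp_zero J_def)
  have Z1m: "Z1 \<subseteq> vmon V [0] V"
  proof
    fix v assume v: "v \<in> Z1"
    have "lookup (v j) 0 = 0" for j
      using v Jc[of "v 0"] by (cases j) (auto simp: Z1_iff in_free)
    then show "v \<in> vmon V [0] V" using v unfolding vmon_const Z1_iff by blast
  qed
  have Z1g: "graded_submod V [0] Z1"
    unfolding graded_submod_def
  proof (intro conjI allI ballI)
    show "submod Z1" unfolding Z1_def by (rule act_hom_kernel[OF ops_v ops_p free_submod \<pi>h])
    show "Z1 \<subseteq> free V [0]" unfolding Z1_def by blast
    fix e v assume v: "v \<in> Z1"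
    then have "vcomp [0] e v \<in> free V [0]" using vcomp_free[of v V "[0]" e] by (simp add: in_free_part Z1_iff)
    then show "vcomp [0] e v \<in> Z1" using v Jg by (simp add: Z1_iff vcomp_def)
  qed
  \<comment> \<open>All degrees have to be carried along, since a shift yields degree
    \<open>q\<close> for the next module from degree \<open>q + 1\<close> for the present
    one.\<close>
  define INV where "INV as Z \<longleftrightarrow> graded_submod V as Z \<and> Z \<subseteq> vmon V as V \<and>
    (\<forall>q\<ge>0. quot_fin (fscale vscale) (kcyc vact l q Z {0}) (kbnd vact l q Z {0}))" for as and Z :: "(nat \<Rightarrow> 'k mpoly) set"
  have INV1: "INV [0] Z1" unfolding INV_def
  proof (intro conjI allI impI Z1g Z1m)
    fix q :: int assume q: "q \<ge> 0"
    show "quot_fin (fscale vscale) (kcyc vact l q Z1 {0}) (kbnd vact l q Z1 {0})"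
      by (rule quot_iso_fin[OF koszul_shift_free[OF l ops_p \<pi>h Z1_def Z1m q]])
        (unfold \<pi>img, rule fin, use q in simp)
  qed
  \<comment> \<open>A state consists of the degrees of a free module, the kernel inside it and the
    columns of the map out of it; \<open>Q\<close> says that the next free module covers this
    kernel. At stage 0 the columns are left \<open>undefined\<close>, because the map out is the
    augmentation.\<close>
  define Q where "Q n x y \<longleftrightarrow> (case x of (as, Z, g) \<Rightarrow> case y of (bs, Z', g') \<Rightarrow>
    (\<forall>j<length bs. g' j \<in> free_part V as (bs ! j)) \<and> comb (length bs) g' ` free V bs = Z \<and>
    Z' = {v \<in> free V bs. comb (length bs) g' v = 0})"
    for n :: nat and x y :: "int list \<times> (nat \<Rightarrow> 'k mpoly) set \<times> (nat \<Rightarrow> nat \<Rightarrow> 'k mpoly)"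
  define P where "P n x \<longleftrightarrow> (case x of (as, Z, g) \<Rightarrow> INV as Z \<and> (n = 0 \<longrightarrow> as = [0] \<and> Z = Z1))"
    for n :: nat and x :: "int list \<times> (nat \<Rightarrow> 'k mpoly) set \<times> (nat \<Rightarrow> nat \<Rightarrow> 'k mpoly)"
  have "\<exists>f. \<forall>n. P n (f n) \<and> Q n (f n) (f (Suc n))"
  proof (rule dependent_nat_choice)
    show "\<exists>x. P 0 x" using INV1 by (intro exI[of _ "([0], Z1, undefined)"]) (simp add: P_def)
    fix x n assume "P n x"
    then obtain as Z g where x: "x = (as, Z, g)" and I: "INV as Z" unfolding P_def by (cases x) auto
    from I have Zg: "graded_submod V as Z" and Zm: "Z \<subseteq> vmon V as V"
      and Zf: "\<And>q. q \<ge> 0 \<Longrightarrow> quot_fin (fscale vscale) (kcyc vact l q Z {0}) (kbnd vact l q Z {0})"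
      unfolding INV_def by simp_all
    have Zs: "submod Z" using Zg unfolding graded_submod_def by (elim conjE)
    have f0: "quot_fin vscale Z (imul vact l Z)"
      by (rule quot_iso_fin[OF quot_iso_sym[OF koszul_bot[OF Zs lV]] Zf]) simp
    obtain bs h where h: "\<And>j. j < length bs \<Longrightarrow> h j \<in> free_part V as (bs ! j)"
      "comb (length bs) h ` free V bs = Z"
      "{v \<in> free V bs. comb (length bs) h v = 0} \<subseteq> vmon V bs V"
      "graded_submod V bs {v \<in> free V bs. comb (length bs) h v = 0}"
      by (rule minimal_cover[OF l(2) Zg f0]) (rule that)
    let ?Z = "{v \<in> free V bs. comb (length bs) h v = 0}"
    have "INV bs ?Z" unfolding INV_def
    proof (intro conjI allI impI h(3,4))
      fix q :: int assume q: "q \<ge> 0"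
      show "quot_fin (fscale vscale) (kcyc vact l q ?Z {0}) (kbnd vact l q ?Z {0})"
        by (rule quot_iso_fin[OF koszul_shift_free[OF l ops_v comb_hom refl h(3) q]])
          (unfold h(2), rule Zf, use q in simp)
    qed
    then have "P (Suc n) (bs, ?Z, h)" by (simp add: P_def)
    moreover have "Q n x (bs, ?Z, h)" unfolding Q_def x using h(1,2) by simp
    ultimately show "\<exists>y. P (Suc n) y \<and> Q n x y" by blast
  qed
  then obtain f where f: "\<And>n. P n (f n)" "\<And>n. Q n (f n) (f (Suc n))" by blast
  define F where "F n = fst (f n)" for n
  define Z where "Z n = fst (snd (f n))" for n
  define g where "g n = snd (snd (f n))" for n
  have fn: "f n = (F n, Z n, g n)" for n by (simp add: F_def Z_def g_def)
  have INVn: "INV (F n) (Z n)" and F0: "F 0 = [0]" and Z0: "Z 0 = Z1" for n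
    using f(1)[of n] f(1)[of 0] unfolding fn P_def by simp_all
  have gn: "g (Suc n) j \<in> free_part V (F n) (F (Suc n) ! j)" if "j < length (F (Suc n))" for n j
    using f(2)[of n] that unfolding fn Q_def by simp
  have imgn: "comb (length (F (Suc n))) (g (Suc n)) ` free V (F (Suc n)) = Z n" for n
    using f(2)[of n] unfolding fn Q_def by simp
  have kern: "Z (Suc n) = {v \<in> free V (F (Suc n)). comb (length (F (Suc n))) (g (Suc n)) v = 0}" for n
    using f(2)[of n] unfolding fn Q_def by simp
  define d where "d n = comb (length (F (Suc n))) (g (Suc n))" for n
  define \<epsilon> where "\<epsilon> v = J +>\<^bsub>?R\<^esub> v 0" for v :: "nat \<Rightarrow> 'k mpoly"
  have qcar: "carrier (quot_mod V J) = (\<lambda>f. J +>\<^bsub>?R\<^esub> f) ` polys V"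
    and qadd: "add (quot_mod V J) = add (?R Quot J)" and qz: "ring.zero (quot_mod V J) = J +>\<^bsub>?R\<^esub> 0"
    and qsm: "\<And>r a. smult (quot_mod V J) r a = (J +>\<^bsub>?R\<^esub> r) \<otimes>\<^bsub>?R Quot J\<^esub> a"
    using qs by (simp_all add: quot_mod_def Let_def)
  have dmem: "d k v \<in> free V (F k)" if "v \<in> free V (F (Suc k))" for k v
    unfolding d_def
  proof (rule comb_mem)
    show "g (Suc k) j \<in> free V (F k)" if "j < length (F (Suc k))" for j
      using gn[OF that] by (simp add: in_free_part)
    show "v j \<in> polys V" for j using that by (simp add: in_free)
  qed
  have "graded_free_resolution V J F d \<epsilon>"
    unfolding graded_free_resolution_def
  proof (intro conjI allI)
    show "\<epsilon> \<in> module_homs ?R (free_mod V (F 0)) (quot_mod V J)"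
      unfolding module_homs_def by (auto simp: qcar qadd qsm \<epsilon>_def in_free qs)
    show "\<epsilon> ` free_part V (F 0) e \<subseteq> quot_part V J e" for e
    proof
      fix x assume "x \<in> \<epsilon> ` free_part V (F 0) e"
      then obtain v where v: "v \<in> free_part V [0] e" "x = \<epsilon> v" unfolding F0 by blast
      have "v 0 \<in> homog_part V (e - [0] ! 0)" using v(1) unfolding in_free_part by blast
      then show "x \<in> quot_part V J e" unfolding v(2) \<epsilon>_def quot_part_def by simp
    qed
    show "d k \<in> module_homs ?R (free_mod V (F (Suc k))) (free_mod V (F k))" for k
      unfolding module_homs_def using dmem by (simp add: d_def comb_add comb_smult)
    show "d k ` free_part V (F (Suc k)) e \<subseteq> free_part V (F k) e" for k e
      unfolding d_def using comb_free_part[OF gn] by blast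
    show "\<epsilon> ` free V (F 0) = carrier (quot_mod V J)"
    proof
      show "\<epsilon> ` free V (F 0) \<subseteq> carrier (quot_mod V J)" by (auto simp: qcar \<epsilon>_def in_free)
      show "carrier (quot_mod V J) \<subseteq> \<epsilon> ` free V (F 0)"
      proof
        fix x assume "x \<in> carrier (quot_mod V J)"
        then obtain h where h: "h \<in> polys V" "x = J +>\<^bsub>?R\<^esub> h" unfolding qcar by blast
        then have "x = \<epsilon> (\<lambda>j. if j = 0 then h else 0)" by (simp add: \<epsilon>_def)
        then show "x \<in> \<epsilon> ` free V (F 0)" using emb[OF h(1)] unfolding F0 by (rule image_eqI)
      qed
    qed
    show "d 0 ` free V (F (Suc 0)) = a_kernel (free_mod V (F 0)) (quot_mod V J) \<epsilon>"
    proof -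
      have "\<epsilon> v = J +>\<^bsub>?R\<^esub> 0 \<longleftrightarrow> v 0 \<in> J" if "v \<in> free V [0]" for v
        using coset_eq_iff[OF J, of "v 0" 0] that by (simp add: \<epsilon>_def in_free)
      then have "{v \<in> free V [0]. \<epsilon> v = J +>\<^bsub>?R\<^esub> 0} = Z1" using Z1_iff by blast
      then show ?thesis unfolding a_kernel_free[OF qz] d_def imgn Z0 F0 by simp
    qed
    show "d (Suc k) ` free V (F (Suc (Suc k))) = a_kernel (free_mod V (F (Suc k))) (free_mod V (F k)) (d k)" for k
    proof -
      have z: "\<zero>\<^bsub>free_mod V (F k)\<^esub> = (0 :: nat \<Rightarrow> 'k mpoly)" by (simp only: free_mod_simps)
      show ?thesis unfolding a_kernel_free[OF z] unfolding d_def imgn kern ..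
    qed
  qed
  moreover have "d k v j \<in> irrelevant_ideal V" if "v \<in> free V (F (Suc k))" "j < length (F k)" for k v j
  proof -
    have "d k v \<in> Z k" using imgn[of k] that(1) unfolding d_def by blast
    then have "d k v \<in> vmon V (F k) V" using INVn[of k] unfolding INV_def by blast
    then show ?thesis using that(2) unfolding vmon_irrelevant by blast
  qed
  ultimately have "minimal_graded_free_resolution V J F d \<epsilon>" unfolding minimal_graded_free_resolution_def by blast
  then show ?thesis by blast
qed

section \<open>The semigroup of an arithmetic sequence\<close>

locale arith_curve =
  fixes n d :: nat and m :: "nat \<Rightarrow> nat"
  assumes n2: "n \<ge> 2" and mpos: "\<forall>i\<in>{1..n}. m i > 0" and dpos: "d > 0"
    and arith: "\<forall>i\<in>{1..n}. m i = m 1 + (i - 1) * d" and coprime: "gcd (m 1) d = 1"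
begin

definition "r = n - 1"
definition "a = m 1"
definition "M = a + r * d"

lemma r_pos: "r \<ge> 1" using n2 by (simp add: r_def)
lemma a_pos: "a \<ge> 1" using mpos n2 by (simp add: a_def Suc_le_eq)
lemma M_pos: "M \<ge> 2"
proof -
  have "1 \<le> r * d" using r_pos dpos by simp
  then show ?thesis using a_pos unfolding M_def by linarith
qed
lemma m_eq: "1 \<le> i \<Longrightarrow> i \<le> n \<Longrightarrow> m i = a + (i - 1) * d" unfolding a_def by (rule bspec[OF arith]) simp
lemma m_n: "m n = M" using m_eq[of n] n2 by (simp add: M_def r_def)

text \<open>The pair \<open>(x, \<delta>)\<close> stands for the monomial \<open>u\<^sup>x v\<^sup>M\<^sup>\<delta>\<^sup>-\<^sup>x\<close> of the coordinate ring, where \<open>\<delta>\<close> is its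
  degree: \<open>x\<close> has to be a sum of at most \<open>\<delta>\<close> of the \<open>m i\<close>, and the sums of exactly \<open>j\<close> of them are the
  numbers \<open>j * a + t * d\<close> with \<open>t \<le> r * j\<close>.\<close>

definition in_S :: "nat \<Rightarrow> nat \<Rightarrow> bool" where
  "in_S x \<delta> \<longleftrightarrow> (\<exists>j t. j \<le> \<delta> \<and> t \<le> r * j \<and> x = j * a + t * d)"

lemma in_SI: "j \<le> \<delta> \<Longrightarrow> t \<le> r * j \<Longrightarrow> in_S (j * a + t * d) \<delta>"
  unfolding in_S_def by blast

lemma in_S_le: "in_S x \<delta> \<Longrightarrow> x \<le> M * \<delta>"
proof -
  assume "in_S x \<delta>"
  then obtain j t where jt: "j \<le> \<delta>" "t \<le> r * j" "x = j * a + t * d" unfolding in_S_def by blast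
  have "x \<le> j * a + r * j * d" using jt by simp
  also have "\<dots> = M * j" by (simp add: M_def algebra_simps)
  also have "\<dots> \<le> M * \<delta>" using jt by simp
  finally show ?thesis .
qed

lemma in_S_0: "in_S 0 0" using in_SI[of 0 0 0] by simp

lemma in_S_Suc: "in_S x \<delta> \<Longrightarrow> in_S x (Suc \<delta>)"
  unfolding in_S_def using le_SucI by blast

lemma in_S_step:
  assumes "in_S x \<delta>" "c \<le> r" shows "in_S (x + (a + c * d)) (Suc \<delta>)"
proof -
  obtain j t where jt: "j \<le> \<delta>" "t \<le> r * j" "x = j * a + t * d" using assms(1) unfolding in_S_def by blast
  have "x + (a + c * d) = Suc j * a + (t + c) * d" using jt(3) by (simp add: algebra_simps)
  moreover have "t + c \<le> r * Suc j" using jt(2) assms(2) by simp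
  then have "in_S (Suc j * a + (t + c) * d) (Suc \<delta>)" using jt(1) by (intro in_SI) simp_all
  ultimately show ?thesis by (simp only:)
qed

text \<open>Two representations \<open>j * a + t * d\<close> of the same number differ by a multiple of \<open>(d, - a)\<close>.\<close>

lemma shift_rep:
  assumes "j * a + t * d = j' * a + t' * d" "j' < j" "t' \<le> r * j'"
  shows "t + M \<le> r * j"
proof -
  have eq: "(int j - int j') * int a = (int t' - int t) * int d"
    using arg_cong[OF assms(1), of int] by (simp add: algebra_simps)
  have "coprime (int d) (int a)"
    using coprime by (simp add: a_def coprime_iff_gcd_eq_1 gcd.commute)
  moreover have "int d dvd (int j - int j') * int a" unfolding eq by simp
  ultimately have "int d dvd int j - int j'" by (simp add: coprime_dvd_mult_left_iff)
  then obtain k where k: "int j - int j' = int d * k" by blast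
  then have k1: "k \<ge> 1" using assms(2) dpos by (metis diff_gt_0_iff_gt int_one_le_iff_zero_less of_nat_0_less_iff of_nat_less_iff zero_less_mult_pos)
  have "int d * (k * int a) = int d * (int t' - int t)" using eq unfolding k by (simp add: algebra_simps)
  then have t': "int t' = int t + k * int a" using dpos by simp
  \<comment> \<open>Inserting \<open>j' = j - d k\<close> and \<open>t' = t + k a\<close> into
    \<open>t' <= r j'\<close> collects \<open>k (a + r d) = k M\<close> on the left.\<close>
  have "int t + k * int a \<le> int r * (int j - int d * k)"
  proof -
    have "int t' \<le> int r * int j'" using assms(3) by (metis of_nat_le_iff of_nat_mult)
    moreover have "int j' = int j - int d * k" using k by simp
    ultimately show ?thesis using t' by simp
  qed
  then have "int t + k * int M \<le> int r * int j" by (simp add: M_def algebra_simps)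
  moreover have "int M \<le> k * int M" using k1 by (simp add: mult_le_cancel_right1)
  ultimately have "int t + int M \<le> int r * int j" by linarith
  then show ?thesis by (metis of_nat_add of_nat_le_iff of_nat_mult)
qed

text \<open>This is the Cohen--Macaulay property: \<open>x\<^sub>n\<close> is a nonzerodivisor modulo \<open>x\<^sub>n\<^sub>+\<^sub>1\<close>.\<close>

lemma in_S_depth:
  assumes "in_S x \<delta>" "in_S (x + M) \<delta>"
  shows "\<exists>\<delta>'. \<delta> = Suc \<delta>' \<and> in_S x \<delta>'"
proof -
  obtain j t where jt: "j \<le> \<delta>" "t \<le> r * j" "x + M = j * a + t * d" using assms(2) unfolding in_S_def by blast
  have j0: "j \<noteq> 0" using jt(2,3) M_pos by (intro notI) simp
  then obtain \<delta>' where \<delta>': "\<delta> = Suc \<delta>'" using jt(1) by (cases \<delta>) auto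
  obtain i where i: "j = Suc i" using j0 by (cases j) auto
  have "in_S x \<delta>'"
  proof (cases "r \<le> t")
    case True
    then have "x = i * a + (t - r) * d" using jt(3) unfolding i M_def by (simp add: algebra_simps diff_mult_distrib)
    then show ?thesis using in_SI[of i \<delta>' "t - r"] jt(1,2) i \<delta>' by simp
  next
    case False
    obtain j' t' where jt': "j' \<le> \<delta>" "t' \<le> r * j'" "x = j' * a + t' * d" using assms(1) unfolding in_S_def by blast
    \<comment> \<open>By size: otherwise \<open>x + M\<close> would be at least
      \<open>(\<delta> + 1) a + r d\<close>, while \<open>j <= \<delta>\<close> and
      \<open>t < r\<close> keep it below \<open>\<delta> a + r d\<close>.\<close>
    have "j' \<noteq> \<delta>"
    proof
      assume j': "j' = \<delta>"
      have "(j' + 1) * a + (t' + r) * d = j * a + t * d" using jt(3) unfolding jt'(3) M_def by (simp add: algebra_simps)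
      moreover have "j < j' + 1" using jt(1) j' by simp
      moreover have "j * a \<le> j' * a" using jt(1) j' by simp
      moreover have "t * d < r * d" using False dpos by simp
      moreover have "(j' + 1) * a + (t' + r) * d = j' * a + a + t' * d + r * d" by (simp add: algebra_simps)
      ultimately show False by linarith
    qed
    then show ?thesis using in_SI[of j' \<delta>' t'] jt' \<delta>' by simp
  qed
  then show ?thesis using \<delta>' by blast
qed

text \<open>The monomials outside the ideal generated by \<open>x\<^sub>n\<close> and \<open>x\<^sub>n\<^sub>+\<^sub>1\<close>. They have degree \<open>j\<close>, and
  \<open>r * j - t\<close> runs through \<open>0, \<dots>, M - 1\<close>.\<close>

definition apery :: "nat \<Rightarrow> nat \<Rightarrow> bool" where
  "apery j t \<longleftrightarrow> j = 0 \<and> t = 0 \<or> j \<ge> 1 \<and> t < r \<and> r * j < M + t"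

text \<open>Divisibility by \<open>x_(n+1)\<close> means a representation with fewer than
  \<open>\<delta>\<close> summands, divisibility by \<open>x_n\<close> that one summand
  \<open>m n\<close> can be split off. With \<open>j = \<delta>\<close> summands, fewer are possible
  iff \<open>d\<close> of them can be traded, \<open>(j, t)\<close> becoming
  \<open>(j - d, t + a)\<close>; this needs \<open>r j >= M + t\<close>, and
  \<open>shift_rep\<close> gives the converse.\<close>

lemma apery_iff:
  "in_S x \<delta> \<and> \<not> (\<exists>\<delta>'. \<delta> = Suc \<delta>' \<and> (in_S x \<delta>' \<or> (\<exists>y. x = y + M \<and> in_S y \<delta>'))) \<longleftrightarrow>
    (\<exists>t. apery \<delta> t \<and> x = \<delta> * a + t * d)" (is "?L \<longleftrightarrow> ?R")
proof
  assume L: ?L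
  then obtain j t where jt: "j \<le> \<delta>" "t \<le> r * j" "x = j * a + t * d" unfolding in_S_def by blast
  show ?R
  proof (cases \<delta>)
    case 0
    then show ?thesis using jt by (intro exI[of _ 0]) (simp add: apery_def)
  next
    case (Suc \<delta>')
    have nS: "\<not> in_S x \<delta>'" and nM: "\<And>y. x = y + M \<Longrightarrow> \<not> in_S y \<delta>'" using L Suc by auto
    have j: "j = Suc \<delta>'" using in_SI[of j \<delta>' t] jt nS Suc by (metis le_SucE)
    have "t < r"
    proof (rule ccontr)
      assume "\<not> t < r"
      then obtain u where u: "t = r + u" by (metis not_less le_iff_add)
      have "x = (\<delta>' * a + u * d) + M" using jt(3) unfolding j M_def u by (simp add: algebra_simps)
      moreover have "in_S (\<delta>' * a + u * d) \<delta>'" using jt(2) j u by (intro in_SI) auto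
      ultimately show False using nM by blast
    qed
    moreover have "r * j < M + t"
    proof (rule ccontr)
      assume "\<not> r * j < M + t"
      then have ge: "a + r * d + t \<le> r * j" by (simp add: M_def)
      then have "r * d \<le> r * j" by linarith
      then have dj: "d \<le> j" using r_pos by simp
      have "x = (j - d) * a + (t + a) * d" using jt(3) dj by (simp add: algebra_simps diff_mult_distrib)
      moreover have "t + a \<le> r * (j - d)" using ge by (simp add: diff_mult_distrib2)
      moreover have "j - d \<le> \<delta>'" using j dpos by simp
      ultimately show False using nS in_SI by blast
    qed
    ultimately show ?thesis using jt j Suc by (intro exI[of _ t]) (simp add: apery_def)
  qed
next
  assume ?R
  then obtain t where t: "apery \<delta> t" "x = \<delta> * a + t * d" by blast
  have "in_S x \<delta>" unfolding t(2)
  proof (rule in_SI)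
    show "t \<le> r * \<delta>" using t(1) unfolding apery_def by (cases \<delta>) (auto intro: order.trans[of _ r])
  qed simp
  moreover have False if d': "\<delta> = Suc \<delta>'" and or: "in_S x \<delta>' \<or> (\<exists>y. x = y + M \<and> in_S y \<delta>')" for \<delta>'
  proof -
    have E: "t < r" "r * \<delta> < M + t" using t(1) d' unfolding apery_def by auto
    have no: False if "\<delta> * a + t * d = j' * a + t' * d" "j' < \<delta>" "t' \<le> r * j'" for j' t'
      using shift_rep[OF that] E(2) by simp
    from or show False
    proof
      assume "in_S x \<delta>'"
      then show False using no t(2) d' unfolding in_S_def by (metis le_imp_less_Suc)
    next
      assume "\<exists>y. x = y + M \<and> in_S y \<delta>'"
      then obtain j t' where y: "j \<le> \<delta>'" "t' \<le> r * j" "x = j * a + t' * d + M" unfolding in_S_def by blast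
      have eq: "\<delta> * a + t * d = Suc j * a + (t' + r) * d" using y(3) t(2) by (simp add: M_def algebra_simps)
      show False
      proof (cases "Suc j = \<delta>")
        case True
        then have "t * d = (t' + r) * d" using eq by simp
        then show False using E(1) dpos by simp
      next
        case False
        then show False using no[OF eq] y(1,2) d' by (simp add: add.commute)
      qed
    qed
  qed
  ultimately show ?L by blast
qed

lemma apery_finite: "finite {(j, t). apery j t}"
proof (rule finite_subset)
  have "j \<le> M + r \<and> t \<le> r" if "apery j t" for j t
  proof -
    have "j \<le> r * j" using r_pos by simp
    then show ?thesis using that unfolding apery_def by linarith
  qed
  then show "{(j, t). apery j t} \<subseteq> {..M + r} \<times> {..r}" by auto
qed simp

text \<open>Multiplication by \<open>x_(c+1)\<close> with \<open>c < r\<close> takes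
  \<open>(j, t)\<close> to \<open>(j + 1, t + c)\<close>, while \<open>x_n\<close> and
  \<open>x_(n+1)\<close> act as zero on the quotient.\<close>

definition socle :: "nat \<Rightarrow> nat \<Rightarrow> bool" where
  "socle j t \<longleftrightarrow> apery j t \<and> (\<forall>c<r. \<not> apery (Suc j) (t + c))"

text \<open>Among the pairs \<open>(j + 1, t + c)\<close> with \<open>t + c < r\<close>, the one
  with \<open>t + c = r - 1\<close> has the weakest Apery inequality
  \<open>r (j + 1) < M + t + c\<close>. So all of them fail iff this one does, that is, iff
  \<open>M <= r j + 1\<close>.\<close>

lemma socle_iff: "socle j t \<longleftrightarrow> t < r \<and> M \<le> r * j + 1 \<and> r * j < M + t"
proof -
  have t: "t < r" if "apery j t" using that r_pos unfolding apery_def by auto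
  have "(\<forall>c<r. \<not> apery (Suc j) (t + c)) \<longleftrightarrow> M \<le> r * j + 1" if "t < r"
  proof
    assume *: "\<forall>c<r. \<not> apery (Suc j) (t + c)"
    have "r - 1 - t < r" "t + (r - 1 - t) = r - 1" using r_pos that by linarith+
    then have "\<not> apery (Suc j) (r - 1)" using *[rule_format, of "r - 1 - t"] by (simp only:) simp
    then show "M \<le> r * j + 1" using r_pos by (auto simp: apery_def)
  qed (auto simp: apery_def)
  moreover have "j \<ge> 1" if "M \<le> r * j + 1" using that M_pos by (cases j) auto
  moreover have "apery j t \<longleftrightarrow> t < r \<and> r * j < M + t" if "j \<ge> 1" using that by (auto simp: apery_def)
  ultimately show ?thesis unfolding socle_def using t by blast
qed

lemma socle_nonempty: "\<exists>j. socle j (r - 1)"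
proof -
  \<comment> \<open>\<open>(M - 1) / r\<close> rounded up.\<close>
  define j where "j = (M + r - 2) div r"
  have "r * j \<le> M + r - 2" unfolding j_def by simp
  moreover have "M + r - 2 < r * j + r" unfolding j_def using r_pos
    by (metis add.commute dividend_less_times_div less_le_trans mult.commute zero_less_one)
  ultimately have "socle j (r - 1)" unfolding socle_iff using r_pos M_pos by auto
  then show ?thesis ..
qed

text \<open>The inequalities confine \<open>r j\<close> to a window of length \<open>r\<close>, so
  \<open>j\<close> is common to all socle elements, and \<open>t = r - 1\<close> always occurs. For
  \<open>r >= 2\<close>, uniqueness amounts to the failure of the next candidate
  \<open>t = r - 2\<close>.\<close>

lemma socle_unique:
  "(\<exists>!p. case p of (j, t) \<Rightarrow> socle j t) \<longleftrightarrow> [m 1 = 2] (mod (n - 1))"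
proof -
  obtain j where j: "socle j (r - 1)" using socle_nonempty by blast
  have ju: "j' = j" if "socle j' t" for j' t
  proof -
    have "r * j' < r * j + r" "r * j < r * j' + r" using that j unfolding socle_iff using r_pos by auto
    then have "r * j' < r * (j + 1)" "r * j < r * (j' + 1)" by auto
    then have "j' < j + 1" "j < j' + 1" by (simp_all only: mult_less_cancel1)
    then show ?thesis by simp
  qed
  have cong: "[m 1 = 2] (mod (n - 1)) \<longleftrightarrow> [M = 2] (mod r)"
    by (simp add: cong_def M_def a_def r_def)
  have jpos: "j \<ge> 1" using j M_pos unfolding socle_iff by (cases j) auto
  have "(\<exists>!p. case p of (j, t) \<Rightarrow> socle j t) \<longleftrightarrow> r * j + 2 = M + r"
  proof
    assume un: "\<exists>!p. case p of (j, t) \<Rightarrow> socle j t"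
    show "r * j + 2 = M + r"
    proof (cases "r = 1")
      case True
      then show ?thesis using j unfolding socle_iff by auto
    next
      case False
      then have r2: "r \<ge> 2" using r_pos by simp
      have "\<not> socle j (r - 2)"
      proof
        assume "socle j (r - 2)"
        then have "(j, r - 2) = (j, r - 1)" using un j by (auto simp: Ex1_def)
        then show False using r2 by simp
      qed
      then show ?thesis using j r2 unfolding socle_iff by auto
    qed
  next
    assume eq: "r * j + 2 = M + r"
    show "\<exists>!p. case p of (j, t) \<Rightarrow> socle j t"
    proof (rule ex1I[of _ "(j, r - 1)"])
      show "case (j, r - 1) of (j, t) \<Rightarrow> socle j t" using j by simp
      fix p assume "case p of (j, t) \<Rightarrow> socle j t"
      then obtain j' t where p: "p = (j', t)" "socle j' t" by (cases p) auto
      have "j' = j" using ju p by blast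
      then have "t = r - 1" using p(2) eq unfolding socle_iff by auto
      then show "p = (j, r - 1)" using p \<open>j' = j\<close> by simp
    qed
  qed
  also have "\<dots> \<longleftrightarrow> [M = 2] (mod r)"
  proof
    assume eq: "r * j + 2 = M + r"
    moreover obtain i where "j = Suc i" using jpos by (cases j) auto
    ultimately have "M = 2 + r * i" by simp
    then show "[M = 2] (mod r)" unfolding cong_def by (simp only: mod_mult_self2)
  next
    assume "[M = 2] (mod r)"
    then obtain k where k: "M = 2 + k * r" using M_pos by (metis cong_to_1_nat cong_diff_iff_cong_0_nat cong_0_iff dvd_def le_add_diff_inverse mult.commute)
    have "socle (k + 1) (r - 1)" unfolding socle_iff using k r_pos by (auto simp: algebra_simps)
    then have "k + 1 = j" using ju by blast
    then show "r * j + 2 = M + r" using k by (auto simp: algebra_simps)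
  qed
  finally show ?thesis using cong by simp
qed

end

section \<open>Koszul homology of the coordinate ring\<close>

definition kspan :: "(nat \<Rightarrow>\<^sub>0 nat) set \<Rightarrow> ('k::field) mpoly set" where
  "kspan T = {f. keys f \<subseteq> T}"

lemma kspan_closed:
  "0 \<in> kspan T" "f \<in> kspan T \<Longrightarrow> g \<in> kspan T \<Longrightarrow> f + g \<in> kspan T" "f \<in> kspan T \<Longrightarrow> - f \<in> kspan T"
  "f \<in> kspan T \<Longrightarrow> Const c * f \<in> kspan T" "t \<in> T \<Longrightarrow> single t c \<in> kspan T"
  using keys_add[of f g] by (auto simp: kspan_def in_keys_iff lookup_single when_def)

lemma kspan_sum: "(\<And>x. x \<in> A \<Longrightarrow> f x \<in> kspan T) \<Longrightarrow> sum f A \<in> kspan T"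
  by (induction A rule: infinite_finite_induct) (auto simp: kspan_closed)

lemma kspan_empty: "kspan {} = {0}"
  by (auto simp: kspan_def)

lemma kspan_induct [consumes 1, case_names zero monomial add]:
  assumes "f \<in> kspan T" "P 0" "\<And>t c. t \<in> T \<Longrightarrow> P (single t c)" "\<And>f g. P f \<Longrightarrow> P g \<Longrightarrow> P (f + g)"
  shows "P f"
proof -
  have "P (\<Sum>t\<in>B. single t (lookup f t))" if "B \<subseteq> keys f" for B
    using that by (induction B rule: infinite_finite_induct) (use assms in \<open>auto simp: kspan_def\<close>)
  then show ?thesis using mpoly_expand[of f] by (metis order_refl)
qed

text \<open>The analogue of \<open>vmon_step\<close> for spans of monomials; with
  \<open>U = S\<close> it computes the submodules \<open>N + a M\<close> that arise in
  \<open>koszul_regular\<close>.\<close>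

lemma kspan_step:
  "{y + single g 1 * x | y x. y \<in> kspan T \<and> x \<in> kspan U} = (kspan (T \<union> (+) g ` U) :: ('k::field) mpoly set)" (is "?L = ?R")
proof
  show "?L \<subseteq> ?R"
  proof safe
    fix y x :: "'k mpoly" assume "y \<in> kspan T" "x \<in> kspan U"
    then have "y \<in> ?R" "single g 1 * x \<in> ?R" by (auto simp: kspan_def keys_single_times)
    then show "y + single g 1 * x \<in> ?R" by (rule kspan_closed)
  qed
  show "?R \<subseteq> ?L"
  proof
    fix f :: "'k mpoly" assume "f \<in> ?R"
    then have "\<exists>y\<in>kspan T. \<exists>x\<in>kspan U. f = y + single g 1 * x"
    proof (induction rule: kspan_induct)
      case zero
      show ?case by (intro bexI[of _ 0] kspan_closed) simp
    next
      case (monomial t c)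
      then show ?case
      proof
        assume "t \<in> T"
        then show ?thesis by (intro bexI[of _ "single t c"] bexI[of _ 0] kspan_closed) simp_all
      next
        assume "t \<in> (+) g ` U"
        then obtain u where "t = g + u" "u \<in> U" by blast
        then show ?thesis by (intro bexI[of _ 0] bexI[of _ "single u c"] kspan_closed) (simp_all add: mult_single)
      qed
    next
      case (add f f')
      then obtain y x y' x' where h: "y \<in> kspan T" "x \<in> kspan U" "f = y + single g 1 * x"
        "y' \<in> kspan T" "x' \<in> kspan U" "f' = y' + single g 1 * x'" by blast
      then have "f + f' = (y + y') + single g 1 * (x + x')" by (simp add: algebra_simps)
      then show ?case using kspan_closed(2) h by blast
    qed
    then show "f \<in> ?L" by blast
  qed
qed

text \<open>The monomials with exponent in \<open>U - T\<close> represent a basis of the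
  quotient.\<close>

lemma kspan_quot_line:
  assumes "T \<subseteq> U"
  shows "quot_line pscale (kspan U :: 'k::field mpoly set) (kspan T) \<longleftrightarrow> (\<exists>!s. s \<in> U - T)"
proof
  assume "quot_line pscale (kspan U :: 'k mpoly set) (kspan T)"
  then obtain z :: "'k mpoly" where z: "z \<in> kspan U" "z \<notin> kspan T" "\<And>y. y \<in> kspan U \<Longrightarrow> \<exists>c. y + pscale c z \<in> kspan T"
    unfolding quot_line_def by blast
  then obtain s where s: "s \<in> keys z" "s \<in> U - T" unfolding kspan_def by blast
  show "\<exists>!s. s \<in> U - T"
  proof (rule ex1I[of _ s])
    show "s \<in> U - T" by fact
    fix t assume t: "t \<in> U - T"
    show "t = s"
    proof (rule ccontr)
      assume ne: "t \<noteq> s"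
      have van: "lookup f u = 0" if "f \<in> kspan T" "u \<in> U - T" for f :: "'k mpoly" and u
        using that by (auto simp: kspan_def in_keys_iff)
      obtain c where "single t 1 + pscale c z \<in> kspan T" using z(3)[of "single t 1"] t kspan_closed(5) by blast
      note c = van[OF this]
      have "lookup z s \<noteq> 0" using s(1) by (simp add: in_keys_iff)
      then have "c = 0" using c[OF s(2)] ne by (simp add: lookup_add pscale_def lookup_single)
      then show False using c[OF t] by (simp add: lookup_add pscale_def)
    qed
  qed
next
  assume "\<exists>!s. s \<in> U - T"
  then obtain s where s: "s \<in> U - T" "\<And>t. t \<in> U - T \<Longrightarrow> t = s" by blast
  show "quot_line pscale (kspan U :: 'k mpoly set) (kspan T)" unfolding quot_line_def
  proof (intro bexI conjI ballI)
    show "single s (1::'k) \<in> kspan U" using s(1) by (simp add: kspan_closed)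
    show "single s (1::'k) \<notin> kspan T" using s(1) by (simp add: kspan_def)
    fix y :: "'k mpoly" assume y: "y \<in> kspan U"
    have "t \<in> T" if "t \<in> keys (y + pscale (- lookup y s) (single s 1))" for t
    proof -
      have nz: "lookup y t + (- lookup y s) * lookup (single s 1) t \<noteq> 0"
        using that by (simp add: in_keys_iff lookup_add pscale_def)
      then have "t \<noteq> s" by auto
      moreover from this nz have "t \<in> keys y" by (simp add: in_keys_iff lookup_single)
      then have "t \<in> U" using y by (auto simp: kspan_def)
      ultimately show ?thesis using s(2) by blast
    qed
    then have "y + pscale (- lookup y s) (single s 1) \<in> kspan T" unfolding kspan_def by blast
    then show "\<exists>c. y + pscale c (single s 1) \<in> kspan T" by blast
  qed
qed

lemma kspan_submod:
  assumes "\<And>i t. i \<in> V \<Longrightarrow> t \<in> T \<Longrightarrow> g i + t \<in> T" and \<psi>: "\<And>i. i \<in> V \<Longrightarrow> \<psi> i = single (g i) (1::'k::field)"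
  shows "ops.submod pscale (\<lambda>i f. \<psi> i * f) V (kspan T)"
proof -
  interpret ops pscale "\<lambda>i f. \<psi> i * f" V by (rule ops_p)
  show ?thesis
    by (rule submodI) (use assms(1) in \<open>auto simp: kspan_closed pscale_def \<psi>\<close>, auto simp: kspan_def keys_single_times)
qed

lemma Var_power: "Var i ^ k = single (single i k) 1"
  by (induction k) (simp_all add: Var_def mult_single flip: single_add)

section \<open>The coordinate ring as a semigroup ring\<close>

context arith_curve begin

text \<open>The truncated subtraction is faithful for \<open>x <= M * \<delta>\<close>, which
  \<open>in_S_le\<close> provides for the exponents in question.\<close>

definition mono :: "nat \<Rightarrow> nat \<Rightarrow> (nat \<Rightarrow>\<^sub>0 nat)" where
  "mono x \<delta> = single 1 x + single 2 (M * \<delta> - x)"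

definition gen :: "nat \<Rightarrow> (nat \<Rightarrow>\<^sub>0 nat)" where
  "gen i = (if i = n + 1 then mono 0 1 else mono (m i) 1)"

abbreviation "V \<equiv> {1..n+1}"

definition S :: "(nat \<Rightarrow>\<^sub>0 nat) set" where
  "S = {mono x \<delta> | x \<delta>. in_S x \<delta>}"

lemma mono_add:
  assumes "x \<le> M * \<delta>" "x' \<le> M * \<delta>'" shows "mono x \<delta> + mono x' \<delta>' = mono (x + x') (\<delta> + \<delta>')"
proof -
  have "M * \<delta> - x + (M * \<delta>' - x') = M * (\<delta> + \<delta>') - (x + x')" using assms by (simp add: distrib_left)
  moreover have "mono x \<delta> + mono x' \<delta>' = single 1 (x + x') + single 2 (M * \<delta> - x + (M * \<delta>' - x'))"
    unfolding mono_def single_add by (simp add: ac_simps)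
  ultimately show ?thesis by (simp add: mono_def)
qed

lemma mono_inj:
  assumes "x \<le> M * \<delta>" "x' \<le> M * \<delta>'" "mono x \<delta> = mono x' \<delta>'" shows "x = x' \<and> \<delta> = \<delta>'"
proof -
  have "lookup (mono x \<delta>) 1 = x" "lookup (mono x \<delta>) 2 = M * \<delta> - x" "lookup (mono x' \<delta>') 1 = x'" "lookup (mono x' \<delta>') 2 = M * \<delta>' - x'"
    by (simp_all add: mono_def lookup_add lookup_single)
  then have "x = x'" "M * \<delta> - x = M * \<delta>' - x'" using assms(3) by metis+
  then have "M * \<delta> = M * \<delta>'" using assms(1,2) by linarith
  then show ?thesis using \<open>x = x'\<close> M_pos by simp
qed

lemma mi: "c < n \<Longrightarrow> m (c + 1) = a + c * d" using m_eq[of "c + 1"] by simp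

lemma gen_last: "gen (n + 1) = mono 0 1" and gen_n: "gen n = mono M 1"
  by (simp_all add: gen_def m_n)

lemma gen_in: "c < n \<Longrightarrow> gen (c + 1) = mono (a + c * d) 1"
  using mi[of c] by (simp add: gen_def)

lemma V_cases:
  assumes "i \<in> V" obtains "i = n + 1" | c where "c < n" "i = c + 1"
  using assms by (cases "i = n + 1") (auto intro: that(2)[of "i - 1"] that(1))

lemma mono_gen:
  assumes "c < n" "x \<le> M * \<delta>" shows "gen (c + 1) + mono x \<delta> = mono (x + (a + c * d)) (Suc \<delta>)"
proof -
  have "c \<le> r" using assms(1) by (simp add: r_def)
  then have "a + c * d \<le> M * 1" by (simp add: M_def)
  then show ?thesis using mono_add[of "a + c * d" 1 x \<delta>] assms gen_in by (simp add: ac_simps)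
qed

lemma mono_gen_last:
  assumes "x \<le> M * \<delta>" shows "gen (n + 1) + mono x \<delta> = mono x (Suc \<delta>)"
  using mono_add[of 0 1 x \<delta>] assms unfolding gen_last by simp

lemma gen_S: "i \<in> V \<Longrightarrow> s \<in> S \<Longrightarrow> gen i + s \<in> S"
proof -
  assume i: "i \<in> V" and "s \<in> S"
  then obtain x \<delta> where s: "s = mono x \<delta>" "in_S x \<delta>" unfolding S_def by blast
  note le = in_S_le[OF s(2)]
  from i show ?thesis
  proof (cases rule: V_cases)
    case 1
    then show ?thesis unfolding s(1) S_def using mono_gen_last[OF le] in_S_Suc[OF s(2)] by auto
  next
    case (2 c)
    have "c \<le> r" using 2(1) by (simp add: r_def)
    from in_S_step[OF s(2) this] show ?thesis unfolding s(1) S_def 2(2) using mono_gen[OF 2(1) le] by blast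
  qed
qed

lemma zero_S: "0 \<in> S"
  unfolding S_def using in_S_0 by (intro CollectI exI[of _ 0]) (simp add: mono_def)

lemma param: "i \<in> V \<Longrightarrow> curve_param n m i = single (gen i) (1::'k::field)"
proof -
  assume i: "i \<in> V"
  have "Var 1 ^ x * Var 2 ^ (M * 1 - x) = single (mono x 1) (1::'k)" for x
    by (simp add: Var_power mult_single mono_def)
  from this[of 0] this[of "m i"] show ?thesis by (simp add: curve_param_def gen_def m_n)
qed

definition A :: "('k::field) mpoly set" where "A = poly_subst (curve_param n m) ` polys V"

lemma A_closed:
  "f \<in> A \<Longrightarrow> g \<in> A \<Longrightarrow> f + g \<in> A" "f \<in> A \<Longrightarrow> g \<in> A \<Longrightarrow> f * g \<in> A" "Const c \<in> A" "i \<in> V \<Longrightarrow> curve_param n m i \<in> A"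
proof -
  show "f + g \<in> A" if "f \<in> A" "g \<in> A"
    using that unfolding A_def by (auto simp: poly_subst_add[symmetric])
  show "f * g \<in> A" if "f \<in> A" "g \<in> A"
    using that unfolding A_def by (auto simp: poly_subst_mult[symmetric])
  show "Const c \<in> A" unfolding A_def by (rule image_eqI[of _ _ "Const c"]) auto
  show "curve_param n m i \<in> A" if "i \<in> V" unfolding A_def using that by (intro image_eqI[of _ _ "Var i"]) auto
qed

text \<open>Monomials are sent to monomials with exponent in \<open>S\<close>, because
  \<open>S\<close> contains 0 and is closed under adding generators. Conversely, an exponent in
  \<open>S\<close> is reached by splitting off one generator per degree.\<close>

lemma A_eq: "A = (kspan S :: ('k::field) mpoly set)"
proof
  show "A \<subseteq> (kspan S :: 'k mpoly set)"
  proof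
    fix h :: "'k mpoly" assume "h \<in> A"
    then obtain f where f: "f \<in> polys V" "h = poly_subst (curve_param n m) f" unfolding A_def by blast
    have mon: "\<exists>s\<in>S. (\<Prod>i\<in>B. curve_param n m i ^ e i) = single s (1::'k)" if "finite B" "B \<subseteq> V" for B e
      using that
    proof (induction B rule: finite_induct)
      case empty
      show ?case using zero_S by (intro bexI[of _ 0]) simp_all
    next
      case (insert i B)
      then obtain s where s: "s \<in> S" "(\<Prod>i\<in>B. curve_param n m i ^ e i) = single s (1::'k)" by auto
      have "\<exists>s\<in>S. curve_param n m i ^ k * (\<Prod>i\<in>B. curve_param n m i ^ e i) = single s (1::'k)" for k
      proof (induction k)
        case 0 then show ?case using s by auto
      next
        case (Suc k)
        then obtain s where "s \<in> S" "curve_param n m i ^ k * (\<Prod>i\<in>B. curve_param n m i ^ e i) = single s (1::'k)" by blast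
        then show ?case using insert.prems gen_S[of i s]
          by (intro bexI[of _ "gen i + s"]) (simp_all add: param mult_single mult.assoc)
      qed
      then show ?case using insert by simp
    qed
    show "h \<in> kspan S" unfolding f(2) poly_subst_def
    proof (rule kspan_sum)
      fix t assume "t \<in> keys f"
      then have "keys t \<subseteq> V" using f(1) by (auto simp: in_polys)
      then obtain s where "s \<in> S" "(\<Prod>i\<in>keys t. curve_param n m i ^ lookup t i) = single s (1::'k)"
        using mon[of "keys t" "lookup t"] by auto
      then show "Const (lookup f t) * (\<Prod>i\<in>keys t. curve_param n m i ^ lookup t i) \<in> kspan S"
        using kspan_closed(5)[of s S "lookup f t"] by (simp flip: single_eq_Const)
    qed
  qed
  show "(kspan S :: 'k mpoly set) \<subseteq> A"
  proof
    fix h :: "'k mpoly" assume "h \<in> kspan S"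
    then show "h \<in> A"
    proof (induction rule: kspan_induct)
      case zero
      show ?case using A_closed(3)[of 0] by simp
    next
      case (monomial t c)
      then obtain x \<delta> where t: "t = mono x \<delta>" "in_S x \<delta>" unfolding S_def by blast
      from t(2) have "single (mono x \<delta>) (1::'k) \<in> A"
      proof (induction \<delta> arbitrary: x)
        case 0
        then have "x = 0" by (auto simp: in_S_def)
        then show ?case using A_closed(3)[of 1] by (simp add: mono_def)
      next
        case (Suc \<delta>)
        then obtain j t where jt: "j \<le> Suc \<delta>" "t \<le> r * j" "x = j * a + t * d" unfolding in_S_def by blast
        show ?case
        proof (cases "j \<le> \<delta>")
          \<comment> \<open>A spare summand corresponds to a factor \<open>x_(n+1)\<close>.\<close>
          case True
          then have xs: "in_S x \<delta>" using jt in_SI by blast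
          have "single (mono x (Suc \<delta>)) (1::'k) = curve_param n m (n + 1) * single (mono x \<delta>) 1"
            using mono_gen_last[OF in_S_le[OF xs]] param[of "n + 1", where 'k='k] by (simp add: mult_single)
          then show ?thesis using A_closed(2)[OF A_closed(4)[of "n + 1"] Suc.IH[OF xs]] by simp
        next
          case False
          then have j: "j = Suc \<delta>" using jt by simp
          \<comment> \<open>The largest admissible summand: taking \<open>min t r\<close> away from
            \<open>t <= r (\<delta> + 1)\<close> leaves at most \<open>r \<delta>\<close>, as the
            remaining \<open>\<delta>\<close> summands require.\<close>
          define c where "c = min t r"
          have c: "c \<le> r" "c \<le> t" "t - c \<le> r * \<delta>" using jt(2) j by (auto simp: c_def)
          have cn: "c < n" using c(1) n2 by (simp add: r_def)
          obtain u where u: "t = c + u" using c(2) le_Suc_ex by blast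
          have xs: "in_S (\<delta> * a + u * d) \<delta>" using c(3) u by (intro in_SI) auto
          have "x = (\<delta> * a + u * d) + (a + c * d)" using jt(3) j u by (simp add: algebra_simps)
          then have "single (mono x (Suc \<delta>)) (1::'k) = curve_param n m (c + 1) * single (mono (\<delta> * a + u * d) \<delta>) 1"
            using mono_gen[OF cn in_S_le[OF xs]] param[of "c + 1", where 'k='k] cn by (simp add: mult_single)
          then show ?thesis using A_closed(2)[OF A_closed(4)[of "c + 1"] Suc.IH[OF xs]] cn by simp
        qed
      qed
      then show ?case using A_closed(2)[OF A_closed(3)[of c]] t(1) single_eq_Const[of t c] by simp
    next
      case (add f g)
      then show ?case by (rule A_closed)
    qed
  qed
qed

text \<open>\<open>T1\<close> and \<open>T2\<close> are the exponents that occur in \<open>x\<^sub>n\<^sub>+\<^sub>1 A\<close> and in \<open>x\<^sub>n\<^sub>+\<^sub>1 A + x\<^sub>n A\<close>.\<close>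

definition T1 where "T1 = (+) (gen (n + 1)) ` S"
definition T2 where "T2 = T1 \<union> (+) (gen n) ` S"

lemma T1_mono: "in_S x \<delta> \<Longrightarrow> mono x \<delta> \<in> T1 \<longleftrightarrow> (\<exists>\<delta>'. \<delta> = Suc \<delta>' \<and> in_S x \<delta>')"
proof
  assume x: "in_S x \<delta>" and "mono x \<delta> \<in> T1"
  then obtain y \<epsilon> where y: "in_S y \<epsilon>" "mono x \<delta> = gen (n + 1) + mono y \<epsilon>" unfolding T1_def S_def by blast
  then have "mono x \<delta> = mono y (Suc \<epsilon>)" using mono_gen_last[OF in_S_le] by simp
  then have "x = y \<and> \<delta> = Suc \<epsilon>" using in_S_le[OF x] in_S_le[OF in_S_Suc[OF y(1)]] by (intro mono_inj)
  then show "\<exists>\<delta>'. \<delta> = Suc \<delta>' \<and> in_S x \<delta>'" using y(1) by blast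
next
  assume "\<exists>\<delta>'. \<delta> = Suc \<delta>' \<and> in_S x \<delta>'"
  then obtain \<delta>' where "\<delta> = Suc \<delta>'" "in_S x \<delta>'" by blast
  then have "mono x \<delta> = gen (n + 1) + mono x \<delta>'" "mono x \<delta>' \<in> S"
    using mono_gen_last[OF in_S_le, of x \<delta>'] by (auto simp: S_def)
  then show "mono x \<delta> \<in> T1" unfolding T1_def by (rule image_eqI)
qed

lemma mono_gen_n: "x \<le> M * \<delta> \<Longrightarrow> gen n + mono x \<delta> = mono (x + M) (Suc \<delta>)"
  using mono_gen[of "n - 1" x \<delta>] n2 by (simp add: M_def r_def)

lemma in_S_M: "in_S x \<delta> \<Longrightarrow> in_S (x + M) (Suc \<delta>)"
  using in_S_step[of x \<delta> r] by (simp add: M_def)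

lemma T2_mono:
  "in_S x \<delta> \<Longrightarrow> mono x \<delta> \<in> T2 \<longleftrightarrow> (\<exists>\<delta>'. \<delta> = Suc \<delta>' \<and> (in_S x \<delta>' \<or> (\<exists>y. x = y + M \<and> in_S y \<delta>')))"
proof -
  assume x: "in_S x \<delta>"
  have "mono x \<delta> \<in> (+) (gen n) ` S \<longleftrightarrow> (\<exists>\<delta>' y. \<delta> = Suc \<delta>' \<and> x = y + M \<and> in_S y \<delta>')"
  proof
    assume "mono x \<delta> \<in> (+) (gen n) ` S"
    then obtain y \<epsilon> where y: "in_S y \<epsilon>" "mono x \<delta> = gen n + mono y \<epsilon>" unfolding S_def by blast
    then have "mono x \<delta> = mono (y + M) (Suc \<epsilon>)" using mono_gen_n[OF in_S_le] by simp
    then have "x = y + M \<and> \<delta> = Suc \<epsilon>" using in_S_le[OF x] in_S_le[OF in_S_M[OF y(1)]] by (intro mono_inj)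
    then show "\<exists>\<delta>' y. \<delta> = Suc \<delta>' \<and> x = y + M \<and> in_S y \<delta>'" using y(1) by blast
  next
    assume "\<exists>\<delta>' y. \<delta> = Suc \<delta>' \<and> x = y + M \<and> in_S y \<delta>'"
    then obtain \<delta>' y where "\<delta> = Suc \<delta>'" "x = y + M" "in_S y \<delta>'" by blast
    then have "mono x \<delta> = gen n + mono y \<delta>'" "mono y \<delta>' \<in> S"
      using mono_gen_n[OF in_S_le, of y \<delta>'] by (auto simp: S_def)
    then show "mono x \<delta> \<in> (+) (gen n) ` S" by (rule image_eqI)
  qed
  then show ?thesis unfolding T2_def using T1_mono[OF x] by blast
qed

lemma apery_mono: "S - T2 = {mono (j * a + t * d) j | j t. apery j t}"
proof -
  have "mono x \<delta> \<in> S - T2 \<longleftrightarrow> (\<exists>t. apery \<delta> t \<and> x = \<delta> * a + t * d)" if "in_S x \<delta>" for x \<delta>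
    using apery_iff[of x \<delta>] T2_mono[OF that] that unfolding S_def by blast
  moreover have "in_S (j * a + t * d) j" if "apery j t" for j t
    using apery_iff[of "j * a + t * d" j] that by blast
  ultimately show ?thesis unfolding S_def by blast
qed

lemma apery_mono_iff:
  assumes "t \<le> r * j" shows "mono (j * a + t * d) j \<in> T2 \<longleftrightarrow> \<not> apery j t"
proof -
  have x: "in_S (j * a + t * d) j" using assms by (intro in_SI) auto
  have "(\<exists>t'. apery j t' \<and> j * a + t * d = j * a + t' * d) \<longleftrightarrow> apery j t" using dpos by auto
  then show ?thesis using apery_iff[of "j * a + t * d" j] T2_mono[OF x] x by blast
qed

lemma gen_shift: "i \<in> V \<Longrightarrow> t \<in> (+) g ` S \<Longrightarrow> gen i + t \<in> (+) g ` S"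
proof -
  assume i: "i \<in> V" and "t \<in> (+) g ` S"
  then obtain s where "s \<in> S" "t = g + s" by blast
  then have "gen i + t = g + (gen i + s)" "gen i + s \<in> S" using gen_S[OF i] by (simp_all only: add.left_commute)
  then show ?thesis by (rule image_eqI)
qed

lemma gen_T1: "i \<in> V \<Longrightarrow> t \<in> T1 \<Longrightarrow> gen i + t \<in> T1"
  unfolding T1_def by (rule gen_shift)

lemma gen_T2: "i \<in> V \<Longrightarrow> t \<in> T2 \<Longrightarrow> gen i + t \<in> T2"
  unfolding T2_def using gen_T1 gen_shift by blast

lemma T2_S: "T2 \<subseteq> S"
  unfolding T2_def T1_def using gen_S[of "n + 1"] gen_S[of n] n2 by auto

lemma T1_S: "T1 \<subseteq> S"
  using T2_S unfolding T2_def by blast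

text \<open>Carries \<open>in_S_depth\<close> over to exponents; both \<open>koszul_reduce\<close>
  and the regular sequence in the quotient ring rest on it.\<close>

lemma depth_T1: "s \<in> S \<Longrightarrow> gen n + s \<in> T1 \<Longrightarrow> s \<in> T1"
proof -
  assume "s \<in> S" and t: "gen n + s \<in> T1"
  then obtain x \<delta> where s: "s = mono x \<delta>" "in_S x \<delta>" unfolding S_def by blast
  have "mono (x + M) (Suc \<delta>) \<in> T1" using t unfolding s(1) using mono_gen_n[OF in_S_le[OF s(2)]] by simp
  then have "in_S (x + M) \<delta>" using T1_mono[OF in_S_M[OF s(2)]] by simp
  then show ?thesis using in_S_depth[OF s(2)] T1_mono[OF s(2)] s(1) by simp
qed

text \<open>Modulo \<open>T2\<close>, these exponents form the socle of the Artinian reduction.\<close>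

definition soc where "soc = {s \<in> S. \<forall>i\<in>{1..<n}. gen i + s \<in> T2}"

lemma soc_socle: "soc - T2 = {mono (j * a + t * d) j | j t. socle j t}"
proof -
  have "mono (j * a + t * d) j \<in> soc - T2 \<longleftrightarrow> socle j t" if ap: "apery j t" for j t
  proof -
    have tj: "t \<le> r * j" using ap unfolding apery_def by (cases j) (auto intro: order.trans[of _ r])
    then have x: "in_S (j * a + t * d) j" by (intro in_SI) auto
    have g: "gen (c + 1) + mono (j * a + t * d) j \<in> T2 \<longleftrightarrow> \<not> apery (Suc j) (t + c)" if "c < r" for c
    proof -
      have "gen (c + 1) + mono (j * a + t * d) j = mono (Suc j * a + (t + c) * d) (Suc j)"
        using mono_gen[OF _ in_S_le[OF x], of c] that by (simp add: r_def algebra_simps)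
      moreover have "t + c \<le> r * Suc j" using tj that by simp
      ultimately show ?thesis using apery_mono_iff[of "t + c" "Suc j"] by simp
    qed
    have "(\<forall>i\<in>{1..<n}. gen i + mono (j * a + t * d) j \<in> T2) \<longleftrightarrow> (\<forall>c<r. gen (c + 1) + mono (j * a + t * d) j \<in> T2)"
    proof (intro iffI allI impI ballI)
      fix c assume "\<forall>i\<in>{1..<n}. gen i + mono (j * a + t * d) j \<in> T2" "c < r"
      then show "gen (c + 1) + mono (j * a + t * d) j \<in> T2" by (simp add: r_def)
    next
      fix i assume *: "\<forall>c<r. gen (c + 1) + mono (j * a + t * d) j \<in> T2" and "i \<in> {1..<n}"
      then have "i - 1 < r" "i - 1 + 1 = i" by (auto simp: r_def)
      with * show "gen i + mono (j * a + t * d) j \<in> T2" by metis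
    qed
    then show ?thesis unfolding soc_def socle_def using g ap x apery_mono by (auto simp: S_def)
  qed
  moreover have "soc - T2 \<subseteq> S - T2" unfolding soc_def by blast
  moreover have "socle j t \<Longrightarrow> apery j t" for j t unfolding socle_def by blast
  ultimately show ?thesis unfolding apery_mono by blast
qed

lemma socle_mono_inj:
  assumes "socle j t" "socle j' t'" "mono (j * a + t * d) j = mono (j' * a + t' * d) j'" shows "j = j' \<and> t = t'"
proof -
  have "in_S (j * a + t * d) j" if "apery j t" for j t
    using apery_iff[of "j * a + t * d" j] that by blast
  then have "j * a + t * d = j' * a + t' * d \<and> j = j'"
    using assms by (intro mono_inj in_S_le) (auto simp: socle_def)
  then show ?thesis using dpos by auto
qed

lemma soc_unique: "(\<exists>!s. s \<in> soc - T2) \<longleftrightarrow> [m 1 = 2] (mod (n - 1))"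
proof -
  have "(\<exists>!s. s \<in> soc - T2) \<longleftrightarrow> (\<exists>!p. case p of (j, t) \<Rightarrow> socle j t)"
  proof
    assume "\<exists>!s. s \<in> soc - T2"
    then obtain s where s: "s \<in> soc - T2" "\<And>s'. s' \<in> soc - T2 \<Longrightarrow> s' = s" by blast
    then obtain j t where jt: "socle j t" "s = mono (j * a + t * d) j" unfolding soc_socle by blast
    show "\<exists>!p. case p of (j, t) \<Rightarrow> socle j t"
    proof (rule ex1I[of _ "(j, t)"])
      fix p assume "case p of (j, t) \<Rightarrow> socle j t"
      then obtain j' t' where p: "p = (j', t')" "socle j' t'" by (cases p) auto
      then have "mono (j' * a + t' * d) j' = s" using s(2) unfolding soc_socle by blast
      then show "p = (j, t)" using socle_mono_inj[OF p(2) jt(1)] jt(2) p(1) by simp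
    qed (use jt in simp)
  next
    assume "\<exists>!p. case p of (j, t) \<Rightarrow> socle j t"
    then obtain j t where jt: "socle j t" "\<And>j' t'. socle j' t' \<Longrightarrow> j' = j \<and> t' = t"
      by (metis (no_types, lifting) case_prodE case_prodI prod.inject)
    show "\<exists>!s. s \<in> soc - T2"
    proof (rule ex1I[of _ "mono (j * a + t * d) j"])
      show "mono (j * a + t * d) j \<in> soc - T2" unfolding soc_socle using jt(1) by blast
      fix s assume "s \<in> soc - T2"
      then show "s = mono (j * a + t * d) j" unfolding soc_socle using jt(2) by blast
    qed
  qed
  then show ?thesis using socle_unique by simp
qed

end

section \<open>Reduction of Koszul homology to the Artinian quotient\<close>

context arith_curve begin

abbreviation act :: "nat \<Rightarrow> ('k::field) mpoly \<Rightarrow> 'k mpoly" where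
  "act \<equiv> (\<lambda>i f. curve_param n m i * f)"

text \<open>The regular sequence comes first because \<open>koszul_regular\<close> removes the head
  of the list.\<close>

abbreviation "vars \<equiv> (n + 1) # n # [1..<n]"

lemma vars: "distinct vars" "set vars = V"
  using n2 by auto

lemma submods:
  "ops.submod pscale act V (kspan S)" "ops.submod pscale act V (kspan T1)"
  "ops.submod pscale act V (kspan T2)" "ops.submod pscale act V {0}"
  by (rule kspan_submod[OF gen_S param] kspan_submod[OF gen_T1 param] kspan_submod[OF gen_T2 param]
      ops.submod_zero[OF ops_p]; assumption)+

text \<open>Two uses of \<open>koszul_regular\<close>. The first nonzerodivisor condition holds
  because polynomials form a domain, the second is \<open>depth_T1\<close> applied to each
  exponent.\<close>

lemma koszul_reduce:
  "quot_iso (fscale pscale) (kcyc act vars q A {0}) (kbnd act vars q A {0})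
    (fscale pscale) (kcyc act [1..<n] q A (kspan T2)) (kbnd act [1..<n] q A (kspan T2 :: ('k::field) mpoly set))"
proof -
  interpret ops pscale "act :: nat \<Rightarrow> 'k mpoly \<Rightarrow> 'k mpoly" V by (rule ops_p)
  have V: "n + 1 \<in> V" "n \<in> V" "set (n # [1..<n]) \<subseteq> V" "set [1..<n] \<subseteq> V" using n2 by auto
  have N1: "{y + act (n + 1) x | y x. y \<in> {0} \<and> x \<in> kspan S} = (kspan T1 :: 'k mpoly set)"
    using kspan_step[of "gen (n + 1)" "{}" S, where 'k='k] V(1) unfolding kspan_empty T1_def by (simp add: param)
  have N2: "{y + act n x | y x. y \<in> kspan T1 \<and> x \<in> kspan S} = (kspan T2 :: 'k mpoly set)"
    using kspan_step[of "gen n" T1 S, where 'k='k] V(2) unfolding T2_def by (simp add: param)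
  have "quot_iso (fscale pscale) (kcyc act vars q (kspan S) {0}) (kbnd act vars q (kspan S) {0})
    (fscale pscale) (kcyc act (n # [1..<n]) q (kspan S) (kspan T1)) (kbnd act (n # [1..<n]) q (kspan S) (kspan T1 :: 'k mpoly set))"
    unfolding N1[symmetric]
  proof (rule koszul_regular[OF submods(1) submods(4) _ V(1) V(3)])
    show "x \<in> {0}" if "act (n + 1) x \<in> {0}" for x :: "'k mpoly"
    proof -
      have "single (gen (n + 1)) (1::'k) \<noteq> 0" by (metis lookup_single_eq lookup_zero zero_neq_one)
      then show ?thesis using that V(1) by (simp add: param)
    qed
  qed (simp add: kspan_closed)
  moreover have "quot_iso (fscale pscale) (kcyc act (n # [1..<n]) q (kspan S) (kspan T1)) (kbnd act (n # [1..<n]) q (kspan S) (kspan T1))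
    (fscale pscale) (kcyc act [1..<n] q (kspan S) (kspan T2)) (kbnd act [1..<n] q (kspan S) (kspan T2 :: 'k mpoly set))"
    unfolding N2[symmetric]
  proof (rule koszul_regular[OF submods(1) submods(2) _ V(2) V(4)])
    show "kspan T1 \<subseteq> (kspan S :: 'k mpoly set)" using T1_S by (auto simp: kspan_def)
    show "x \<in> kspan T1" if x: "x \<in> kspan S" "act n x \<in> kspan T1" for x :: "'k mpoly"
      unfolding kspan_def
    proof (intro CollectI subsetI)
      fix s assume s: "s \<in> keys x"
      have "keys (act n x) = (+) (gen n) ` keys x" using V(2) by (simp add: param keys_single_times)
      then have "gen n + s \<in> T1" using x(2) s unfolding kspan_def by blast
      then show "s \<in> T1" using x(1) s depth_T1 unfolding kspan_def by blast
    qed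
  qed
  ultimately show ?thesis unfolding A_eq by (rule quot_iso_trans)
qed

text \<open>After the reduction a chain counts modulo \<open>T2\<close>, so it is determined by its
  coefficients at the finitely many pairs of a basis list and an exponent in \<open>S - T2\<close>.
  These are the functionals for \<open>quot_fin_coords\<close>.\<close>

lemma koszul_fin:
  "quot_fin (fscale pscale) (kcyc act vars q A {0}) (kbnd act vars q A ({0} :: ('k::field) mpoly set))"
proof (rule quot_iso_fin[OF quot_iso_sym[OF koszul_reduce]])
  interpret ops pscale "act :: nat \<Rightarrow> 'k mpoly \<Rightarrow> 'k mpoly" V by (rule ops_p)
  let ?l = "[1..<n]"
  have l: "set ?l \<subseteq> V" by auto
  define I where "I = {bl :: bool list. length bl = length ?l} \<times> (S - T2)"
  have "finite (S - T2)"
  proof -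
    have "S - T2 = (\<lambda>(j, t). mono (j * a + t * d) j) ` {(j, t). apery j t}" unfolding apery_mono by auto
    then show ?thesis using apery_finite by simp
  qed
  moreover have "finite {bl :: bool list. length bl = length ?l}"
    using finite_lists_length_eq[of "UNIV :: bool set" "length ?l"] by simp
  ultimately have "finite I" unfolding I_def by blast
  show "quot_fin (fscale pscale) (kcyc act ?l q A (kspan T2)) (kbnd act ?l q A (kspan T2 :: 'k mpoly set))"
    unfolding A_eq
  proof (rule quot_fin_coords[OF \<open>finite I\<close>, where \<kappa>="\<lambda>(bl, s) f. lookup (f bl) s"])
    show "x + y \<in> kcyc act ?l q (kspan S) (kspan T2)" if "x \<in> kcyc act ?l q (kspan S) (kspan T2)" "y \<in> kcyc act ?l q (kspan S) (kspan T2)"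
      for x y :: "bool list \<Rightarrow> 'k mpoly"
      using kcyc_add[OF submods(1,3)] that .
    show "fscale pscale c x \<in> kcyc act ?l q (kspan S) (kspan T2)" if "x \<in> kcyc act ?l q (kspan S) (kspan T2)"
      for c and x :: "bool list \<Rightarrow> 'k mpoly"
      using kcyc_scale[OF submods(1,3)] that .
    show "(case i of (bl, s) \<Rightarrow> \<lambda>f. lookup (f bl) s) (x + y) = (case i of (bl, s) \<Rightarrow> \<lambda>f. lookup (f bl) s) x + (case i of (bl, s) \<Rightarrow> \<lambda>f. lookup (f bl) s) y"
      for i and x y :: "bool list \<Rightarrow> 'k mpoly" by (cases i) (simp add: lookup_add)
    show "(case i of (bl, s) \<Rightarrow> \<lambda>f. lookup (f bl) s) (fscale pscale c x) = c * (case i of (bl, s) \<Rightarrow> \<lambda>f. lookup (f bl) s) x"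
      for i c and x :: "bool list \<Rightarrow> 'k mpoly" by (cases i) (simp add: pscale_def)
  next
    fix z :: "bool list \<Rightarrow> 'k mpoly"
    assume z: "z \<in> kcyc act ?l q (kspan S) (kspan T2)" and 0: "\<forall>i\<in>I. (case i of (bl, s) \<Rightarrow> \<lambda>f. lookup (f bl) s) z = 0"
    have zc: "z \<in> kchains (length ?l) q (kspan S)" using z unfolding kcyc_def by blast
    have "z \<in> kchains (length ?l) q (kspan T2)"
    proof (rule kchainsI)
      fix bl :: "bool list" assume bl: "length bl = length ?l" "int (count_list bl True) = q"
      have zs: "keys (z bl) \<subseteq> S" using kchains_on[OF zc bl] by (simp add: kspan_def)
      have "s \<in> T2" if "s \<in> keys (z bl)" for s
      proof (rule ccontr)
        assume "s \<notin> T2"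
        then have "(bl, s) \<in> I" using that zs bl unfolding I_def by auto
        then have "lookup (z bl) s = 0" using 0 by fastforce
        then show False using that by (simp add: in_keys_iff)
      qed
      then show "z bl \<in> kspan T2" unfolding kspan_def by blast
    qed (rule kchains_off[OF zc])
    then have "z - kd act ?l 0 \<in> kchains (length ?l) q (kspan T2)" by simp
    then show "z \<in> kbnd act ?l q (kspan S) (kspan T2)"
      unfolding kbnd_def using zc kchains_zero[OF kspan_closed(1)] by blast
  qed
qed

text \<open>Only \<open>n - 1 = r\<close> operators remain after the reduction, so there are no
  chains above degree \<open>r\<close>.\<close>

lemma koszul_vanish:
  assumes "q > int r" shows "kcyc act vars q A {0} \<subseteq> kbnd act vars q A ({0} :: ('k::field) mpoly set)"
proof -
  interpret ops pscale "act :: nat \<Rightarrow> 'k mpoly \<Rightarrow> 'k mpoly" V by (rule ops_p)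
  have "kcyc act [1..<n] q A (kspan T2) \<subseteq> kbnd act [1..<n] q A (kspan T2 :: 'k mpoly set)"
  proof
    fix f :: "bool list \<Rightarrow> 'k mpoly" assume "f \<in> kcyc act [1..<n] q A (kspan T2)"
    then have f: "f \<in> kchains (length [1..<n]) q A" unfolding kcyc_def by blast
    then have f0: "f = 0" by (rule kchains_out) (use assms in \<open>simp add: r_def\<close>)
    have "f - kd act [1..<n] 0 \<in> kchains (length [1..<n]) q (kspan T2)"
      unfolding f0 kd_zero diff_zero by (rule kchains_zero[OF kspan_closed(1)])
    then show "f \<in> kbnd act [1..<n] q A (kspan T2)"
      unfolding kbnd_def A_eq using f[unfolded A_eq] kchains_zero[OF kspan_closed(1)] by blast
  qed
  then show ?thesis using quot_iso_zero[OF koszul_reduce[of q, where 'k='k]] by blast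
qed

lemma koszul_top_socle:
  "quot_iso pscale (kspan soc) (kspan T2 :: ('k::field) mpoly set)
    (fscale pscale) (kcyc act vars (int r) A {0}) (kbnd act vars (int r) A {0})"
proof -
  interpret ops pscale "act :: nat \<Rightarrow> 'k mpoly \<Rightarrow> 'k mpoly" V by (rule ops_p)
  let ?l = "[1..<n]"
  have l: "set ?l \<subseteq> V" by auto
  have e: "{x \<in> kspan S. \<forall>i\<in>set ?l. act i x \<in> kspan T2} = (kspan soc :: 'k mpoly set)"
  proof -
    have "act i x \<in> kspan T2 \<longleftrightarrow> (\<forall>s\<in>keys x. gen i + s \<in> T2)" if "i \<in> set ?l" for i and x :: "'k mpoly"
      using that l by (auto simp: kspan_def param keys_single_times)
    then show ?thesis unfolding soc_def by (auto simp: kspan_def)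
  qed
  have "quot_iso pscale {x \<in> kspan S. \<forall>i\<in>set ?l. act i x \<in> kspan T2} (kspan T2)
    (fscale pscale) (kcyc act ?l (int (length ?l)) (kspan S) (kspan T2)) (kbnd act ?l (int (length ?l)) (kspan S) (kspan T2 :: 'k mpoly set))"
    by (rule koszul_top[OF submods(1,3) _ l]) (use T2_S in \<open>auto simp: kspan_def\<close>)
  then have "quot_iso pscale (kspan soc) (kspan T2)
    (fscale pscale) (kcyc act ?l (int r) A (kspan T2)) (kbnd act ?l (int r) A (kspan T2 :: 'k mpoly set))"
    unfolding e A_eq by (simp add: r_def)
  then show ?thesis using quot_iso_sym[OF koszul_reduce] by (rule quot_iso_trans)
qed

lemma T2_soc: "T2 \<subseteq> soc"
  unfolding soc_def using T2_S gen_T2 by auto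

lemma soc_nonempty: "soc - T2 \<noteq> {}"
  unfolding soc_socle using socle_nonempty by blast

lemma koszul_line:
  "quot_line (fscale pscale) (kcyc act vars (int r) A {0}) (kbnd act vars (int r) A ({0} :: ('k::field) mpoly set))
    \<longleftrightarrow> [m 1 = 2] (mod (n - 1))"
  using quot_iso_line[OF koszul_top_socle[where 'k='k]] kspan_quot_line[OF T2_soc, where 'k='k] soc_unique by blast

lemma koszul_nonzero:
  "\<not> kcyc act vars (int r) A {0} \<subseteq> kbnd act vars (int r) A ({0} :: ('k::field) mpoly set)"
proof -
  obtain s where s: "s \<in> soc" "s \<notin> T2" using soc_nonempty by blast
  then have "single s (1::'k) \<in> kspan soc" "single s (1::'k) \<notin> kspan T2" by (auto simp: kspan_def)
  then have "\<not> kspan soc \<subseteq> (kspan T2 :: 'k mpoly set)" by blast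
  then show ?thesis using quot_iso_zero[OF koszul_top_socle[where 'k='k]] by blast
qed

lemma gen_degree: "i \<in> V \<Longrightarrow> monom_degree (gen i) = M"
proof -
  have "monom_degree (mono x 1) = M" if "x \<le> M" for x
    using that by (simp add: mono_def monom_degree_add)
  moreover have "m i \<le> M" if i: "i \<in> V" "i \<noteq> n + 1"
  proof -
    have "i - 1 \<le> r" "m i = a + (i - 1) * d" using i m_eq[of i] by (auto simp: r_def)
    then show ?thesis by (simp add: M_def)
  qed
  ultimately show "i \<in> V \<Longrightarrow> monom_degree (gen i) = M" by (simp add: gen_def)
qed

lemma curve_ideal_eq: "curve_ideal n m = {f \<in> polys V. poly_subst (curve_param n m) f = 0}"
  by (simp add: curve_ideal_def a_kernel_def kernel_def)

text \<open>Every variable is sent to a monomial of degree \<open>M\<close>, so the substitution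
  multiplies degrees by \<open>M\<close>. This makes the vanishing ideal homogeneous, as
  \<open>minimal_resolution_exists\<close> requires.\<close>

lemma subst_hcomp:
  fixes f :: "('k::field) mpoly"
  assumes "f \<in> polys V"
  shows "hcomp (int M * e) (poly_subst (curve_param n m) f) = poly_subst (curve_param n m) (hcomp e f)"
proof -
  have mon: "(subst_mon (curve_param n m) t :: 'k mpoly) \<in> homog_part UNIV (int M * int (monom_degree t))" if "keys t \<subseteq> V" for t
  proof -
    have pw: "(curve_param n m i :: 'k mpoly) ^ k \<in> homog_part UNIV (int M * int k)" if "i \<in> V" for i k
    proof (induction k)
      case 0
      show ?case using Const_homog[of 1 UNIV] by simp
    next
      case (Suc k)
      have "(curve_param n m i :: 'k mpoly) \<in> homog_part UNIV (int M)"
        using gen_degree[OF that] by (auto simp: homog_part_def in_polys param[OF that])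
      from homog_part_mult[OF this Suc] show ?case by (simp add: algebra_simps)
    qed
    have "(\<Prod>i\<in>B. (curve_param n m i :: 'k mpoly) ^ lookup t i) \<in> homog_part UNIV (int M * int (\<Sum>i\<in>B. lookup t i))" if "B \<subseteq> V" for B
      using that
    proof (induction B rule: infinite_finite_induct)
      case (insert i B)
      then have "(curve_param n m i :: 'k mpoly) ^ lookup t i * (\<Prod>i\<in>B. (curve_param n m i :: 'k mpoly) ^ lookup t i)
        \<in> homog_part UNIV (int M * int (lookup t i) + int M * int (\<Sum>i\<in>B. lookup t i))"
        by (intro homog_part_mult pw) auto
      then show ?case using insert by (simp add: algebra_simps)
    qed (use Const_homog[of 1 UNIV] in simp_all)
    from this[OF that] show ?thesis by (simp add: subst_mon_def monom_degree_def)
  qed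
  have "hcomp (int M * e) (poly_subst (curve_param n m) (single t (lookup f t))) = poly_subst (curve_param n m) (hcomp e (single t (lookup f t)))"
    if t: "t \<in> keys f" for t
  proof -
    have "keys t \<subseteq> V" using assms t by (auto simp: in_polys)
    then have "hcomp (int M * e) (subst_mon (curve_param n m) t) = (if e = int (monom_degree t) then subst_mon (curve_param n m) t else (0 :: 'k mpoly))"
      using hcomp_homog[OF mon, of t "int M * e"] M_pos by auto
    moreover have "hcomp (int M * e) (Const (lookup f t) * subst_mon (curve_param n m) t) = Const (lookup f t) * hcomp (int M * e) (subst_mon (curve_param n m) t)"
      using hcomp_homog_times[OF Const_homog[of "lookup f t" UNIV]] by simp
    moreover have "hcomp e (single t (lookup f t)) = (if e = int (monom_degree t) then single t (lookup f t) else 0)"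
      by (rule poly_mapping_eqI) (simp add: lookup_hcomp lookup_single when_def)
    ultimately show ?thesis by (simp add: poly_subst_single)
  qed
  then have "hcomp (int M * e) (poly_subst (curve_param n m) (\<Sum>t\<in>keys f. single t (lookup f t))) =
    poly_subst (curve_param n m) (hcomp e (\<Sum>t\<in>keys f. single t (lookup f t)))"
    by (simp add: poly_subst_sum hcomp_sum)
  then show ?thesis by (simp flip: mpoly_expand)
qed

text \<open>In every minimal resolution \<open>F r\<close> is nonzero and all later modules vanish,
  so \<open>p\<close> can only be \<open>r\<close>. One direction applies this to the given
  resolution, the other to the one from \<open>minimal_resolution_exists\<close>.\<close>

theorem last_rank_one_iff:
  "(\<exists>F dd \<epsilon> p. minimal_graded_free_resolution V (curve_ideal n m :: ('k::field) mpoly set) F dd \<epsilon> \<and>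
      length (F p) = 1 \<and> (\<forall>k>p. length (F k) = 0)) \<longleftrightarrow> [m 1 = 2] (mod (n - 1))"
proof -
  let ?J = "curve_ideal n m :: 'k mpoly set"
  let ?H = "\<lambda>p::nat. kcyc act vars (int p) A ({0} :: 'k mpoly set)" and ?B = "\<lambda>p::nat. kbnd act vars (int p) A ({0} :: 'k mpoly set)"
  have zero: "length (F p) = 0 \<longleftrightarrow> ?H p \<subseteq> ?B p" and line: "length (F p) = 1 \<longleftrightarrow> quot_line (fscale pscale) (?H p) (?B p)"
    if res: "minimal_graded_free_resolution V ?J F dd \<epsilon>" and p: "p \<ge> 1" for F dd \<epsilon> p
  proof -
    note iso = resolution_koszul[OF vars res[unfolded curve_ideal_eq] p, folded A_def]
    show "length (F p) = 0 \<longleftrightarrow> ?H p \<subseteq> ?B p"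
      using quot_iso_zero[OF iso] free_quot_zero[of V "F p", where 'a='k] by blast
    show "length (F p) = 1 \<longleftrightarrow> quot_line (fscale pscale) (?H p) (?B p)"
      using quot_iso_line[OF iso] free_quot_line[of V "F p", where 'k='k] by blast
  qed
  have van: "length (F k) = 0" if "minimal_graded_free_resolution V ?J F dd \<epsilon>" "k > r" for F dd \<epsilon> k
    using zero[OF that(1), of k] koszul_vanish[of "int k", where 'k='k] that(2) by simp
  show ?thesis
  proof
    assume "\<exists>F dd \<epsilon> p. minimal_graded_free_resolution V ?J F dd \<epsilon> \<and> length (F p) = 1 \<and> (\<forall>k>p. length (F k) = 0)"
    then obtain F dd \<epsilon> p where h: "minimal_graded_free_resolution V ?J F dd \<epsilon>" "length (F p) = 1" "\<And>k. k > p \<Longrightarrow> length (F k) = 0"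
      by blast
    have "\<not> p > r" using van[OF h(1), of p] h(2) by auto
    moreover have "length (F r) \<noteq> 0" using zero[OF h(1) r_pos] koszul_nonzero[where 'k='k] by blast
    then have "\<not> p < r" using h(3)[of r] by blast
    ultimately have "p = r" by simp
    then show "[m 1 = 2] (mod (n - 1))" using line[OF h(1) r_pos] h(2) koszul_line[where 'k='k] by blast
  next
    assume c: "[m 1 = 2] (mod (n - 1))"
    have "\<exists>F dd \<epsilon>. minimal_graded_free_resolution V ?J F dd \<epsilon>"
      unfolding curve_ideal_eq
    proof (rule minimal_resolution_exists[OF vars])
      fix e and f :: "'k mpoly" assume f: "f \<in> {f \<in> polys V. poly_subst (curve_param n m) f = 0}"
      then show "hcomp e f \<in> {f \<in> polys V. poly_subst (curve_param n m) f = 0}"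
        using subst_hcomp[of f e] hcomp_polys[of f V e] by simp
    next
      fix q :: int
      show "quot_fin (fscale pscale) (kcyc act vars q (poly_subst (curve_param n m) ` polys V) {0})
        (kbnd act vars q (poly_subst (curve_param n m) ` polys V) ({0} :: 'k mpoly set))"
        using koszul_fin[of q, where 'k='k] unfolding A_def .
    qed
    then obtain F dd \<epsilon> where res: "minimal_graded_free_resolution V ?J F dd \<epsilon>" by blast
    have "length (F r) = 1" using line[OF res r_pos] c koszul_line[where 'k='k] by blast
    then show "\<exists>F dd \<epsilon> p. minimal_graded_free_resolution V ?J F dd \<epsilon> \<and> length (F p) = 1 \<and> (\<forall>k>p. length (F k) = 0)"
      using res van[OF res] by blast
  qed
qed

end

section \<open>Cohen--Macaulayness\<close>

definition indep_mod :: "('k::field) mpoly set \<Rightarrow> 's set \<Rightarrow> ('s \<Rightarrow> 'k mpoly) \<Rightarrow> bool" where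
  "indep_mod P S g \<longleftrightarrow> (\<forall>c. (\<Sum>s\<in>S. Const (c s) * g s) \<in> P \<longrightarrow> (\<forall>s\<in>S. c s = 0))"

definition ideal_set :: "nat set \<Rightarrow> ('k::field) mpoly set \<Rightarrow> bool" where
  "ideal_set V P \<longleftrightarrow> (\<forall>f\<in>P. \<forall>g\<in>P. f - g \<in> P) \<and> (\<forall>f\<in>P. \<forall>g\<in>polys V. g * f \<in> P)"

lemma ideal_setD:
  assumes "ideal_set V P"
  shows "f \<in> P \<Longrightarrow> g \<in> P \<Longrightarrow> f - g \<in> P" "f \<in> P \<Longrightarrow> g \<in> polys V \<Longrightarrow> g * f \<in> P"
  using assms by (simp_all add: ideal_set_def)

text \<open>Modulo \<open>P'\<close> a relation reduces to its terms with \<open>i = 0\<close>,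
  whose coefficients vanish by the independence of \<open>g\<close>. What remains is divisible by
  \<open>x\<close>, which can be cancelled modulo \<open>P\<close>; then induction on
  \<open>N\<close> applies.\<close>

lemma indep_mod_step:
  assumes "ideal_set V P'" "P \<subseteq> P'" "x \<in> P'" "x \<in> polys V"
    and nzd: "\<And>y. y \<in> polys V \<Longrightarrow> x * y \<in> P \<Longrightarrow> y \<in> P"
    and g: "\<And>s. s \<in> S \<Longrightarrow> g s \<in> polys V" and ind: "indep_mod P' S g"
  shows "indep_mod P ({..<N} \<times> S) (\<lambda>(i, s). x ^ i * g s)"
proof -
  have main: "\<forall>i<N. \<forall>s\<in>S. c i s = 0" if "(\<Sum>i<N. x ^ i * (\<Sum>s\<in>S. Const (c i s) * g s)) \<in> P" for c
    using that
  proof (induction N arbitrary: c)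
    case (Suc N)
    let ?G = "\<lambda>i. \<Sum>s\<in>S. Const (c i s) * g s"
    let ?y = "\<Sum>i<N. x ^ i * ?G (Suc i)"
    have y: "?y \<in> polys V" using assms(4) g by (intro polys_sum polys_closed polys_power) auto
    have e: "(\<Sum>i<Suc N. x ^ i * ?G i) = ?G 0 + x * ?y"
      by (simp add: sum.lessThan_Suc_shift sum_distrib_left mult.assoc del: sum.lessThan_Suc)
    have "?y * x \<in> P'" by (rule ideal_setD(2)[OF assms(1,3) y])
    moreover have "?G 0 + x * ?y \<in> P'" using Suc.prems unfolding e by (rule subsetD[OF assms(2)])
    ultimately have "?G 0 + x * ?y - ?y * x \<in> P'" by (intro ideal_setD(1)[OF assms(1)])
    then have "?G 0 \<in> P'" by (simp only: mult.commute[of ?y x] add_diff_cancel_right')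
    then have c0: "\<forall>s\<in>S. c 0 s = 0" using ind unfolding indep_mod_def by blast
    then have "?G 0 = 0" by simp
    then have "x * ?y \<in> P" using Suc.prems unfolding e by simp
    then have "?y \<in> P" by (rule nzd[OF y])
    then have "\<forall>i<N. \<forall>s\<in>S. c (Suc i) s = 0" by (rule Suc.IH[of "\<lambda>i. c (Suc i)"])
    then show ?case using c0 by (auto simp: less_Suc_eq_0_disj)
  qed simp
  show ?thesis unfolding indep_mod_def
  proof (intro allI impI ballI)
    fix c p assume c: "(\<Sum>p\<in>{..<N} \<times> S. Const (c p) * (case p of (i, s) \<Rightarrow> x ^ i * g s)) \<in> P" and p: "p \<in> {..<N} \<times> S"
    have "(\<Sum>p\<in>{..<N} \<times> S. Const (c p) * (case p of (i, s) \<Rightarrow> x ^ i * g s)) = (\<Sum>i<N. x ^ i * (\<Sum>s\<in>S. Const (c (i, s)) * g s))"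
      by (simp add: sum.cartesian_product' sum_distrib_left mult.left_commute)
    with c have "\<forall>i<N. \<forall>s\<in>S. c (i, s) = 0" using main[of "\<lambda>i s. c (i, s)"] by simp
    then show "c p = 0" using p by auto
  qed
qed

lemma indep_mod_one:
  assumes "ideal_set V P" "1 \<notin> P" shows "indep_mod P {()} (\<lambda>_. 1)"
  unfolding indep_mod_def
proof (intro allI impI ballI)
  fix c and s :: unit assume c: "(\<Sum>s\<in>{()}. Const (c s) * 1) \<in> P"
  show "c s = 0"
  proof (rule ccontr)
    assume nz: "c s \<noteq> 0"
    have "Const (c s) \<in> P" using c by simp
    then have "Const (inverse (c s)) * Const (c s) \<in> P" by (rule ideal_setD(2)[OF assms(1)]) simp
    then show False using assms(2) nz by (simp flip: Const_mult)
  qed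
qed

text \<open>Gaussian elimination over the monomials of \<open>B\<close>: a pivot \<open>s0\<close>
  removes the monomial \<open>b\<close> from all other \<open>h s\<close> at the cost of one
  index.\<close>

lemma linear_dependence:
  fixes h :: "'s \<Rightarrow> ('k::field) mpoly"
  assumes "finite B" "finite S" "card B < card S" "\<And>s. s \<in> S \<Longrightarrow> h s \<in> kspan B"
  shows "\<exists>c. (\<Sum>s\<in>S. Const (c s) * h s) = 0 \<and> (\<exists>s\<in>S. c s \<noteq> 0)"
  using assms
proof (induction B arbitrary: S h rule: finite_induct)
  case empty
  then obtain s where "s \<in> S" by fastforce
  moreover have "h s = 0" if "s \<in> S" for s using empty.prems(3)[OF that] by (simp add: kspan_empty)
  ultimately show ?case by (intro exI[of _ "\<lambda>_. 1"]) auto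
next
  case (insert b B)
  show ?case
  proof (cases "\<forall>s\<in>S. lookup (h s) b = 0")
    case True
    have "h s \<in> kspan B" if "s \<in> S" for s
      using insert.prems(3)[OF that] True that by (auto simp: kspan_def in_keys_iff)
    then show ?thesis using insert.IH[of S h] insert.prems(1,2) insert.hyps by simp
  next
    case False
    then obtain s0 where s0: "s0 \<in> S" "lookup (h s0) b \<noteq> 0" by blast
    define q where "q s = lookup (h s) b / lookup (h s0) b" for s
    define h' where "h' s = h s - Const (q s) * h s0" for s
    have "h' s \<in> kspan B" if "s \<in> S - {s0}" for s
    proof -
      have "lookup (h' s) b = 0" using s0(2) by (simp add: h'_def q_def lookup_minus)
      moreover have "h' s \<in> kspan (insert b B)"
        using insert.prems(3)[of s] insert.prems(3)[OF s0(1)] that kspan_closed(2)[of "h s" _ "- (Const (q s) * h s0)"]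
          kspan_closed(3,4) unfolding h'_def by fastforce
      ultimately show ?thesis by (auto simp: kspan_def in_keys_iff)
    qed
    moreover have "card B < card (S - {s0})" using insert.prems(1,2) insert.hyps s0(1) by simp
    ultimately obtain c where c: "(\<Sum>s\<in>S - {s0}. Const (c s) * h' s) = 0" "\<exists>s\<in>S - {s0}. c s \<noteq> 0"
      using insert.IH[of "S - {s0}" h'] insert.prems(1) by auto
    \<comment> \<open>The coefficient at the pivot compensates for the multiples of
      \<open>h s0\<close> that were subtracted in \<open>h'\<close>.\<close>
    define c' where "c' = c(s0 := - (\<Sum>s\<in>S - {s0}. c s * q s))"
    have "(\<Sum>s\<in>S. Const (c' s) * h s) = Const (c' s0) * h s0 + (\<Sum>s\<in>S - {s0}. Const (c s) * h s)"
      by (subst sum.remove[OF insert.prems(1) s0(1)]) (auto simp: c'_def intro!: sum.cong)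
    also have "(\<Sum>s\<in>S - {s0}. Const (c s) * h s) = (\<Sum>s\<in>S - {s0}. Const (c s) * h' s) + (\<Sum>s\<in>S - {s0}. Const (c s * q s)) * h s0"
      unfolding sum_distrib_right sum.distrib[symmetric]
      by (rule sum.cong) (simp_all add: h'_def algebra_simps Const_mult)
    also have "(\<Sum>s\<in>S - {s0}. Const (c s * q s)) = Const (\<Sum>s\<in>S - {s0}. c s * q s)"
      by (rule sum_comp_morphism[of Const, unfolded comp_def]) (simp_all add: Const_add)
    also have "Const (c' s0) * h s0 + ((\<Sum>s\<in>S - {s0}. Const (c s) * h' s) + Const (\<Sum>s\<in>S - {s0}. c s * q s) * h s0) = 0"
      using c(1) by (simp add: c'_def Const_uminus)
    finally have "(\<Sum>s\<in>S. Const (c' s) * h s) = 0" .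
    moreover have "\<exists>s\<in>S. c' s \<noteq> 0" using c(2) by (auto simp: c'_def)
    ultimately show ?thesis by blast
  qed
qed

definition box :: "nat \<Rightarrow> (nat \<Rightarrow>\<^sub>0 nat) set" where
  "box D = (\<lambda>(i, j). single 1 i + single 2 j) ` ({..D} \<times> {..D})"

lemma box_card: "finite (box D)" "card (box D) \<le> (D + 1) ^ 2"
proof -
  show "finite (box D)" by (simp add: box_def)
  have "card (box D) \<le> card ({..D} \<times> {..D})" unfolding box_def by (rule card_image_le) simp
  then show "card (box D) \<le> (D + 1) ^ 2" by (simp add: power2_eq_square)
qed

lemma kspan_box_mult:
  assumes "f \<in> kspan (box D)" "g \<in> kspan (box E)" shows "f * g \<in> kspan (box (D + E))"
  unfolding kspan_def
proof (intro CollectI subsetI)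
  fix t assume "t \<in> keys (f * g)"
  then obtain s u where t: "t = s + u" "s \<in> keys f" "u \<in> keys g" using keys_mult[of f g] by auto
  from t(2) assms(1) have "s \<in> box D" by (auto simp: kspan_def)
  then obtain i j where s: "s = single 1 i + single 2 j" "i \<le> D" "j \<le> D" by (auto simp: box_def)
  from t(3) assms(2) have "u \<in> box E" by (auto simp: kspan_def)
  then obtain i' j' where u: "u = single 1 i' + single 2 j'" "i' \<le> E" "j' \<le> E" by (auto simp: box_def)
  have "t = single 1 (i + i') + single 2 (j + j')" unfolding t(1) s(1) u(1) single_add by (simp only: ac_simps)
  then show "t \<in> box (D + E)" unfolding box_def using s u by (intro image_eqI[of _ _ "(i + i', j + j')"]) auto
qed

lemma kspan_box_one: "1 \<in> kspan (box 0)"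
  by (simp add: kspan_def box_def)

lemma kspan_box_mono: "D \<le> E \<Longrightarrow> kspan (box D) \<subseteq> kspan (box E)"
  unfolding kspan_def box_def by fastforce

lemma kspan_box_power:
  assumes "f \<in> kspan (box D)" shows "f ^ k \<in> kspan (box (k * D))"
proof (induction k)
  case (Suc k)
  show ?case using kspan_box_mult[OF assms Suc] by simp
qed (simp add: kspan_box_one)

lemma in_box:
  assumes "f \<in> polys {1, 2}" obtains D where "f \<in> kspan (box D)"
proof -
  define D where "D = (\<Sum>t\<in>keys f. lookup t 1 + lookup t 2)"
  have "t \<in> box D" if t: "t \<in> keys f" for t
  proof -
    have "lookup t 1 + lookup t 2 \<le> D" unfolding D_def using t by (intro member_le_sum) auto
    moreover have "t = single 1 (lookup t 1) + single 2 (lookup t 2)"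
    proof (rule poly_mapping_eqI)
      fix i
      have "keys t \<subseteq> {1, 2}" using assms t by (auto simp: in_polys)
      then show "lookup t i = lookup (single 1 (lookup t 1) + single 2 (lookup t 2)) i"
        by (cases "i = 1 \<or> i = 2") (auto simp: lookup_add lookup_single when_def in_keys_iff)
    qed
    ultimately show ?thesis unfolding box_def by (intro image_eqI[of _ _ "(lookup t 1, lookup t 2)"]) auto
  qed
  then show ?thesis using that unfolding kspan_def by blast
qed

text \<open>The \<open>N^3\<close> products lie in the span of at most \<open>(N D + 1)^2\<close>
  monomials, which is of smaller order in \<open>N\<close>. The nested index tuples and the final
  factor 1 are those that three uses of \<open>indep_mod_step\<close> produce from
  \<open>indep_mod_one\<close>.\<close>

lemma three_dependent:
  fixes x y z :: "('k::field) mpoly"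
  assumes "x \<in> polys {1, 2}" "y \<in> polys {1, 2}" "z \<in> polys {1, 2}"
  shows "\<exists>N. \<not> indep_mod {0} ({..<N} \<times> {..<N} \<times> {..<N} \<times> {()}) (\<lambda>(i, j, k, s). x ^ i * (y ^ j * (z ^ k * 1)))"
proof -
  obtain Dx Dy Dz where D: "x \<in> kspan (box Dx)" "y \<in> kspan (box Dy)" "z \<in> kspan (box Dz)"
    using in_box assms by metis
  define D where "D = Dx + Dy + Dz"
  \<comment> \<open>Chosen so that \<open>(N D + 1)^2 <= N^2 (D + 1)^2 < N^3\<close>.\<close>
  define N where "N = (D + 1) ^ 2 + 1"
  let ?S = "{..<N} \<times> {..<N} \<times> {..<N} \<times> {()}" and ?h = "\<lambda>(i, j, k, s::unit). x ^ i * (y ^ j * (z ^ k * 1))"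
  have "?h s \<in> kspan (box (N * D))" if "s \<in> ?S" for s
  proof -
    obtain i j k where s: "s = (i, j, k, ())" "i < N" "j < N" "k < N" using \<open>s \<in> ?S\<close> by auto
    have "x ^ i * (y ^ j * (z ^ k * 1)) \<in> kspan (box (i * Dx + (j * Dy + (k * Dz + 0))))"
      by (intro kspan_box_mult kspan_box_power kspan_box_one D)
    moreover have "i * Dx + (j * Dy + (k * Dz + 0)) \<le> N * D"
      using mult_le_mono1[OF less_imp_le[OF s(2)], of Dx] mult_le_mono1[OF less_imp_le[OF s(3)], of Dy]
        mult_le_mono1[OF less_imp_le[OF s(4)], of Dz] unfolding D_def distrib_left by linarith
    ultimately show ?thesis using kspan_box_mono s(1) by auto
  qed
  moreover have "card (box (N * D)) < card ?S"
  proof -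
    have "N * D + 1 \<le> N * (D + 1)" by (simp add: N_def)
    then have "(N * D + 1) ^ 2 \<le> (N * (D + 1)) ^ 2" by (intro power_mono) auto
    also have "\<dots> = N * N * (D + 1) ^ 2" by (simp only: power2_eq_square ac_simps)
    also have "\<dots> < N * N * N" by (simp add: N_def)
    finally show ?thesis using box_card(2)[of "N * D"] by (simp add: card_cartesian_product mult.assoc)
  qed
  ultimately have "\<exists>c. (\<Sum>s\<in>?S. Const (c s) * ?h s) = 0 \<and> (\<exists>s\<in>?S. c s \<noteq> 0)"
    by (intro linear_dependence[OF box_card(1)]) auto
  then show ?thesis unfolding indep_mod_def by blast
qed

lemma poly_subst_compose: "poly_subst \<alpha> (poly_subst \<beta> f) = poly_subst (\<lambda>i. poly_subst \<alpha> (\<beta> i)) f"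
proof (induction f rule: mpoly_induct)
  case (monomial t c)
  have "poly_subst \<alpha> (\<Prod>i\<in>B. \<beta> i ^ lookup t i) = (\<Prod>i\<in>B. poly_subst \<alpha> (\<beta> i) ^ lookup t i)" for B
    by (induction B rule: infinite_finite_induct) (simp_all add: poly_subst_mult poly_subst_power)
  then show ?case by (simp add: poly_subst_single poly_subst_mult subst_mon_def)
qed (simp_all add: poly_subst_add)

text \<open>Common to regular sequences and to chains of primes: if \<open>x i\<close> lies in the \<open>(i+1)\<close>st member of a
  chain of ideals and is a nonzerodivisor modulo the \<open>i\<close>th one, then the \<open>x i\<close> are algebraically
  independent. So the chain has length at most 2, the number of variables of the target.\<close>

lemma no_three_poly:
  assumes \<phi>: "\<And>i. i \<in> V \<Longrightarrow> \<phi> i \<in> polys {1, 2}"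
    and P: "\<And>i. i \<le> 3 \<Longrightarrow> ideal_set V (P i)" "\<And>i. i < 3 \<Longrightarrow> P i \<subseteq> P (Suc i)" "(1::'k::field mpoly) \<notin> P 3"
    and J: "\<And>f. f \<in> polys V \<Longrightarrow> poly_subst \<phi> f = 0 \<Longrightarrow> f \<in> P 0"
    and x: "\<And>i. i < 3 \<Longrightarrow> x i \<in> polys V" "\<And>i. i < 3 \<Longrightarrow> x i \<in> P (Suc i)"
    and nzd: "\<And>i y. i < 3 \<Longrightarrow> y \<in> polys V \<Longrightarrow> x i * y \<in> P i \<Longrightarrow> y \<in> P i"
  shows False
proof -
  have \<phi>x: "poly_subst \<phi> (x i) \<in> polys {1, 2}" if "i < 3" for i
    by (rule poly_subst_closed[OF \<phi> x(1)[OF that]])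
  obtain N where N: "\<not> indep_mod {0} ({..<N} \<times> {..<N} \<times> {..<N} \<times> {()})
    (\<lambda>(i, j, k, s). poly_subst \<phi> (x 0) ^ i * (poly_subst \<phi> (x 1) ^ j * (poly_subst \<phi> (x 2) ^ k * 1)))"
    using three_dependent[OF \<phi>x[of 0] \<phi>x[of 1] \<phi>x[of 2]] by auto
  let ?g1 = "\<lambda>(k, s::unit). x 2 ^ k * 1" and ?S1 = "{..<N} \<times> {()}"
  let ?g2 = "\<lambda>(j, s). x 1 ^ j * ?g1 s" and ?S2 = "{..<N} \<times> ?S1"
  let ?g3 = "\<lambda>(i, s). x 0 ^ i * ?g2 s" and ?soc = "{..<N} \<times> ?S2"
  \<comment> \<open>The family is built from the top of the chain down: 1 is independent modulo
    \<open>P 3\<close>, and each \<open>x i\<close> contributes its powers in the passage from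
    \<open>P (i + 1)\<close> to \<open>P i\<close>.\<close>
  have "indep_mod (P 3) {()} (\<lambda>_. 1)" by (rule indep_mod_one[OF P(1) P(3)]) simp
  note 0 = this
  have 1: "indep_mod (P 2) ?S1 ?g1"
    by (rule indep_mod_step[of V "P 3", OF _ _ _ _ _ _ 0])
      (use P(1)[of 3] P(2)[of 2] x[of 2] nzd[of 2] in \<open>auto simp: eval_nat_numeral\<close>)
  have 2: "indep_mod (P 1) ?S2 ?g2"
    by (rule indep_mod_step[of V "P 2", OF _ _ _ _ _ _ 1])
      (use P(1)[of 2] P(2)[of 1] x[of 1] x(1)[of 2] nzd[of 1] in \<open>auto simp: eval_nat_numeral\<close>)
  have 3: "indep_mod (P 0) ?soc ?g3"
    by (rule indep_mod_step[of V "P 1", OF _ _ _ _ _ _ 2])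
      (use P(1)[of 1] P(2)[of 0] x[of 0] x(1)[of 1] x(1)[of 2] nzd[of 0] in auto)
  \<comment> \<open>A relation between the images comes from a polynomial in the kernel, hence in
    \<open>P 0\<close>. So independence modulo \<open>P 0\<close> passes to the images, against the
    choice of \<open>N\<close>.\<close>
  have "indep_mod {0} ?soc (\<lambda>(i, j, k, s). poly_subst \<phi> (x 0) ^ i * (poly_subst \<phi> (x 1) ^ j * (poly_subst \<phi> (x 2) ^ k * 1)))"
    unfolding indep_mod_def
  proof (intro allI impI)
    fix c assume c: "(\<Sum>s\<in>?soc. Const (c s) * (case s of (i, j, k, s) \<Rightarrow>
      poly_subst \<phi> (x 0) ^ i * (poly_subst \<phi> (x 1) ^ j * (poly_subst \<phi> (x 2) ^ k * 1)))) \<in> {0}"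
    let ?f = "\<Sum>s\<in>?soc. Const (c s) * ?g3 s"
    have "poly_subst \<phi> ?f = (\<Sum>s\<in>?soc. Const (c s) * (case s of (i, j, k, s) \<Rightarrow>
      poly_subst \<phi> (x 0) ^ i * (poly_subst \<phi> (x 1) ^ j * (poly_subst \<phi> (x 2) ^ k * 1))))"
      unfolding poly_subst_sum by (rule sum.cong) (auto simp: poly_subst_mult poly_subst_power)
    then have "poly_subst \<phi> ?f = 0" using c by simp
    moreover have "?f \<in> polys V" using x(1) by (intro polys_sum) auto
    ultimately have "?f \<in> P 0" by (rule J[rotated])
    then show "\<forall>s\<in>?soc. c s = 0" using 3 unfolding indep_mod_def by blast
  qed
  then show False using N by simp
qed

section \<open>Dimension and depth of the quotient ring\<close>

locale curve_ring = arith_curve +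
  fixes K :: "'k::field itself"
begin

definition "W = {1..n+1}"

abbreviation "\<phi> \<equiv> (poly_subst (curve_param n m) :: 'k mpoly \<Rightarrow> 'k mpoly)"
abbreviation "R \<equiv> (poly_ring W :: 'k mpoly ring)"
abbreviation "J \<equiv> (curve_ideal n m :: 'k mpoly set)"
abbreviation "Q \<equiv> R Quot J"

definition coset :: "'k mpoly \<Rightarrow> 'k mpoly set" where "coset f = J +>\<^bsub>R\<^esub> f"

lemma J_iff: "f \<in> J \<longleftrightarrow> f \<in> polys W \<and> \<phi> f = 0"
  by (simp add: curve_ideal_eq[folded W_def])

lemma J_ideal: "ideal J R"
  unfolding curve_ideal_eq[folded W_def] by (rule kernel_ideal)

lemma Q_cring: "cring Q"
  by (rule ideal.quotient_is_cring[OF J_ideal cring_poly_ring])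

lemmas Q_simps = quot_simps[OF J_ideal, folded coset_def]

lemma coset_eq: "f \<in> polys W \<Longrightarrow> g \<in> polys W \<Longrightarrow> coset f = coset g \<longleftrightarrow> \<phi> f = \<phi> g"
  unfolding coset_def by (simp add: coset_eq_iff[OF J_ideal] J_iff poly_subst_diff)

lemma coset_in: "f \<in> polys W \<Longrightarrow> coset f \<in> carrier Q"
  by (simp add: Q_simps)

lemma Q_rep: "y \<in> carrier Q \<Longrightarrow> \<exists>f. f \<in> polys W \<and> y = coset f"
  unfolding Q_simps by blast

lemma coset_uminus: "f \<in> polys W \<Longrightarrow> \<ominus>\<^bsub>Q\<^esub> coset f = coset (- f)"
proof -
  interpret Q: cring Q by (rule Q_cring)
  assume f: "f \<in> polys W"
  then have "coset (- f) \<oplus>\<^bsub>Q\<^esub> coset f = \<zero>\<^bsub>Q\<^esub>" by (simp add: Q_simps)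
  then show ?thesis using f by (intro Q.minus_equality) (simp_all add: coset_in)
qed

text \<open>The chain is pulled back along the coset map to ideals of the polynomial ring that
  contain the vanishing ideal, where \<open>no_three_poly\<close> applies.\<close>

lemma no_three:
  assumes I: "\<And>i. i \<le> 3 \<Longrightarrow> ideal (I i) Q" "\<And>i. i < 3 \<Longrightarrow> I i \<subseteq> I (Suc i)" "I 3 \<noteq> carrier Q"
    and x: "\<And>i. i < 3 \<Longrightarrow> x i \<in> I (Suc i)"
    and nzd: "\<And>i y. i < 3 \<Longrightarrow> y \<in> carrier Q \<Longrightarrow> x i \<otimes>\<^bsub>Q\<^esub> y \<in> I i \<Longrightarrow> y \<in> I i"
  shows False
proof -
  interpret Q: cring Q by (rule Q_cring)
  have "\<exists>f. f \<in> polys W \<and> x i = coset f" if "i < 3" for i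
  proof -
    have "x i \<in> carrier Q" using x[OF that] ideal.Icarr[OF I(1)[of "Suc i"]] that by simp
    then show ?thesis by (rule Q_rep)
  qed
  then have "\<forall>i. \<exists>f. i < 3 \<longrightarrow> f \<in> polys W \<and> x i = coset f" by blast
  from choice[OF this] obtain f where f: "\<And>i. i < 3 \<Longrightarrow> f i \<in> polys W" "\<And>i. i < 3 \<Longrightarrow> x i = coset (f i)" by blast
  define P where "P i = {g \<in> polys W. coset g \<in> I i}" for i
  show False
  proof (rule no_three_poly[of W "curve_param n m" P f])
    show "curve_param n m i \<in> polys {1, 2}" if "i \<in> W" for i
      by (auto simp: curve_param_def)
  next
    fix i :: nat assume i: "i \<le> 3"
    note Ii = I(1)[OF i]
    show "ideal_set W (P i)" unfolding ideal_set_def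
    proof (intro conjI ballI)
      fix g h assume "g \<in> P i" "h \<in> P i"
      then have gh: "g \<in> polys W" "h \<in> polys W" "coset g \<in> I i" "coset h \<in> I i" unfolding P_def by simp_all
      have "\<ominus>\<^bsub>Q\<^esub> coset h \<in> I i" using additive_subgroup.a_inv_closed[OF ideal.axioms(1)[OF Ii] gh(4)] .
      then have "coset g \<oplus>\<^bsub>Q\<^esub> coset (- h) \<in> I i"
        using additive_subgroup.a_closed[OF ideal.axioms(1)[OF Ii] gh(3)] gh(2) by (simp add: coset_uminus)
      then show "g - h \<in> P i" unfolding P_def using gh by (simp add: Q_simps)
    next
      fix g h :: "'k mpoly" assume "g \<in> P i" and h: "h \<in> polys W"
      then have g: "g \<in> polys W" "coset g \<in> I i" unfolding P_def by simp_all
      have "coset h \<otimes>\<^bsub>Q\<^esub> coset g \<in> I i" by (rule ideal.I_l_closed[OF Ii g(2) coset_in[OF h]])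
      then show "h * g \<in> P i" unfolding P_def using g h by (simp add: Q_simps)
    qed
  next
    fix i :: nat assume "i < 3"
    then show "P i \<subseteq> P (Suc i)" using I(2)[of i] unfolding P_def by blast
  next
    show "1 \<notin> P 3"
    proof
      assume "1 \<in> P 3"
      then have "\<one>\<^bsub>Q\<^esub> \<in> I 3" unfolding P_def by (simp add: Q_simps)
      then show False using I(3) ideal.one_imp_carrier[OF I(1)[of 3]] by simp
    qed
  next
    fix g assume "g \<in> polys W" "\<phi> g = 0"
    then have "coset g = \<zero>\<^bsub>Q\<^esub>" using coset_eq[of g 0] by (simp add: Q_simps)
    then show "g \<in> P 0" unfolding P_def using \<open>g \<in> polys W\<close> additive_subgroup.zero_closed[OF ideal.axioms(1)[OF I(1)[of 0]]] by simp
  next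
    fix i :: nat assume i: "i < 3"
    show "f i \<in> polys W" by (rule f(1)[OF i])
    show "f i \<in> P (Suc i)" unfolding P_def using f[OF i] x[OF i] by simp
    fix y assume y: "y \<in> polys W" "f i * y \<in> P i"
    then have "x i \<otimes>\<^bsub>Q\<^esub> coset y \<in> I i" using f[OF i] unfolding P_def by (simp add: Q_simps)
    then show "y \<in> P i" unfolding P_def using nzd[OF i coset_in[OF y(1)]] y(1) by simp
  qed
qed

text \<open>Modulo a prime every element outside it is a nonzerodivisor, so any choice of elements
  witnessing that the inclusions are strict satisfies the conditions of
  \<open>no_three\<close>.\<close>

lemma krull_le: "krull_dim Q \<le> 2"
  unfolding krull_dim_def
proof (rule Sup_least, clarify)
  fix k P assume P: "\<forall>i\<le>k. primeideal (P i) Q" "\<forall>i<k. P i \<subset> P (Suc i)"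
  have "\<not> k \<ge> 3"
  proof
    assume k: "k \<ge> 3"
    have "\<forall>i. \<exists>x. i < 3 \<longrightarrow> x \<in> P (Suc i) \<and> x \<notin> P i" using P(2) k by (metis less_le_trans psubset_imp_ex_mem DiffE)
    from choice[OF this] obtain x where x: "\<And>i. i < 3 \<Longrightarrow> x i \<in> P (Suc i)" "\<And>i. i < 3 \<Longrightarrow> x i \<notin> P i" by blast
    have prime_of: "primeideal (P i) Q" if "i \<le> 3" for i using P(1) k that by simp
    show False
    proof (rule no_three[of P x])
      show "ideal (P i) Q" if "i \<le> 3" for i using prime_of[OF that] by (rule primeideal.axioms(1))
      show "P i \<subseteq> P (Suc i)" if "i < 3" for i using P(2) k that by (metis less_le_trans psubset_imp_subset)
      show "P 3 \<noteq> carrier Q" using primeideal.I_notcarr[OF prime_of[of 3]] by simp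
      show "x i \<in> P (Suc i)" if "i < 3" for i by (rule x(1)[OF that])
      fix i :: nat and y assume i: "i < 3" and y: "y \<in> carrier Q" "x i \<otimes>\<^bsub>Q\<^esub> y \<in> P i"
      have "x i \<in> carrier Q" using x(1)[OF i] ideal.Icarr[OF primeideal.axioms(1)[OF prime_of[of "Suc i"]]] i by simp
      then show "y \<in> P i" using primeideal.I_prime[OF prime_of[of i]] i y x(2)[OF i] by force
    qed
  qed
  then show "enat k \<le> 2" by (simp add: numeral_eq_enat)
qed

text \<open>The ideals generated by the initial segments of a regular sequence form the chain for
  \<open>no_three\<close>.\<close>

lemma depth_le: "depth Q I \<le> 2"
  unfolding depth_def
proof (rule Sup_least, clarify)
  fix xs assume rs: "regular_sequence Q xs"
  interpret Q: cring Q by (rule Q_cring)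
  have xc: "set xs \<subseteq> carrier Q" and nt: "genideal Q (set xs) \<noteq> carrier Q"
    and reg: "\<And>i a. i < length xs \<Longrightarrow> a \<in> carrier Q \<Longrightarrow> xs ! i \<otimes>\<^bsub>Q\<^esub> a \<in> genideal Q (set (take i xs)) \<Longrightarrow> a \<in> genideal Q (set (take i xs))"
    using rs unfolding regular_sequence_def by blast+
  have "\<not> length xs \<ge> 3"
  proof
    assume k: "length xs \<ge> 3"
    have tk: "set (take i xs) \<subseteq> carrier Q" for i using xc set_take_subset[of i xs] by blast
    have mono: "genideal Q S \<subseteq> genideal Q T" if "S \<subseteq> T" "T \<subseteq> carrier Q" for S T
      using that Q.genideal_self[of T] by (intro Q.genideal_minimal Q.genideal_ideal) auto
    show False
    proof (rule no_three[of "\<lambda>i. genideal Q (set (take i xs))" "\<lambda>i. xs ! i"])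
      show "ideal (genideal Q (set (take i xs))) Q" for i by (rule Q.genideal_ideal[OF tk])
      show "genideal Q (set (take i xs)) \<subseteq> genideal Q (set (take (Suc i) xs))" for i
        by (rule mono[OF set_take_subset_set_take tk]) simp
      show "genideal Q (set (take 3 xs)) \<noteq> carrier Q"
      proof
        assume "genideal Q (set (take 3 xs)) = carrier Q"
        then have "carrier Q \<subseteq> genideal Q (set xs)" using mono[OF set_take_subset xc, of 3] by simp
        moreover have "genideal Q (set xs) \<subseteq> carrier Q" using ideal.Icarr[OF Q.genideal_ideal[OF xc]] by blast
        ultimately show False using nt by blast
      qed
      fix i :: nat assume i: "i < 3"
      have "xs ! i \<in> set (take (Suc i) xs)" using i k by (simp add: take_Suc_conv_app_nth)
      then show "xs ! i \<in> genideal Q (set (take (Suc i) xs))" using Q.genideal_self[OF tk] by blast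
      show "y \<in> genideal Q (set (take i xs))" if "y \<in> carrier Q" "xs ! i \<otimes>\<^bsub>Q\<^esub> y \<in> genideal Q (set (take i xs))" for y
        using reg[of i y] i k that by simp
    qed
  qed
  then show "enat (length xs) \<le> 2" by (simp add: numeral_eq_enat)
qed

text \<open>The kernel of a homomorphism from the quotient ring to polynomials: parametrize, then
  substitute \<open>\<alpha>\<close> for \<open>u\<close> and \<open>v\<close>. It is prime because
  the target is a domain.\<close>

definition prime_of :: "(nat \<Rightarrow> 'k mpoly) \<Rightarrow> 'k mpoly set set" where
  "prime_of \<alpha> = coset ` {f \<in> polys W. poly_subst \<alpha> (\<phi> f) = 0}"

lemma prime_of_iff: "f \<in> polys W \<Longrightarrow> coset f \<in> prime_of \<alpha> \<longleftrightarrow> poly_subst \<alpha> (\<phi> f) = 0"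
proof -
  assume f: "f \<in> polys W"
  have "poly_subst \<alpha> (\<phi> f) = 0" if "g \<in> polys W" "poly_subst \<alpha> (\<phi> g) = 0" "coset f = coset g" for g
    using coset_eq[OF f that(1)] that(2,3) by simp
  then show ?thesis using f unfolding prime_of_def by blast
qed

lemma prime_of_prime: "primeideal (prime_of \<alpha>) Q"
proof -
  interpret Q: cring Q by (rule Q_cring)
  show ?thesis
  proof (rule primeidealI)
    show "ideal (prime_of \<alpha>) Q"
    proof (rule idealI)
      show "ring Q" by (rule Q.ring_axioms)
      show "subgroup (prime_of \<alpha>) (add_monoid Q)"
      proof (rule Q.add.subgroupI)
        show "prime_of \<alpha> \<subseteq> carrier Q" unfolding prime_of_def using coset_in by blast
        have "coset 0 \<in> prime_of \<alpha>" by (simp add: prime_of_iff)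
        then show "prime_of \<alpha> \<noteq> {}" by blast
      next
        fix x assume "x \<in> prime_of \<alpha>"
        then obtain f where f: "f \<in> polys W" "x = coset f" "poly_subst \<alpha> (\<phi> f) = 0" unfolding prime_of_def by blast
        then show "\<ominus>\<^bsub>Q\<^esub> x \<in> prime_of \<alpha>" by (simp add: coset_uminus prime_of_iff poly_subst_uminus)
      next
        fix x y assume "x \<in> prime_of \<alpha>" "y \<in> prime_of \<alpha>"
        then obtain f g where fg: "f \<in> polys W" "x = coset f" "poly_subst \<alpha> (\<phi> f) = 0"
          "g \<in> polys W" "y = coset g" "poly_subst \<alpha> (\<phi> g) = 0" unfolding prime_of_def by blast
        then show "x \<oplus>\<^bsub>Q\<^esub> y \<in> prime_of \<alpha>" by (simp add: Q_simps prime_of_iff poly_subst_add)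
      qed
    next
      fix x y assume x: "x \<in> prime_of \<alpha>" and y: "y \<in> carrier Q"
      obtain f g where fg: "f \<in> polys W" "x = coset f" "poly_subst \<alpha> (\<phi> f) = 0" "g \<in> polys W" "y = coset g"
        using x Q_rep[OF y] unfolding prime_of_def by blast
      then show "y \<otimes>\<^bsub>Q\<^esub> x \<in> prime_of \<alpha>" "x \<otimes>\<^bsub>Q\<^esub> y \<in> prime_of \<alpha>" by (simp_all add: Q_simps prime_of_iff poly_subst_mult)
    qed
    show "cring Q" by (rule Q_cring)
    have "coset 1 \<notin> prime_of \<alpha>" by (simp add: prime_of_iff)
    then show "carrier Q \<noteq> prime_of \<alpha>" using coset_in[of 1] by auto
    fix x y assume x: "x \<in> carrier Q" and y: "y \<in> carrier Q" and xy: "x \<otimes>\<^bsub>Q\<^esub> y \<in> prime_of \<alpha>"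
    obtain f g where fg: "f \<in> polys W" "x = coset f" "g \<in> polys W" "y = coset g" using Q_rep[OF x] Q_rep[OF y] by blast
    then show "x \<in> prime_of \<alpha> \<or> y \<in> prime_of \<alpha>" using xy by (simp add: Q_simps prime_of_iff poly_subst_mult)
  qed
qed

definition ev1 :: "nat \<Rightarrow> 'k mpoly" where "ev1 i = (if i = 1 then Var 1 else 0)"

lemma V_mem: "n + 1 \<in> W" "Suc n \<in> W" "n \<in> W" using n2 by (auto simp: W_def)

lemma phi_Var: "\<phi> (Var (n + 1)) = Var 2 ^ M" "\<phi> (Var n) = Var 1 ^ M"
  by (simp_all add: curve_param_def m_n)

lemma Var_nonzero: "(Var i :: 'k mpoly) \<noteq> 0"
  unfolding Var_def by (metis lookup_single_eq lookup_zero zero_neq_one)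

lemma subst_Var: "poly_subst Var f = f" for f :: "'k mpoly"
proof (induction f rule: mpoly_induct)
  case (monomial t c)
  have pw: "(\<Prod>i\<in>B. Var i ^ lookup t i) = single (\<Sum>i\<in>B. single i (lookup t i)) (1::'k)" for B
    by (induction B rule: infinite_finite_induct) (simp_all add: Var_power mult_single)
  have "t = (\<Sum>i\<in>keys t. single i (lookup t i))"
    by (rule poly_mapping_eqI) (simp add: lookup_sum lookup_single when_def in_keys_iff sum.delta')
  then have "subst_mon Var t = single t (1::'k)" unfolding subst_mon_def pw by simp
  then show ?case unfolding poly_subst_single by (simp only: single_eq_Const[symmetric])
qed (simp_all add: poly_subst_add)

lemma ev0_ev1: "poly_subst ev1 g = 0 \<Longrightarrow> poly_subst (\<lambda>_. 0) g = (0::'k mpoly)"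
proof -
  assume g: "poly_subst ev1 g = 0"
  have "poly_subst (\<lambda>_. 0) (poly_subst ev1 g) = poly_subst (\<lambda>i. poly_subst (\<lambda>_. 0) (ev1 i)) g"
    by (rule poly_subst_compose)
  also have "(\<lambda>i. poly_subst (\<lambda>_. 0) (ev1 i)) = (\<lambda>_. 0 :: 'k mpoly)" by (auto simp: ev1_def)
  finally show ?thesis using g by simp
qed

text \<open>The chain consists of the kernels for the identity, for \<open>v = 0\<close> and for
  \<open>u = v = 0\<close>. It is strict because \<open>x_(n+1)\<close> and \<open>x_n\<close> are
  sent to \<open>v^M\<close> and \<open>u^M\<close>.\<close>

lemma krull_ge: "2 \<le> krull_dim Q"
proof -
  define P where "P i = (if i = 0 then prime_of Var else if i = 1 then prime_of ev1 else prime_of (\<lambda>_. 0))" for i :: nat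
  have M0: "M \<noteq> 0" using M_pos by simp
  have e1: "poly_subst ev1 (\<phi> (Var (n + 1))) = 0" "poly_subst ev1 (\<phi> (Var n)) = Var 1 ^ M"
    using M0 unfolding phi_Var by (simp_all add: poly_subst_power ev1_def)
  have e0: "poly_subst (\<lambda>_. 0) (\<phi> (Var n)) = (0 :: 'k mpoly)"
    using M0 unfolding phi_Var by (simp add: poly_subst_power)
  have "prime_of Var \<subset> prime_of ev1"
  proof
    show "prime_of Var \<subseteq> prime_of ev1" unfolding prime_of_def by (auto simp: subst_Var)
    have "coset (Var (n + 1)) \<in> prime_of ev1" using e1(1) V_mem(1) by (subst prime_of_iff) simp_all
    moreover have "coset (Var (n + 1)) \<notin> prime_of Var" using V_mem(1) Var_nonzero phi_Var(1) by (subst prime_of_iff) (simp_all add: subst_Var)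
    ultimately show "prime_of Var \<noteq> prime_of ev1" by blast
  qed
  moreover have "prime_of ev1 \<subset> prime_of (\<lambda>_. 0)"
  proof
    show "prime_of ev1 \<subseteq> prime_of (\<lambda>_. 0)" unfolding prime_of_def using ev0_ev1 by blast
    have "coset (Var n) \<in> prime_of (\<lambda>_. 0)" using e0 V_mem(3) by (subst prime_of_iff) simp_all
    moreover have "coset (Var n) \<notin> prime_of ev1" using e1(2) V_mem(3) Var_nonzero by (subst prime_of_iff) simp_all
    ultimately show "prime_of ev1 \<noteq> prime_of (\<lambda>_. 0)" by blast
  qed
  ultimately have "(\<forall>i\<le>2. primeideal (P i) Q) \<and> (\<forall>i<2. P i \<subset> P (Suc i))"
    using prime_of_prime by (auto simp: P_def less_2_cases_iff)
  then have "enat 2 \<le> krull_dim Q" unfolding krull_dim_def by (intro Sup_upper) blast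
  then show ?thesis by (simp add: numeral_eq_enat)
qed

lemma zero_ideal: "genideal Q {} = {\<zero>\<^bsub>Q\<^esub>}"
proof
  interpret Q: cring Q by (rule Q_cring)
  show "genideal Q {} \<subseteq> {\<zero>\<^bsub>Q\<^esub>}" by (rule Q.genideal_minimal[OF Q.zeroideal]) simp
  show "{\<zero>\<^bsub>Q\<^esub>} \<subseteq> genideal Q {}"
    using additive_subgroup.zero_closed[OF ideal.axioms(1)[OF Q.genideal_ideal[of "{}"]]] by simp
qed

lemma phi_S: "f \<in> polys W \<Longrightarrow> \<phi> f \<in> kspan S"
  unfolding A_eq[symmetric] A_def[folded W_def] by blast

text \<open>\<open>x_(n+1)\<close> is a nonzerodivisor because the parametrization embeds the
  quotient ring in a domain; for \<open>x_n\<close> the exponents on both sides of an equation are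
  compared by \<open>depth_T1\<close>. The ideal of the pair is proper since it lies in the kernel
  of evaluation at the origin.\<close>

lemma regular_pair: "regular_sequence Q [coset (Var (n + 1)), coset (Var n)]"
proof -
  interpret Q: cring Q by (rule Q_cring)
  let ?x = "coset (Var (n + 1))" and ?y = "coset (Var n)"
  have xy: "?x \<in> carrier Q" "?y \<in> carrier Q" using V_mem by (simp_all add: coset_in)
  have M0: "M \<noteq> 0" using M_pos by simp
  note p = prime_of_prime[of "\<lambda>_. 0"]
  have "?x \<in> prime_of (\<lambda>_. 0)" "?y \<in> prime_of (\<lambda>_. 0)"
    using V_mem M0 phi_Var by (simp_all add: prime_of_iff poly_subst_power)
  then have "genideal Q {?x, ?y} \<subseteq> prime_of (\<lambda>_. 0)"
    by (intro Q.genideal_minimal primeideal.axioms(1)[OF p]) simp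
  moreover have "prime_of (\<lambda>_. 0) \<subset> carrier Q"
    using primeideal.I_notcarr[OF p] ideal.Icarr[OF primeideal.axioms(1)[OF p]] by blast
  ultimately have proper: "genideal Q {?x, ?y} \<noteq> carrier Q" by blast
  have reg0: "a \<in> genideal Q {}" if aa: "a \<in> carrier Q" "?x \<otimes>\<^bsub>Q\<^esub> a \<in> genideal Q {}" for a
  proof -
    obtain f where f: "f \<in> polys W" "a = coset f" using Q_rep[OF aa(1)] by blast
    have "coset (Var (n + 1) * f) = coset 0" using aa(2) f V_mem(1) by (simp add: zero_ideal Q_simps)
    then have "\<phi> (Var (n + 1)) * \<phi> f = 0" using f V_mem(1) coset_eq[of "Var (n + 1) * f" 0] by (simp add: poly_subst_mult)
    then have "\<phi> f = 0" using Var_nonzero unfolding phi_Var by simp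
    then have "coset f = coset 0" using coset_eq[OF f(1), of 0] by simp
    then show ?thesis using f(2) by (simp add: zero_ideal Q_simps)
  qed
  have reg1: "a \<in> genideal Q {?x}" if aa: "a \<in> carrier Q" "?y \<otimes>\<^bsub>Q\<^esub> a \<in> genideal Q {?x}" for a
  proof -
    have gi: "genideal Q {?x} = {z \<otimes>\<^bsub>Q\<^esub> ?x | z. z \<in> carrier Q}"
      using Q.cgenideal_eq_genideal[OF xy(1)] unfolding cgenideal_def by simp
    obtain f where f: "f \<in> polys W" "a = coset f" using Q_rep[OF aa(1)] by blast
    obtain z where z: "z \<in> carrier Q" "?y \<otimes>\<^bsub>Q\<^esub> a = z \<otimes>\<^bsub>Q\<^esub> ?x" using aa(2) unfolding gi by blast
    obtain g where g: "g \<in> polys W" "?y \<otimes>\<^bsub>Q\<^esub> a = coset g \<otimes>\<^bsub>Q\<^esub> ?x" using Q_rep[OF z(1)] z(2) by blast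
    have "coset (Var n * f) = coset (g * Var (n + 1))" using g f V_mem by (simp add: Q_simps)
    then have "\<phi> (Var n * f) = \<phi> (g * Var (n + 1))" using f g V_mem coset_eq[of "Var n * f" "g * Var (n + 1)"] by simp
    then have "curve_param n m n * \<phi> f = curve_param n m (n + 1) * \<phi> g" by (simp only: poly_subst_mult poly_subst_Var mult.commute)
    then have e: "single (gen n) 1 * \<phi> f = single (gen (n + 1)) 1 * \<phi> g" using V_mem by (simp only: param[folded W_def])
    \<comment> \<open>All exponents of the image of \<open>f\<close> lie in
      \<open>gen (n + 1) + S\<close>. So the image is the monomial of \<open>x_(n+1)\<close> times
      some \<open>w\<close> in \<open>A\<close>, and a preimage \<open>h\<close> of \<open>w\<close>
      is the cofactor that exhibits \<open>a\<close> as a multiple of \<open>?x\<close>.\<close>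
    have "s \<in> T1" if s: "s \<in> keys (\<phi> f)" for s
    proof -
      have "gen n + s \<in> keys (single (gen n) 1 * \<phi> f)" using s by (simp add: keys_single_times)
      then have "gen n + s \<in> (+) (gen (n + 1)) ` keys (\<phi> g)" unfolding e keys_single_times .
      then have "gen n + s \<in> T1" using phi_S[OF g(1)] unfolding T1_def kspan_def by blast
      moreover have "s \<in> S" using phi_S[OF f(1)] s unfolding kspan_def by blast
      ultimately show ?thesis using depth_T1 by blast
    qed
    then have "\<phi> f \<in> kspan ({} \<union> (+) (gen (n + 1)) ` S)" unfolding kspan_def T1_def by blast
    then obtain w where w: "w \<in> kspan S" "\<phi> f = single (gen (n + 1)) 1 * w"
      unfolding kspan_step[symmetric] kspan_empty by auto
    then obtain h where h: "h \<in> polys W" "w = \<phi> h" unfolding A_eq[symmetric] A_def[folded W_def] by blast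
    have "\<phi> f = \<phi> (h * Var (n + 1))"
      using w(2) h(2) param[folded W_def, OF V_mem(1), where 'k='k] by (simp add: poly_subst_mult mult.commute)
    then have "coset f = coset (h * Var (n + 1))" using coset_eq[OF f(1), of "h * Var (n + 1)"] h(1) V_mem(1) by simp
    then have "a = coset h \<otimes>\<^bsub>Q\<^esub> ?x" using f(2) h(1) V_mem(1) by (simp add: Q_simps)
    then show ?thesis unfolding gi using coset_in[OF h(1)] by blast
  qed
  show ?thesis unfolding regular_sequence_def
  proof (intro conjI allI impI ballI)
    show "set [?x, ?y] \<subseteq> carrier Q" using xy by simp
    show "genideal Q (set [?x, ?y]) \<noteq> carrier Q" using proper by simp
    fix i a assume i: "i < length [?x, ?y]" and a: "a \<in> carrier Q"
      "[?x, ?y] ! i \<otimes>\<^bsub>Q\<^esub> a \<in> genideal Q (set (take i [?x, ?y]))"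
    show "a \<in> genideal Q (set (take i [?x, ?y]))"
    proof (cases "i = 0")
      case True
      then show ?thesis using reg0 a by simp
    next
      case False
      then have "i = 1" using i by simp
      then show ?thesis using reg1 a by simp
    qed
  qed
qed

theorem cohen_macaulay: "graded_cohen_macaulay W J"
proof -
  let ?I = "(\<lambda>f. J +>\<^bsub>R\<^esub> f) ` irrelevant_ideal W"
  have irr: "Var i \<in> (irrelevant_ideal W :: 'k mpoly set)" if "i \<in> W" for i
    using that unfolding irrelevant_ideal_eq by (auto simp: Var_def lookup_single in_polys)
  have "set [coset (Var (n + 1)), coset (Var n)] \<subseteq> ?I" using irr V_mem unfolding coset_def by auto
  then have "enat (length [coset (Var (n + 1)), coset (Var n)]) \<le> depth Q ?I"
    unfolding depth_def using regular_pair by (intro Sup_upper) blast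
  then have "2 \<le> depth Q ?I" by (simp add: numeral_eq_enat numeral_2_eq_2)
  then have "depth Q ?I = 2" using depth_le by (intro antisym)
  moreover have "krull_dim Q = 2" using krull_le krull_ge by (intro antisym)
  ultimately show ?thesis unfolding graded_cohen_macaulay_def by simp
qed

theorem gorenstein_iff: "graded_gorenstein W J \<longleftrightarrow> [m 1 = 2] (mod (n - 1))"
  unfolding graded_gorenstein_def using cohen_macaulay last_rank_one_iff[folded W_def, where 'k='k] by simp

end

theorem corollary2p14:
  fixes n d :: nat and m :: "nat \<Rightarrow> nat"
  assumes "infinite (UNIV :: 'k::field set)"
    and "n \<ge> 2"
    and "\<forall>i\<in>{1..n}. m i > 0"
    and "d > 0"
    and "\<forall>i\<in>{1..n}. m i = m 1 + (i - 1) * d"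
    and "gcd (m 1) d = 1"
  shows "graded_gorenstein {1..n+1} (curve_ideal n m :: 'k mpoly set) \<longleftrightarrow> [m 1 = 2] (mod (n - 1))"
proof -
  interpret curve_ring n d m "TYPE('k)"
    by unfold_locales (use assms in blast)+
  show ?thesis by (rule gorenstein_iff[unfolded W_def])
qed

end
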